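(* There is a unique law $\mathcal{V}_0$ on $\mathcal{T}_{gen}$ such that, in the environment $\mathcal{V}_0$, $\mathbb{E}(t_\infty)<\infty$ and the law of $(\mathcal{G}^{\mathcal{V}_0}(0),\mathcal{C}^{\mathcal{V}_0}(0))$ is equal to $\mathcal{V}_0$. For $(G,C)\sim\mathcal{V}_0$: (i) the genealogical tree $G$ has the law of the critical binary Galton--Watson tree, with vertices labelled by spent times that are independent exponential random variables conditional on the rooted plane tree structure of $G$, the mean of the spent time of a given vertex being the reciprocal of the number of leaves above that vertex; (ii) the cluster $C$ has the law of the steady state cluster; (iii) given $G$, the root $\rho$ of $C$ is a uniform random leaf of $G$; (iv) for each non-leaf vertex $x$ of $G$, there is a unique edge $e_x$ of $C$ that joins a leaf of the left subtree above $x$ to a leaf of the right subtree above $x$; given $G$, these two leaves are independent uniform random leaves of these two subtrees, and the edges $e_x$ are mutually independent and independent of the choice of $\rho$.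
   Context: A rooted plane binary tree is a finite connected subgraph of the infinite binary tree (vertices: finite strings over $\{0,1\}$) containing the root (the empty string) in which every vertex has either $0$ or $2$ children. The leaves above a vertex are its descendant leaves (a leaf is above itself). The critical binary Galton--Watson tree is the random rooted plane binary tree in which each vertex independently has $0$ or $2$ children with probability $1/2$ each. $\mathcal{T}_{gen}$ is the space of pairs $(G,C)$ where $G$ is a finite rooted plane binary tree whose vertices are labelled by non-negative reals called spent times, and $C$ is a rooted tree whose vertex set is the set of leaves of $G$ (with the obvious topology and Borel $\sigma$-algebra). $G$ is called the genealogical tree and $C$ the cluster. Given a law $\mathcal{V}$ on $\mathcal{T}_{gen}$, define a process $(\mathcal{G}_1^{\mathcal{V}}(t),\mathcal{C}_1^{\mathcal{V}}(t))$ in $\mathcal{T}_{gen}$ as follows. At time $0$, $\mathcal{G}_1^{\mathcal V}(0)$ is a single vertex with spent time $0$ and $\mathcal{C}_1^{\mathcal V}(0)$ is that singleton. The spent time of the root of $\mathcal{G}_1^{\mathcal V}(t)$ increases at rate $1$; those of the other vertices are frozen. Jumps occur at rate equal to the current number of leaves. At a jump, take an independent sample $(G',C')\sim\mathcal{V}$; the new genealogical tree has a new root with spent time label $0$ whose two child subtrees are the previous genealogical tree and $G'$, with the previous tree being the left or the right one with probability $1/2$ each, independently; the new cluster is obtained by adding an edge from the root of $C'$ to an independent uniformly random vertex of the previous cluster, and keeping the root of the previous cluster. Let $t_\infty$ be the limit of the jump times. If $\mathbb{E}(t_\infty)<\infty$, let $(\mathcal{G}^{\mathcal V}(t),\mathcal{C}^{\mathcal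 V}(t))$, $t\in\mathbb{R}$, be the stationary process obtained by concatenating independent copies of $(\mathcal{G}_1^{\mathcal V},\mathcal{C}_1^{\mathcal V})$ on consecutive time intervals, restarting from the singleton at each explosion time, the copy whose interval contains $0$ being size-biased by its lifetime $t_\infty$, with time $0$ placed uniformly in that interval. The steady state cluster is the random finite rooted tree with law $\mathcal{W}_0$ defined as follows. For a law $\mathcal{W}$ on isomorphism classes of finite rooted graphs, let $\mathcal{C}_1^{\mathcal W}(t)$ be the process of rooted graphs started from a singleton root which, when it has $k$ vertices, at rate $k$ jumps by attaching an independent $\mathcal{W}$-distributed rooted graph, via an edge joining the root of that graph to a uniformly random vertex of the current graph; let $\mathcal{C}^{\mathcal W}(t)$ be the corresponding stationary process (returning to the singleton at explosion times). $\mathcal{W}_0$ is the unique law $\mathcal{W}$ for which $\mathcal{C}_1^{\mathcal W}$ explodes almost surely and $\mathcal{C}^{\mathcal W}(0)$ has law $\mathcal{W}$. *)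

theory Defs
  imports "HOL-Probability.Probability" "HOL-Probability.Product_PMF" "HOL-Library.Sublist"
begin

section \<open>Plane binary trees and rooted graphs\<close>

text \<open>
  Vertices of the infinite binary tree are strings over \<^typ>\<open>bool\<close>; \<^term>\<open>False\<close> stands for 0 (left)
  and \<^term>\<open>True\<close> for 1 (right). The children of \<open>v\<close> are \<open>v @ [False]\<close> and \<open>v @ [True]\<close>.
  A connected subgraph containing the root is determined by its (prefix-closed) vertex set.
\<close>

type_synonym vertex = "bool list"

definition plane_tree :: "vertex set \<Rightarrow> bool" where
  "plane_tree T \<longleftrightarrow> finite T \<and> [] \<in> T \<and> (\<forall>v b. v @ [b] \<in> T \<longrightarrow> v \<in> T) \<and>
     (\<forall>v\<in>T. v @ [False] \<in> T \<longleftrightarrow> v @ [True] \<in> T)"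

definition leaves :: "vertex set \<Rightarrow> vertex set" where
  "leaves T = {v \<in> T. \<forall>b. v @ [b] \<notin> T}"

definition leaves_above :: "vertex set \<Rightarrow> vertex \<Rightarrow> vertex set" where
  "leaves_above T v = {w \<in> leaves T. prefix v w}"

text \<open>
  A rooted graph is a triple of vertex set, edge set and root. Since \<^typ>\<open>vertex\<close> is countably
  infinite, every finite rooted graph is isomorphic to one with vertices in this type.
\<close>

type_synonym rgraph = "vertex set \<times> vertex set set \<times> vertex"

abbreviation verts :: "rgraph \<Rightarrow> vertex set" where "verts g \<equiv> fst g"
abbreviation edges :: "rgraph \<Rightarrow> vertex set set" where "edges g \<equiv> fst (snd g)"
abbreviation root_of :: "rgraph \<Rightarrow> vertex" where "root_of g \<equiv> snd (snd g)"

definition rooted_graph :: "rgraph \<Rightarrow> bool" where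
  "rooted_graph g \<longleftrightarrow> finite (verts g) \<and> root_of g \<in> verts g \<and>
     (\<forall>e\<in>edges g. e \<subseteq> verts g \<and> card e = 2)"

definition connected_graph :: "rgraph \<Rightarrow> bool" where
  "connected_graph g \<longleftrightarrow> (\<forall>u\<in>verts g. \<forall>v\<in>verts g. (u, v) \<in> {(a, b). {a, b} \<in> edges g}\<^sup>*)"

definition is_cycle :: "rgraph \<Rightarrow> vertex list \<Rightarrow> bool" where
  "is_cycle g p \<longleftrightarrow> 3 \<le> length p \<and> distinct p \<and>
     (\<forall>i<length p. {p ! i, p ! (Suc i mod length p)} \<in> edges g)"

definition rooted_tree :: "rgraph \<Rightarrow> bool" where
  "rooted_tree g \<longleftrightarrow> rooted_graph g \<and> connected_graph g \<and> (\<nexists>p. is_cycle g p)"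

definition singleton_graph :: rgraph where
  "singleton_graph = ({[]}, {}, [])"

text \<open>
  Disjoint union of \<open>g\<close> and \<open>h\<close> together with an edge from the vertex \<open>v\<close> of \<open>g\<close> to the root of \<open>h\<close>,
  rooted at the root of \<open>g\<close>. The two vertex sets are made disjoint by prefixing those of \<open>g\<close>
  with \<open>b\<close> and those of \<open>h\<close> with \<open>\<not> b\<close>.
\<close>

definition graft :: "bool \<Rightarrow> vertex \<Rightarrow> rgraph \<Rightarrow> rgraph \<Rightarrow> rgraph" where
  "graft b v g h =
     ((#) b ` verts g \<union> (#) (\<not> b) ` verts h,
      insert {b # v, (\<not> b) # root_of h}
        ((\<lambda>e. (#) b ` e) ` edges g \<union> (\<lambda>e. (#) (\<not> b) ` e) ` edges h),
      b # root_of g)"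

definition rooted_iso :: "rgraph \<Rightarrow> rgraph \<Rightarrow> bool" where
  "rooted_iso g h \<longleftrightarrow> (\<exists>f. bij_betw f (verts g) (verts h) \<and>
     (\<lambda>e. f ` e) ` edges g = edges h \<and> f (root_of g) = root_of h)"

definition iso_class :: "rgraph \<Rightarrow> rgraph set" where
  "iso_class g = {h. rooted_graph h \<and> rooted_iso g h}"

definition iso_classes :: "rgraph set set" where
  "iso_classes = iso_class ` {g. rooted_graph g}"


section \<open>Probabilistic preliminaries\<close>

definition law_on :: "'a measure \<Rightarrow> 'a measure \<Rightarrow> bool" where
  "law_on S M \<longleftrightarrow> prob_space M \<and> sets M = sets S"

text \<open>Under \<open>M\<close>, the conditional law of \<open>Y\<close> given \<open>X = x\<close> is \<open>K x\<close>.\<close>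

definition has_cond_law ::
    "'a measure \<Rightarrow> 'b measure \<Rightarrow> ('a \<Rightarrow> 'b) \<Rightarrow> 'c measure \<Rightarrow> ('a \<Rightarrow> 'c) \<Rightarrow> ('b \<Rightarrow> 'c measure) \<Rightarrow> bool" where
  "has_cond_law M S X R Y K \<longleftrightarrow>
     X \<in> M \<rightarrow>\<^sub>M S \<and> Y \<in> M \<rightarrow>\<^sub>M R \<and> K \<in> S \<rightarrow>\<^sub>M prob_algebra R \<and>
     (\<forall>A\<in>sets S. \<forall>B\<in>sets R.
        emeasure M {z \<in> space M. X z \<in> A \<and> Y z \<in> B} =
        (\<integral>\<^sup>+z. indicator A (X z) * emeasure (K (X z)) B \<partial>M))"

text \<open>The rate 1 exponential law, carried by the positive reals so that waiting times are surely positive.\<close>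

definition exp_clock :: "real measure" where
  "exp_clock = restrict_space (density lborel (exponential_density 1)) {0<..}"

text \<open>
  A sample from \<open>uniform_choices\<close> is a choice function \<open>p\<close> such that the \<open>p S\<close> are independent and
  uniform on \<open>S\<close>. Evaluating it at a set independent of \<open>p\<close> gives a uniform element of that set.
\<close>

definition uniform_choices :: "(vertex set \<Rightarrow> vertex) measure" where
  "uniform_choices = PiM {S. finite S \<and> S \<noteq> {}} uniform_count_measure"

text \<open>Jump times obtained from a sequence of waiting times.\<close>

definition jump_time :: "(nat \<Rightarrow> real) \<Rightarrow> nat \<Rightarrow> real" where
  "jump_time h n = (\<Sum>i<n. h i)"

definition explosion_time :: "(nat \<Rightarrow> real) \<Rightarrow> ennreal" where
  "explosion_time h = (SUP n. ennreal (jump_time h n))"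

definition jump_count :: "(nat \<Rightarrow> real) \<Rightarrow> real \<Rightarrow> nat" where
  "jump_count h t = (LEAST n. t < jump_time h (Suc n))"

text \<open>
  Given a process \<open>X \<omega> t\<close> for \<open>\<omega>\<close> distributed according to \<open>M\<close>, run for \<open>0 \<le> t < \<tau> \<omega>\<close>, the stationary
  process is built from independent copies indexed by the integers. Copy 0 is size-biased by its
  lifetime; an independent uniform variable \<open>u\<close> says which fraction of copy 0 lies before time 0.
  Copy \<open>i\<close> occupies the interval from \<open>cycle_start \<tau> (\<omega>, u) i\<close> to \<open>cycle_start \<tau> (\<omega>, u) (i + 1)\<close>.
\<close>

definition stationary_space :: "'w measure \<Rightarrow> ('w \<Rightarrow> ennreal) \<Rightarrow> ((int \<Rightarrow> 'w) \<times> real) measure" where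
  "stationary_space M \<tau> =
     PiM UNIV (\<lambda>i. if i = 0 then density M (\<lambda>\<omega>. \<tau> \<omega> / (\<integral>\<^sup>+\<omega>'. \<tau> \<omega>' \<partial>M)) else M)
     \<Otimes>\<^sub>M uniform_measure lborel {0..1}"

definition cycle_start :: "('w \<Rightarrow> ennreal) \<Rightarrow> (int \<Rightarrow> 'w) \<times> real \<Rightarrow> int \<Rightarrow> real" where
  "cycle_start \<tau> = (\<lambda>(\<omega>, u) i. - u * enn2real (\<tau> (\<omega> 0))
     + (\<Sum>j\<in>{0..<i}. enn2real (\<tau> (\<omega> j))) - (\<Sum>j\<in>{i..<0}. enn2real (\<tau> (\<omega> j))))"

definition stationary_process ::
    "('w \<Rightarrow> ennreal) \<Rightarrow> ('w \<Rightarrow> real \<Rightarrow> 'z) \<Rightarrow> (int \<Rightarrow> 'w) \<times> real \<Rightarrow> real \<Rightarrow> 'z" where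
  "stationary_process \<tau> X \<omega> t =
     (let i = (THE i. cycle_start \<tau> \<omega> i \<le> t \<and> t < cycle_start \<tau> \<omega> (i + 1))
      in X (fst \<omega> i) (t - cycle_start \<tau> \<omega> i))"


section \<open>The steady state cluster\<close>

text \<open>One input per jump: exponential clock, isomorphism class of the attached graph, uniform choices.\<close>

type_synonym cluster_input = "real \<times> rgraph set \<times> (vertex set \<Rightarrow> vertex)"

definition cluster_space :: "rgraph set measure \<Rightarrow> (nat \<Rightarrow> cluster_input) measure" where
  "cluster_space W = PiM UNIV (\<lambda>_. exp_clock \<Otimes>\<^sub>M W \<Otimes>\<^sub>M uniform_choices)"

primrec cluster_chain :: "(nat \<Rightarrow> cluster_input) \<Rightarrow> nat \<Rightarrow> rgraph" where
  "cluster_chain \<omega> 0 = singleton_graph"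
| "cluster_chain \<omega> (Suc n) = (case \<omega> n of (x, c, p) \<Rightarrow>
     graft False (p (verts (cluster_chain \<omega> n))) (cluster_chain \<omega> n) (SOME h. h \<in> c))"

definition cluster_wait :: "(nat \<Rightarrow> cluster_input) \<Rightarrow> nat \<Rightarrow> real" where
  "cluster_wait \<omega> n = fst (\<omega> n) / real (card (verts (cluster_chain \<omega> n)))"

definition cluster_lifetime :: "(nat \<Rightarrow> cluster_input) \<Rightarrow> ennreal" where
  "cluster_lifetime \<omega> = explosion_time (cluster_wait \<omega>)"

text \<open>The value outside the lifetime interval is an irrelevant convention.\<close>

definition cluster_process :: "(nat \<Rightarrow> cluster_input) \<Rightarrow> real \<Rightarrow> rgraph" where
  "cluster_process \<omega> t =
     (if 0 \<le> t \<and> ennreal t < cluster_lifetime \<omega>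
      then cluster_chain \<omega> (jump_count (cluster_wait \<omega>) t) else singleton_graph)"

text \<open>The stationary process only makes sense when the lifetime has finite expectation.\<close>

definition steady_state_cluster_law :: "rgraph set measure \<Rightarrow> bool" where
  "steady_state_cluster_law W \<longleftrightarrow>
     law_on (count_space iso_classes) W \<and>
     (AE \<omega> in cluster_space W. cluster_lifetime \<omega> < \<infinity>) \<and>
     (\<integral>\<^sup>+\<omega>. cluster_lifetime \<omega> \<partial>cluster_space W) < \<infinity> \<and>
     distr (stationary_space (cluster_space W) cluster_lifetime) (count_space iso_classes)
       (\<lambda>\<omega>. iso_class (stationary_process cluster_lifetime cluster_process \<omega> 0)) = W"

definition W0 :: "rgraph set measure" where
  "W0 = (THE W. steady_state_cluster_law W)"


section \<open>Genealogical trees and clusters\<close>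

text \<open>
  A genealogical tree is a plane tree with its spent times, extended by 0 outside the tree.
  The topology is that of the countable disjoint union, over all pairs of a plane tree \<open>T\<close> and a
  cluster on the leaves of \<open>T\<close>, of the spaces of non-negative labellings of \<open>T\<close>. As there are
  only countably many trees and clusters, its Borel sets form the trace on \<open>T_gen\<close> of the product
  of discrete sigma-algebras with the product Borel sigma-algebra of the labels.
\<close>

type_synonym gtree = "vertex set \<times> (vertex \<Rightarrow> real)"
type_synonym gstate = "gtree \<times> rgraph"

definition T_gen :: "gstate set" where
  "T_gen = {((T, s), C). plane_tree T \<and> (\<forall>v. 0 \<le> s v) \<and> (\<forall>v. v \<notin> T \<longrightarrow> s v = 0) \<and>
     rooted_tree C \<and> verts C = leaves T}"

definition gtree_space :: "gtree measure" where
  "gtree_space = count_space {T. plane_tree T} \<Otimes>\<^sub>M PiM UNIV (\<lambda>_. borel)"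

definition gen_space :: "gstate measure" where
  "gen_space = restrict_space (gtree_space \<Otimes>\<^sub>M count_space {C. rooted_tree C}) T_gen"

abbreviation shape :: "gstate \<Rightarrow> vertex set" where "shape z \<equiv> fst (fst z)"
abbreviation spent :: "gstate \<Rightarrow> vertex \<Rightarrow> real" where "spent z \<equiv> snd (fst z)"
abbreviation cluster :: "gstate \<Rightarrow> rgraph" where "cluster z \<equiv> snd z"

definition singleton_state :: gstate where
  "singleton_state = (({[]}, \<lambda>_. 0), singleton_graph)"

definition age :: "real \<Rightarrow> gstate \<Rightarrow> gstate" where
  "age a z = ((shape z, (spent z)([] := spent z [] + a)), cluster z)"

text \<open>
  The previous state \<open>z\<close> becomes the left (\<open>b = False\<close>) or right (\<open>b = True\<close>) subtree and the sample
  \<open>z'\<close> the other one; \<open>v\<close> is the vertex of the previous cluster to which the new cluster is attached.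
\<close>

definition merge :: "bool \<Rightarrow> vertex \<Rightarrow> gstate \<Rightarrow> gstate \<Rightarrow> gstate" where
  "merge b v z z' =
     ((insert [] ((#) b ` shape z \<union> (#) (\<not> b) ` shape z'),
       \<lambda>w. case w of [] \<Rightarrow> 0 | d # w' \<Rightarrow> if d = b then spent z w' else spent z' w'),
      graft b v (cluster z) (cluster z'))"

text \<open>One input per jump: exponential clock, side of the previous tree, sample from \<open>V\<close>, uniform choices.\<close>

type_synonym gen_input = "real \<times> bool \<times> gstate \<times> (vertex set \<Rightarrow> vertex)"

definition genealogy_space :: "gstate measure \<Rightarrow> (nat \<Rightarrow> gen_input) measure" where
  "genealogy_space V = PiM UNIV (\<lambda>_.
     exp_clock \<Otimes>\<^sub>M measure_pmf (bernoulli_pmf (1/2)) \<Otimes>\<^sub>M V \<Otimes>\<^sub>M uniform_choices)"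

text \<open>State immediately after the \<open>n\<close>th jump, when the spent time of the root is 0.\<close>

primrec genealogy_chain :: "(nat \<Rightarrow> gen_input) \<Rightarrow> nat \<Rightarrow> gstate" where
  "genealogy_chain \<omega> 0 = singleton_state"
| "genealogy_chain \<omega> (Suc n) = (case \<omega> n of (x, b, z', p) \<Rightarrow>
     let z = genealogy_chain \<omega> n
     in merge b (p (verts (cluster z))) (age (x / real (card (leaves (shape z)))) z) z')"

definition genealogy_wait :: "(nat \<Rightarrow> gen_input) \<Rightarrow> nat \<Rightarrow> real" where
  "genealogy_wait \<omega> n = fst (\<omega> n) / real (card (leaves (shape (genealogy_chain \<omega> n))))"

definition genealogy_lifetime :: "(nat \<Rightarrow> gen_input) \<Rightarrow> ennreal" where
  "genealogy_lifetime \<omega> = explosion_time (genealogy_wait \<omega>)"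

definition genealogy_process :: "(nat \<Rightarrow> gen_input) \<Rightarrow> real \<Rightarrow> gstate" where
  "genealogy_process \<omega> t =
     (if 0 \<le> t \<and> ennreal t < genealogy_lifetime \<omega>
      then let n = jump_count (genealogy_wait \<omega>) t
           in age (t - jump_time (genealogy_wait \<omega>) n) (genealogy_chain \<omega> n)
      else singleton_state)"

definition steady_environment :: "gstate measure \<Rightarrow> bool" where
  "steady_environment V \<longleftrightarrow>
     law_on gen_space V \<and>
     (\<integral>\<^sup>+\<omega>. genealogy_lifetime \<omega> \<partial>genealogy_space V) < \<infinity> \<and>
     distr (stationary_space (genealogy_space V) genealogy_lifetime) gen_space
       (\<lambda>\<omega>. stationary_process genealogy_lifetime genealogy_process \<omega> 0) = V"


section \<open>Critical binary Galton--Watson tree, spent times, crossing edges\<close>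

text \<open>The vertex \<open>v\<close>, if present, has two children iff \<open>c v\<close>. The resulting tree is almost surely finite.\<close>

definition gw_tree :: "(vertex \<Rightarrow> bool) \<Rightarrow> vertex set" where
  "gw_tree c = {v. \<forall>u. strict_prefix u v \<longrightarrow> c u}"

definition gw_coins :: "(vertex \<Rightarrow> bool) measure" where
  "gw_coins = PiM UNIV (\<lambda>_. measure_pmf (bernoulli_pmf (1/2)))"

definition gw_prob :: "vertex set \<Rightarrow> real" where
  "gw_prob T = measure gw_coins {c \<in> space gw_coins. gw_tree c = T}"

definition spent_time_law :: "vertex set \<Rightarrow> (vertex \<Rightarrow> real) measure" where
  "spent_time_law T = PiM UNIV (\<lambda>v.
     if v \<in> T then density lborel (exponential_density (real (card (leaves_above T v))))
     else return borel 0)"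

definition nonleaves :: "vertex set \<Rightarrow> vertex set" where
  "nonleaves T = T - leaves T"

definition joins_subtrees :: "vertex set \<Rightarrow> vertex \<Rightarrow> vertex \<times> vertex \<Rightarrow> bool" where
  "joins_subtrees T x = (\<lambda>(a, b).
     a \<in> leaves_above T (x @ [False]) \<and> b \<in> leaves_above T (x @ [True]))"

text \<open>
  The end points of the edge \<open>e\<^sub>x\<close>, the one in the left subtree first; the pair \<open>([], [])\<close> is the
  dummy value when \<open>x\<close> is not a non-leaf vertex.
\<close>

definition crossing_edge :: "gstate \<Rightarrow> vertex \<Rightarrow> vertex \<times> vertex" where
  "crossing_edge z x =
     (if x \<in> nonleaves (shape z)
      then THE (a, b). joins_subtrees (shape z) x (a, b) \<and> {a, b} \<in> edges (cluster z)
      else ([], []))"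

definition crossing_edges_law :: "vertex set \<Rightarrow> (vertex \<Rightarrow> vertex \<times> vertex) pmf" where
  "crossing_edges_law T = Pi_pmf (nonleaves T) ([], []) (\<lambda>x.
     pair_pmf (pmf_of_set (leaves_above T (x @ [False]))) (pmf_of_set (leaves_above T (x @ [True]))))"

end

theory Submission
  imports Defs
begin

text \<open>
  Write \<open>|z|\<close> for the number of leaves of a state \<open>z\<close> and \<open>\<theta>\<close> for the expected lifetime. Let \<open>Y\<^sub>n\<close> be the
  state just before jump \<open>n + 1\<close>. A state with \<open>k\<close> leaves is held for an exponential time of rate \<open>k\<close>, so
  the time spent in it amounts, in expectation, to \<open>1 / k\<close> times one observation at the end of the
  holding time. The law \<open>V\<close> of the stationary process at time 0 is the expected time average over one
  life, and therefore \<open>\<theta> \<integral> g dV = \<Sum>\<^sub>n E (g Y\<^sub>n / |Y\<^sub>n|)\<close>; this is \<open>present_integral\<close>.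

  If the attached samples also have law \<open>V\<close>, then \<open>Y\<^sub>n\<^sub>+\<^sub>1\<close> arises from \<open>Y\<^sub>n\<close> by merging it with a
  \<open>V\<close>-distributed state and letting the new root age. Summing over \<open>n\<close> turns stationarity into the
  balance equation
  \<open>\<theta> \<integral> |z| g(z) V(dz) = \<integral> g d\<iota> + \<theta> \<integral> \<integral> |y| E g(aged merge of y and z) V(dz) V(dy)\<close>,
  where \<open>\<iota>\<close> is the law of an aged singleton. Take \<open>g = 1 / |.|\<close>: as \<open>|y| / (|y| + |z|)\<close> has mean \<open>1/2\<close>
  by symmetry, this says \<open>\<theta> = 1 + \<theta> / 2\<close>, hence \<open>\<theta> = 2\<close>. Since sizes add up under merging, the equation
  expresses \<open>V\<close> on states of size \<open>n\<close> through \<open>V\<close> on smaller states. So it has at most one solution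
  (\<open>balanced_unique\<close>), and for a solution it forces the occupation measure of the growth process to be
  the right one, so that solutions are stationary (\<open>balanced_occupation\<close>). The same equivalence
  holds for isomorphism classes of clusters. Forgetting the genealogy maps balanced laws to balanced laws
  (\<open>balanced_clusters\<close>), which identifies the law of the cluster with \<open>W0\<close>.

  The solution is explicit: a critical Galton--Watson tree with independent spent times, and a cluster whose
  root and crossing edges are uniform and independent. To see that this law is balanced
  (\<open>gw_environment_balanced\<close>), look at the root of the tree. If it is not a leaf, the trees \<open>L\<close> and \<open>R\<close> above it
  are independent Galton--Watson trees. If the tree carried by \<open>y\<close> becomes the left one, the
  weight \<open>|y| = |L|\<close> turns the uniform root of the cluster of \<open>y\<close> into a sum over the leaves of \<open>L\<close>, while
  the uniform attachment vertex and the root of the cluster of \<open>z\<close> are independent uniform end points of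
  the new crossing edge. The mirror image contributes the sum over the leaves of \<open>R\<close>. Together the root
  runs over all leaves of the merged tree, which is what the weight \<open>|z|\<close> does to a uniform root on the
  left-hand side. The probability \<open>1/2\<close> of the side agrees with the recursion for the tree, and the
  ageing of the new root supplies its exponential spent time.
\<close>


section \<open>The balance equation\<close>

text \<open>The data of the balance equation: \<open>\<phi>\<close> merges two states with the help of the random input \<open>\<Xi>\<close>, the size
  \<open>sz\<close> is additive under merging, and \<open>\<iota>\<close> is the law of the first state. The locale serves both
  genealogies and isomorphism classes of clusters.\<close>

locale merging =
  fixes S :: "'s measure" and sz :: "'s \<Rightarrow> nat" and \<Xi> :: "'x measure"
    and \<phi> :: "'x \<Rightarrow> 's \<Rightarrow> 's \<Rightarrow> 's" and \<iota> :: "'s measure"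
  assumes prob_Xi: "prob_space \<Xi>"
    and phi_measurable: "(\<lambda>(\<xi>, y, z). \<phi> \<xi> y z) \<in> \<Xi> \<Otimes>\<^sub>M S \<Otimes>\<^sub>M S \<rightarrow>\<^sub>M S"
    and sz_measurable [measurable]: "sz \<in> S \<rightarrow>\<^sub>M count_space UNIV"
    and sz_pos: "z \<in> space S \<Longrightarrow> 0 < sz z"
    and sz_phi: "\<xi> \<in> space \<Xi> \<Longrightarrow> y \<in> space S \<Longrightarrow> z \<in> space S \<Longrightarrow> sz (\<phi> \<xi> y z) = sz y + sz z"
    and prob_iota: "prob_space \<iota>"
    and sets_iota [measurable_cong]: "sets \<iota> = sets S"
    and sz_iota: "AE z in \<iota>. sz z = 1"
begin

definition step_op :: "'s measure \<Rightarrow> ('s \<Rightarrow> ennreal) \<Rightarrow> 's \<Rightarrow> ennreal" where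
  "step_op V g y = (\<integral>\<^sup>+z. \<integral>\<^sup>+\<xi>. g (\<phi> \<xi> y z) \<partial>\<Xi> \<partial>V)"

text \<open>The factor \<open>\<theta>\<close> stands for the expected lifetime, so that \<open>\<theta> * sz\<close> times \<open>V\<close> is the expected number
  of visits.\<close>

definition balanced :: "ennreal \<Rightarrow> 's measure \<Rightarrow> bool" where
  "balanced \<theta> V \<longleftrightarrow> law_on S V \<and>
     (\<forall>g\<in>borel_measurable S. \<theta> * (\<integral>\<^sup>+z. of_nat (sz z) * g z \<partial>V) =
        (\<integral>\<^sup>+z. g z \<partial>\<iota>) + \<theta> * (\<integral>\<^sup>+y. of_nat (sz y) * step_op V g y \<partial>V))"

lemma balanced_law: "balanced \<theta> V \<Longrightarrow> law_on S V"
  by (simp add: balanced_def)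

lemma balanced_eq:
  assumes "balanced \<theta> V" "g \<in> borel_measurable S"
  shows "\<theta> * (\<integral>\<^sup>+z. of_nat (sz z) * g z \<partial>V) =
        (\<integral>\<^sup>+z. g z \<partial>\<iota>) + \<theta> * (\<integral>\<^sup>+y. of_nat (sz y) * step_op V g y \<partial>V)"
  using assms unfolding balanced_def by blast

definition evolves :: "'s measure \<Rightarrow> (nat \<Rightarrow> 's measure) \<Rightarrow> bool" where
  "evolves V P \<longleftrightarrow> (\<forall>n. sets (P n) = sets S) \<and> P 0 = \<iota> \<and>
     (\<forall>n. \<forall>g\<in>borel_measurable S. (\<integral>\<^sup>+z. g z \<partial>P (Suc n)) = (\<integral>\<^sup>+y. step_op V g y \<partial>P n))"

definition occupation :: "(nat \<Rightarrow> 's measure) \<Rightarrow> ('s \<Rightarrow> ennreal) \<Rightarrow> ennreal" where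
  "occupation P g = (\<Sum>n. \<integral>\<^sup>+z. g z \<partial>P n)"

lemma phi_measurable' [measurable (raw)]:
  assumes "f \<in> N \<rightarrow>\<^sub>M \<Xi>" "g \<in> N \<rightarrow>\<^sub>M S" "h \<in> N \<rightarrow>\<^sub>M S"
  shows "(\<lambda>x. \<phi> (f x) (g x) (h x)) \<in> N \<rightarrow>\<^sub>M S"
  using measurable_compose[OF measurable_Pair[OF assms(1) measurable_Pair[OF assms(2,3)]] phi_measurable]
  by simp

lemma weight_measurable [measurable (raw)]:
  "(\<lambda>z. w (sz z)) \<in> borel_measurable S" for w :: "nat \<Rightarrow> ennreal"
  by (rule measurable_compose[OF sz_measurable]) simp

lemma weighted_measurable:
  "g \<in> borel_measurable S \<Longrightarrow> (\<lambda>z. w (sz z) * g z) \<in> borel_measurable S" for w :: "nat \<Rightarrow> ennreal"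
  by (intro borel_measurable_times_ennreal weight_measurable)

lemma divided_measurable:
  "g \<in> borel_measurable S \<Longrightarrow> (\<lambda>z. g z / of_nat (sz z)) \<in> borel_measurable S" for g :: "'s \<Rightarrow> ennreal"
  using weighted_measurable[of g "\<lambda>n. inverse (of_nat n)"] by (simp add: divide_ennreal_def mult.commute)

lemma inner_measurable:
  assumes V: "law_on S V" and [measurable]: "g \<in> borel_measurable S"
  shows "(\<lambda>(y, z). \<integral>\<^sup>+\<xi>. g (\<phi> \<xi> y z) \<partial>\<Xi>) \<in> borel_measurable (S \<Otimes>\<^sub>M S)"
proof -
  interpret Xi: prob_space \<Xi> by (rule prob_Xi)
  note assms(2)[measurable]
  show ?thesis by measurable
qed

lemma step_op_measurable [measurable (raw)]:
  assumes V: "law_on S V" and g: "g \<in> borel_measurable S"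
  shows "step_op V g \<in> borel_measurable S"
proof -
  interpret V: prob_space V using V by (simp add: law_on_def)
  have [measurable_cong]: "sets V = sets S" using V by (simp add: law_on_def)
  note inner_measurable[OF V g, measurable]
  show ?thesis unfolding step_op_def[abs_def] by measurable
qed

lemma weighted_inner_measurable:
  fixes w :: "nat \<Rightarrow> ennreal"
  assumes "law_on S V" "g \<in> borel_measurable S"
  shows "(\<lambda>(y, z). w (sz y + sz z) * (\<integral>\<^sup>+\<xi>. g (\<phi> \<xi> y z) \<partial>\<Xi>)) \<in> borel_measurable (S \<Otimes>\<^sub>M S)"
proof -
  note inner_measurable[OF assms, measurable]
  show ?thesis by measurable
qed

lemma iterated_weighted_measurable:
  fixes w :: "nat \<Rightarrow> ennreal"
  assumes V: "law_on S V" and q: "(\<lambda>(y, z). q y z) \<in> borel_measurable (S \<Otimes>\<^sub>M S)"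
  shows "(\<lambda>y. \<integral>\<^sup>+z. w (sz z) * q y z \<partial>V) \<in> borel_measurable S"
proof -
  interpret V: prob_space V using V by (simp add: law_on_def)
  have [measurable_cong]: "sets V = sets S" using V by (simp add: law_on_def)
  note q[measurable]
  show ?thesis by measurable
qed

text \<open>The size of a merged state is known before the random input is drawn, so functions of the size
  factor out. This is the only way in which additivity of sizes enters.\<close>

lemma step_op_weight:
  assumes V: "law_on S V" and g: "g \<in> borel_measurable S" and y: "y \<in> space S"
  shows "step_op V (\<lambda>z. w (sz z) * g z) y =
    (\<integral>\<^sup>+z. w (sz y + sz z) * (\<integral>\<^sup>+\<xi>. g (\<phi> \<xi> y z) \<partial>\<Xi>) \<partial>V)"
proof -
  have sp: "space V = space S" using V by (metis law_on_def sets_eq_imp_space_eq)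
  have m: "(\<lambda>\<xi>. \<phi> \<xi> y z) \<in> \<Xi> \<rightarrow>\<^sub>M S" if "z \<in> space S" for z
    using y that by measurable
  show ?thesis unfolding step_op_def
  proof (rule nn_integral_cong)
    fix z assume "z \<in> space V"
    then have z: "z \<in> space S" using sp by simp
    have "(\<integral>\<^sup>+\<xi>. w (sz (\<phi> \<xi> y z)) * g (\<phi> \<xi> y z) \<partial>\<Xi>) = (\<integral>\<^sup>+\<xi>. w (sz y + sz z) * g (\<phi> \<xi> y z) \<partial>\<Xi>)"
      by (rule nn_integral_cong) (simp add: sz_phi y z)
    also have "\<dots> = w (sz y + sz z) * (\<integral>\<^sup>+\<xi>. g (\<phi> \<xi> y z) \<partial>\<Xi>)"
      using measurable_compose[OF m[OF z] g] by (rule nn_integral_cmult)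
    finally show "(\<integral>\<^sup>+\<xi>. w (sz (\<phi> \<xi> y z)) * g (\<phi> \<xi> y z) \<partial>\<Xi>) = \<dots>" .
  qed
qed

lemma occupation_recursion:
  assumes ev: "evolves V P" and g: "g \<in> borel_measurable S"
  shows "occupation P g = (\<integral>\<^sup>+z. g z \<partial>\<iota>) + occupation P (step_op V g)"
proof -
  have "(\<Sum>n. \<integral>\<^sup>+z. g z \<partial>P n) = (\<integral>\<^sup>+z. g z \<partial>P 0) + (\<Sum>n. \<integral>\<^sup>+z. g z \<partial>P (Suc n))"
    by (subst suminf_offset[where i = 1]) auto
  then show ?thesis using ev g by (simp add: occupation_def evolves_def)
qed

lemma of_nat_sz_cancel:
  assumes "z \<in> space S"
  shows "of_nat (sz z) * (a / of_nat (sz z)) = (a::ennreal)" "(a / of_nat (sz z)) * of_nat (sz z) = (a::ennreal)"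
proof -
  show "of_nat (sz z) * (a / of_nat (sz z)) = (a::ennreal)"
    using sz_pos[OF assms] by (metis ennreal_mult_divide_eq ennreal_times_divide mult.commute neq0_conv of_nat_eq_0_iff ennreal_of_nat_neq_top)
  then show "(a / of_nat (sz z)) * of_nat (sz z) = (a::ennreal)" by (simp add: mult.commute)
qed

lemma of_nat_sz_cancel':
  assumes "z \<in> space S"
  shows "of_nat (sz z) * (c * (a / of_nat (sz z))) = c * (a::ennreal)"
  by (simp only: mult.left_commute[of _ c] of_nat_sz_cancel[OF assms])

text \<open>Exchanging \<open>y\<close> and \<open>z\<close> shows that both fractions \<open>sz y / (sz y + sz z)\<close> and \<open>sz z / (sz y + sz z)\<close>
  have the same mean, and they add up to 1.\<close>

lemma half_by_symmetry:
  assumes V: "law_on S V"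
  shows "2 * (\<integral>\<^sup>+y. \<integral>\<^sup>+z. of_nat (sz y) * (1 / of_nat (sz y + sz z)) \<partial>V \<partial>V) = (1::ennreal)"
proof -
  interpret V: prob_space V using V by (simp add: law_on_def)
  interpret VV: pair_sigma_finite V V ..
  have [measurable_cong]: "sets V = sets S" using V by (simp add: law_on_def)
  have sp: "space V = space S" by (rule sets_eq_imp_space_eq) fact
  let ?f = "\<lambda>y z. of_nat (sz y) * (1 / of_nat (sz y + sz z)) :: ennreal"
  have "(\<integral>\<^sup>+y. \<integral>\<^sup>+z. ?f y z \<partial>V \<partial>V) = (\<integral>\<^sup>+z. \<integral>\<^sup>+y. ?f y z \<partial>V \<partial>V)"
    by (rule VV.Fubini'[symmetric]) measurable
  then have "2 * (\<integral>\<^sup>+y. \<integral>\<^sup>+z. ?f y z \<partial>V \<partial>V) = (\<integral>\<^sup>+y. \<integral>\<^sup>+z. ?f y z \<partial>V \<partial>V) + (\<integral>\<^sup>+y. \<integral>\<^sup>+z. ?f z y \<partial>V \<partial>V)"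
    by (simp add: mult_2)
  also have "\<dots> = (\<integral>\<^sup>+y. \<integral>\<^sup>+z. ?f y z + ?f z y \<partial>V \<partial>V)"
    by (subst nn_integral_add[symmetric]; (subst nn_integral_add[symmetric])?; measurable?)
  also have "\<dots> = (\<integral>\<^sup>+y. \<integral>\<^sup>+z. 1 \<partial>V \<partial>V)"
  proof (intro nn_integral_cong)
    fix y z assume "y \<in> space V" "z \<in> space V"
    then have p: "0 < sz y + sz z" using sz_pos sp by simp
    have "?f y z + ?f z y = (of_nat (sz y) + of_nat (sz z)) * (1 / of_nat (sz y + sz z))"
      by (simp add: distrib_right add.commute)
    also have "\<dots> = of_nat (sz y + sz z) / of_nat (sz y + sz z)"
      by (simp add: ennreal_times_divide)
    also have "\<dots> = 1" using p by (intro ennreal_divide_self) (simp_all add: of_nat_less_top del: of_nat_add)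
    finally show "?f y z + ?f z y = 1" .
  qed
  also have "\<dots> = 1" by (simp add: V.emeasure_space_1)
  finally show ?thesis .
qed

text \<open>The occupation functional satisfies a renewal-type recursion; expressing it through \<open>V\<close> gives the
  balance equation, whose test function \<open>1 / sz\<close> forces \<open>\<theta> = 2\<close>. Finiteness of \<open>\<theta>\<close> is what permits the
  cancellation.\<close>

theorem stationary_balanced:
  assumes V: "law_on S V" and ev: "evolves V P" and fin: "\<theta> < \<infinity>"
    and st: "\<And>g. g \<in> borel_measurable S \<Longrightarrow>
      \<theta> * (\<integral>\<^sup>+z. g z \<partial>V) = occupation P (\<lambda>z. g z / of_nat (sz z))"
  shows "balanced 2 V"
proof -
  interpret V: prob_space V using V by (simp add: law_on_def)
  have [measurable_cong]: "sets V = sets S" using V by (simp add: law_on_def)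
  have sp: "space V = space S" by (rule sets_eq_imp_space_eq) fact
  have spP: "space (P n) = space S" for n using ev by (metis evolves_def sets_eq_imp_space_eq)
  have occ: "\<theta> * (\<integral>\<^sup>+z. of_nat (sz z) * g z \<partial>V) = occupation P g"
    if [measurable]: "g \<in> borel_measurable S" for g
  proof -
    have "\<theta> * (\<integral>\<^sup>+z. of_nat (sz z) * g z \<partial>V) = occupation P (\<lambda>z. of_nat (sz z) * g z / of_nat (sz z))"
      by (rule st) measurable
    also have "\<dots> = occupation P g"
      unfolding occupation_def
      by (intro suminf_cong nn_integral_cong)
         (simp add: spP of_nat_sz_cancel ennreal_times_divide[symmetric])
    finally show ?thesis .
  qed
  have rec: "\<theta> * (\<integral>\<^sup>+z. of_nat (sz z) * g z \<partial>V) =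
        (\<integral>\<^sup>+z. g z \<partial>\<iota>) + \<theta> * (\<integral>\<^sup>+y. of_nat (sz y) * step_op V g y \<partial>V)"
    if g: "g \<in> borel_measurable S" for g
    by (simp add: occ g occ[OF step_op_measurable[OF V g]] occupation_recursion[OF ev g])
  have two: "\<theta> = 2"
  proof -
    interpret i: prob_space \<iota> by (rule prob_iota)
    let ?g = "\<lambda>z. 1 / of_nat (sz z) :: ennreal"
    have "(\<integral>\<^sup>+z. of_nat (sz z) * ?g z \<partial>V) = (\<integral>\<^sup>+z. 1 \<partial>V)"
      by (intro nn_integral_cong) (simp add: of_nat_sz_cancel sp)
    then have l: "(\<integral>\<^sup>+z. of_nat (sz z) * ?g z \<partial>V) = 1" by (simp add: V.emeasure_space_1)
    have i: "(\<integral>\<^sup>+z. ?g z \<partial>\<iota>) = (\<integral>\<^sup>+z. 1 \<partial>\<iota>)"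
      using sz_iota by (intro nn_integral_cong_AE) (auto elim: eventually_mono)
    have "(\<integral>\<^sup>+y. of_nat (sz y) * step_op V ?g y \<partial>V) =
       (\<integral>\<^sup>+y. \<integral>\<^sup>+z. of_nat (sz y) * (1 / of_nat (sz y + sz z)) \<partial>V \<partial>V)" (is "_ = ?I")
    proof (intro nn_integral_cong)
      fix y assume "y \<in> space V"
      then have y: "y \<in> space S" by (simp add: sp)
      have "step_op V (\<lambda>z. ?g z * 1) y = (\<integral>\<^sup>+z. ?g y * 0 + 1 / of_nat (sz y + sz z) * (\<integral>\<^sup>+\<xi>. 1 \<partial>\<Xi>) \<partial>V)"
        by (subst step_op_weight[OF V _ y, where w = "\<lambda>n. 1 / of_nat n"]) auto
      also have "\<dots> = (\<integral>\<^sup>+z. 1 / of_nat (sz y + sz z) \<partial>V)"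
        by (simp add: prob_space.emeasure_space_1[OF prob_Xi])
      finally show "of_nat (sz y) * step_op V ?g y = (\<integral>\<^sup>+z. of_nat (sz y) * (1 / of_nat (sz y + sz z)) \<partial>V)"
        by (simp del: of_nat_add) (subst nn_integral_cmult; measurable)
    qed
    then have "\<theta> = 1 + \<theta> * ?I" using rec[of ?g] l i by (simp add: i.emeasure_space_1 del: of_nat_add)
    then have "2 * \<theta> = 2 + \<theta> * (2 * ?I)"
      by (metis (no_types, lifting) distrib_left mult.left_commute mult_1_right)
    also have "2 * ?I = 1" using half_by_symmetry[OF V] .
    finally have "\<theta> + \<theta> = 2 + \<theta>" by (simp add: mult_2)
    then show ?thesis using fin by (auto simp: ennreal_add_left_cancel add.commute)
  qed
  show ?thesis using V rec unfolding two balanced_def by blast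
qed

text \<open>Since sizes are positive, a merged state of size at most \<open>n\<close> comes from two states of size less
  than \<open>n\<close>. All inductions on the size rest on this.\<close>

lemma step_op_truncate:
  assumes V: "law_on S V" and g: "g \<in> borel_measurable S" and y: "y \<in> space S"
  shows "step_op V (\<lambda>z. indicator {..<Suc n} (sz z) * g z) y =
    indicator {..<n} (sz y) * (\<integral>\<^sup>+z. indicator {..<n} (sz z) * (indicator {..n} (sz y + sz z) *
      (\<integral>\<^sup>+\<xi>. g (\<phi> \<xi> y z) \<partial>\<Xi>)) \<partial>V)"
proof -
  have sp: "space V = space S" using V by (metis law_on_def sets_eq_imp_space_eq)
  have "step_op V (\<lambda>z. indicator {..<Suc n} (sz z) * g z) y =
    (\<integral>\<^sup>+z. indicator {..<Suc n} (sz y + sz z) * (\<integral>\<^sup>+\<xi>. g (\<phi> \<xi> y z) \<partial>\<Xi>) \<partial>V)"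
    by (rule step_op_weight[OF V g y, where w = "indicator {..<Suc n}"])
  also have "\<dots> = (\<integral>\<^sup>+z. indicator {..<n} (sz y) * (indicator {..<n} (sz z) *
      (indicator {..n} (sz y + sz z) * (\<integral>\<^sup>+\<xi>. g (\<phi> \<xi> y z) \<partial>\<Xi>))) \<partial>V)"
    using sz_pos[OF y] by (intro nn_integral_cong) (auto simp: sp indicator_def dest!: sz_pos)
  also have "\<dots> = indicator {..<n} (sz y) * (\<integral>\<^sup>+z. indicator {..<n} (sz z) *
      (indicator {..n} (sz y + sz z) * (\<integral>\<^sup>+\<xi>. g (\<phi> \<xi> y z) \<partial>\<Xi>)) \<partial>V)"
    by (cases "sz y < n") auto
  finally show ?thesis .
qed

lemma nn_integral_by_truncation:
  assumes V: "sets V = sets S" and [measurable]: "g \<in> borel_measurable S"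
  shows "(\<integral>\<^sup>+z. g z \<partial>V) = (SUP n. \<integral>\<^sup>+z. indicator {..<n} (sz z) * g z \<partial>V)"
proof -
  have [measurable_cong]: "sets V = sets S" by fact
  have "(SUP n. indicator {..<n} (sz z) * g z) = g z" for z
  proof (rule antisym)
    show "(SUP n. indicator {..<n} (sz z) * g z) \<le> g z"
      by (rule SUP_least) (auto simp: indicator_def)
    have "indicator {..<Suc (sz z)} (sz z) * g z \<le> (SUP n. indicator {..<n} (sz z) * g z)"
      by (rule SUP_upper) simp
    then show "g z \<le> (SUP n. indicator {..<n} (sz z) * g z)" by simp
  qed
  then have "(\<integral>\<^sup>+z. g z \<partial>V) = (\<integral>\<^sup>+z. (SUP n. indicator {..<n} (sz z) * g z) \<partial>V)" by simp
  also have "\<dots> = (SUP n. \<integral>\<^sup>+z. indicator {..<n} (sz z) * g z \<partial>V)"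
    by (rule nn_integral_monotone_convergence_SUP)
       (auto simp: incseq_def le_fun_def indicator_def)
  finally show ?thesis .
qed

text \<open>Both the occupation functional and \<open>2 * sz\<close> times \<open>V\<close> solve the same linear recursion. Below size \<open>n\<close>
  it is triangular, so they agree by induction on \<open>n\<close>; monotone convergence removes the truncation.\<close>

theorem balanced_occupation:
  assumes bal: "balanced 2 V" and ev: "evolves V P" and g: "g \<in> borel_measurable S"
  shows "occupation P (\<lambda>z. g z / of_nat (sz z)) = 2 * (\<integral>\<^sup>+z. g z \<partial>V)"
proof -
  have V: "law_on S V" using bal by (rule balanced_law)
  interpret V: prob_space V using V by (simp add: law_on_def)
  have [measurable_cong]: "sets V = sets S" using V by (simp add: law_on_def)
  have sp: "space V = space S" by (rule sets_eq_imp_space_eq) fact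
  have spP: "space (P n) = space S" for n using ev by (metis evolves_def sets_eq_imp_space_eq)
  have trunc: "occupation P (\<lambda>z. indicator {..<n} (sz z) * h z) =
      2 * (\<integral>\<^sup>+z. of_nat (sz z) * (indicator {..<n} (sz z) * h z) \<partial>V)"
    if "h \<in> borel_measurable S" for h n
    using that
  proof (induction n arbitrary: h)
    case 0
    then show ?case by (simp add: occupation_def)
  next
    case (Suc n)
    let ?h = "\<lambda>z. indicator {..<Suc n} (sz z) * h z"
    have h: "?h \<in> borel_measurable S" by (rule weighted_measurable[OF Suc.prems])
    have k: "step_op V ?h \<in> borel_measurable S" by (rule step_op_measurable[OF V h])
    have idem: "indicator {..<n} (sz y) * step_op V ?h y = step_op V ?h y" if "y \<in> space S" for y
      unfolding step_op_truncate[OF V Suc.prems that] by (cases "sz y < n") simp_all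
    have "occupation P (step_op V ?h) = occupation P (\<lambda>y. indicator {..<n} (sz y) * step_op V ?h y)"
      unfolding occupation_def by (intro suminf_cong nn_integral_cong) (simp only: spP idem)
    also have "\<dots> = 2 * (\<integral>\<^sup>+z. of_nat (sz z) * (indicator {..<n} (sz z) * step_op V ?h z) \<partial>V)"
      by (rule Suc.IH[OF k])
    also have "(\<integral>\<^sup>+z. of_nat (sz z) * (indicator {..<n} (sz z) * step_op V ?h z) \<partial>V) =
        (\<integral>\<^sup>+z. of_nat (sz z) * step_op V ?h z \<partial>V)"
      by (intro nn_integral_cong) (simp only: sp idem)
    finally have "occupation P ?h = (\<integral>\<^sup>+z. ?h z \<partial>\<iota>) + 2 * (\<integral>\<^sup>+z. of_nat (sz z) * step_op V ?h z \<partial>V)"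
      by (simp only: occupation_recursion[OF ev h])
    also have "\<dots> = 2 * (\<integral>\<^sup>+z. of_nat (sz z) * ?h z \<partial>V)"
      by (rule balanced_eq[OF bal h, symmetric])
    finally show ?case .
  qed
  let ?g = "\<lambda>z. g z / of_nat (sz z)"
  have gm: "?g \<in> borel_measurable S" by (rule divided_measurable[OF g])
  have "occupation P ?g = (\<Sum>k. SUP n. \<integral>\<^sup>+z. indicator {..<n} (sz z) * ?g z \<partial>P k)"
    unfolding occupation_def
    using ev by (intro suminf_cong nn_integral_by_truncation[OF _ gm]) (simp add: evolves_def)
  also have "\<dots> = (SUP n. occupation P (\<lambda>z. indicator {..<n} (sz z) * ?g z))"
    unfolding occupation_def
    by (rule ennreal_suminf_SUP_eq)
       (auto simp: incseq_def indicator_def intro!: nn_integral_mono)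
  also have "\<dots> = (SUP n. 2 * (\<integral>\<^sup>+z. indicator {..<n} (sz z) * g z \<partial>V))"
    unfolding trunc[OF gm]
    by (intro SUP_cong refl arg_cong[where f = "\<lambda>a. 2 * a"] nn_integral_cong)
       (simp only: of_nat_sz_cancel' sp)
  also have "\<dots> = 2 * (SUP n. (\<integral>\<^sup>+z. indicator {..<n} (sz z) * g z \<partial>V))"
    by (rule SUP_mult_left_ennreal[symmetric])
  also have "\<dots> = 2 * (\<integral>\<^sup>+z. g z \<partial>V)"
    using nn_integral_by_truncation[of V g] V g by (simp add: law_on_def)
  finally show ?thesis .
qed

text \<open>The part of \<open>V\<close> on size at most \<open>n\<close> is a quadratic expression in the part on smaller sizes.\<close>

theorem balanced_unique:
  assumes bal: "balanced 2 V" and bal': "balanced 2 V'"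
  shows "V = V'"
proof -
  have V: "law_on S V" and V': "law_on S V'" using bal bal' by (blast dest: balanced_law)+
  interpret V: prob_space V using V by (simp add: law_on_def)
  interpret V': prob_space V' using V' by (simp add: law_on_def)
  have s [measurable_cong]: "sets V = sets S" "sets V' = sets S" using V V' by (auto simp: law_on_def)
  have sp: "space V = space S" "space V' = space S" by (rule s[THEN sets_eq_imp_space_eq])+
  have trunc: "(\<integral>\<^sup>+z. indicator {..<n} (sz z) * g z \<partial>V) = (\<integral>\<^sup>+z. indicator {..<n} (sz z) * g z \<partial>V')"
    if "g \<in> borel_measurable S" for g n
    using that
  proof (induction n arbitrary: g)
    case 0
    then show ?case by simp
  next
    case (Suc n)
    note Suc.prems[measurable]
    let ?g = "\<lambda>z. g z / of_nat (sz z)"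
    have g: "?g \<in> borel_measurable S"
      by (rule divided_measurable[OF Suc.prems])
    have tg: "(\<lambda>z. indicator {..<Suc n} (sz z) * ?g z) \<in> borel_measurable S"
      by (rule weighted_measurable[OF g])
    define q where "q y z = indicator {..n} (sz y + sz z) * (\<integral>\<^sup>+\<xi>. ?g (\<phi> \<xi> y z) \<partial>\<Xi>)" for y z
    have q: "(\<lambda>(y, z). q y z) \<in> borel_measurable (S \<Otimes>\<^sub>M S)"
      using weighted_inner_measurable[OF V g, of "indicator {..n}"] by (simp add: q_def[abs_def])
    have q1: "q y \<in> borel_measurable S" if "y \<in> space S" for y
      using measurable_compose[OF measurable_Pair1'[OF that] q] by simp
    have expand: "2 * (\<integral>\<^sup>+z. indicator {..<Suc n} (sz z) * g z \<partial>X) =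
        (\<integral>\<^sup>+z. indicator {..<Suc n} (sz z) * ?g z \<partial>\<iota>) +
        2 * (\<integral>\<^sup>+y. indicator {..<n} (sz y) * (of_nat (sz y) * (\<integral>\<^sup>+z. indicator {..<n} (sz z) * q y z \<partial>X)) \<partial>X)"
      if X: "balanced 2 X" for X
    proof -
      have lX: "law_on S X" using X by (rule balanced_law)
      have spX: "space X = space S" using lX by (metis law_on_def sets_eq_imp_space_eq)
      have "2 * (\<integral>\<^sup>+z. indicator {..<Suc n} (sz z) * g z \<partial>X) =
          2 * (\<integral>\<^sup>+z. of_nat (sz z) * (indicator {..<Suc n} (sz z) * ?g z) \<partial>X)"
        by (intro arg_cong[where f = "\<lambda>a. 2 * a"] nn_integral_cong) (simp only: of_nat_sz_cancel' spX)
      also have "\<dots> = (\<integral>\<^sup>+z. indicator {..<Suc n} (sz z) * ?g z \<partial>\<iota>) +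
          2 * (\<integral>\<^sup>+y. of_nat (sz y) * step_op X (\<lambda>z. indicator {..<Suc n} (sz z) * ?g z) y \<partial>X)"
        by (rule balanced_eq[OF X tg])
      also have "(\<integral>\<^sup>+y. of_nat (sz y) * step_op X (\<lambda>z. indicator {..<Suc n} (sz z) * ?g z) y \<partial>X) =
          (\<integral>\<^sup>+y. indicator {..<n} (sz y) * (of_nat (sz y) * (\<integral>\<^sup>+z. indicator {..<n} (sz z) * q y z \<partial>X)) \<partial>X)"
        by (intro nn_integral_cong, subst step_op_truncate[OF lX g])
           (simp_all add: spX q_def mult_ac)
      finally show ?thesis .
    qed
    have mq: "(\<lambda>y. of_nat (sz y) * (\<integral>\<^sup>+z. indicator {..<n} (sz z) * q y z \<partial>V)) \<in> borel_measurable S"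
      by (intro weighted_measurable iterated_weighted_measurable[OF V q])
    have "(\<integral>\<^sup>+y. indicator {..<n} (sz y) * (of_nat (sz y) * (\<integral>\<^sup>+z. indicator {..<n} (sz z) * q y z \<partial>V)) \<partial>V) =
       (\<integral>\<^sup>+y. indicator {..<n} (sz y) * (of_nat (sz y) * (\<integral>\<^sup>+z. indicator {..<n} (sz z) * q y z \<partial>V)) \<partial>V')"
      by (rule Suc.IH[OF mq])
    also have "\<dots> = (\<integral>\<^sup>+y. indicator {..<n} (sz y) * (of_nat (sz y) * (\<integral>\<^sup>+z. indicator {..<n} (sz z) * q y z \<partial>V')) \<partial>V')"
      by (intro nn_integral_cong) (simp add: Suc.IH[OF q1] sp)
    finally have "2 * (\<integral>\<^sup>+z. indicator {..<Suc n} (sz z) * g z \<partial>V) = 2 * (\<integral>\<^sup>+z. indicator {..<Suc n} (sz z) * g z \<partial>V')"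
      by (simp only: expand[OF bal] expand[OF bal'])
    then show ?case by (simp add: ennreal_mult_cancel_left)
  qed
  have int: "(\<integral>\<^sup>+z. g z \<partial>V) = (\<integral>\<^sup>+z. g z \<partial>V')" if g: "g \<in> borel_measurable S" for g
    by (simp only: nn_integral_by_truncation[OF s(1) g] nn_integral_by_truncation[OF s(2) g] trunc[OF g])
  show ?thesis
  proof (rule measure_eqI)
    show "sets V = sets V'" by (simp add: s)
    fix A assume A: "A \<in> sets V"
    then have "emeasure V A = (\<integral>\<^sup>+z. indicator A z \<partial>V)" by simp
    also have "\<dots> = (\<integral>\<^sup>+z. indicator A z \<partial>V')" using A s by (intro int borel_measurable_indicator) simp
    also have "\<dots> = emeasure V' A" using A s by simp
    finally show "emeasure V A = emeasure V' A" .
  qed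
qed

end

section \<open>Exponential clocks and jump times\<close>

lemma exp_clock_integral:
  assumes [measurable]: "f \<in> borel_measurable borel"
  shows "(\<integral>\<^sup>+x. f x \<partial>exp_clock) = (\<integral>\<^sup>+x. indicator {0<..} x * ennreal (exp (- x)) * f x \<partial>lborel)"
  unfolding exp_clock_def
  by (subst nn_integral_restrict_space)
     (auto simp: nn_integral_density exponential_density_def indicator_def intro!: nn_integral_cong)

lemma space_exp_clock: "space exp_clock = {0<..}"
  by (simp add: exp_clock_def space_restrict_space)

lemma measurable_exp_clock_id: "(\<lambda>x. x) \<in> exp_clock \<rightarrow>\<^sub>M borel"
  unfolding exp_clock_def by (rule measurable_restrict_space1) simp

lemma exponential_tail:
  assumes "0 \<le> c"
  shows "(\<integral>\<^sup>+x. indicator {c<..} x * ennreal (exp (- x)) \<partial>lborel) = ennreal (exp (- c))"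
proof -
  have "(\<integral>\<^sup>+x. ennreal (exp (- x)) * indicator {c ..} x \<partial>lborel) = ennreal (0 - (- exp (- c)))"
  proof (rule nn_integral_FTC_atLeast)
    show "((\<lambda>x::real. - exp (- x)) \<longlongrightarrow> 0) at_top"
      using tendsto_minus[OF filterlim_compose[OF exp_at_bot filterlim_uminus_at_bot_at_top]] by simp
  qed (auto intro!: derivative_eq_intros)
  moreover have "(\<integral>\<^sup>+x. indicator {c<..} x * ennreal (exp (- x)) \<partial>lborel) =
      (\<integral>\<^sup>+x. ennreal (exp (- x)) * indicator {c ..} x \<partial>lborel)"
    by (rule nn_integral_cong_AE, rule AE_mp[OF AE_lborel_singleton[of c]]) (auto simp: indicator_def)
  ultimately show ?thesis by simp
qed

lemma prob_space_exp_clock: "prob_space exp_clock"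
proof
  have "emeasure exp_clock (space exp_clock) = (\<integral>\<^sup>+x. 1 \<partial>exp_clock)" by simp
  also have "\<dots> = 1"
    using exponential_tail[of 0] by (subst exp_clock_integral) simp_all
  finally show "emeasure exp_clock (space exp_clock) = 1" .
qed

lemma interval_indicator_measurable [measurable (raw)]:
  fixes f g :: "'a \<Rightarrow> real"
  assumes [measurable]: "f \<in> borel_measurable N" "g \<in> borel_measurable N"
  shows "(\<lambda>x. indicator {0..<f x} (g x) :: ennreal) \<in> borel_measurable N"
proof -
  have "indicator {0..<f x} (g x) = (indicator {0..} (g x) * (if g x < f x then 1 else 0) :: ennreal)" for x
    by (auto simp: indicator_def)
  then show ?thesis by simp
qed

text \<open>Fubini: an interval of exponential length with rate \<open>k\<close> covers the point \<open>a\<close> with probability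
  \<open>exp (- k * a)\<close>, which up to the factor \<open>k\<close> is the density of its length.\<close>

lemma exponential_stay:
  assumes k: "0 < (k::nat)" and [measurable]: "h \<in> borel_measurable borel"
  shows "(\<integral>\<^sup>+x. \<integral>\<^sup>+a. indicator {0..<x / k} a * h a \<partial>lborel \<partial>exp_clock) =
    (\<integral>\<^sup>+x. h (x / k) \<partial>exp_clock) / of_nat k"
proof -
  have [measurable]: "h \<in> borel_measurable lborel" by simp
  have joint: "(\<lambda>(x, a). indicator {0..<x / k} a * h a) \<in> borel_measurable (borel \<Otimes>\<^sub>M lborel)"
    by measurable
  have "(\<integral>\<^sup>+x. \<integral>\<^sup>+a. indicator {0..<x / k} a * h a \<partial>lborel \<partial>exp_clock) =
      (\<integral>\<^sup>+x. indicator {0<..} x * ennreal (exp (- x)) * (\<integral>\<^sup>+a. indicator {0..<x / k} a * h a \<partial>lborel) \<partial>lborel)"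
    by (rule exp_clock_integral) (rule lborel.borel_measurable_nn_integral[OF joint])
  also have "\<dots> = (\<integral>\<^sup>+x. \<integral>\<^sup>+a. indicator {0<..} x * ennreal (exp (- x)) * (indicator {0..<x / k} a * h a) \<partial>lborel \<partial>lborel)"
    by (intro nn_integral_cong nn_integral_cmult[symmetric]) measurable
  also have "\<dots> = (\<integral>\<^sup>+a. \<integral>\<^sup>+x. indicator {0<..} x * ennreal (exp (- x)) * (indicator {0..<x / k} a * h a) \<partial>lborel \<partial>lborel)"
  proof (rule lborel_pair.Fubini')
    show "(\<lambda>(a, x). indicator {0<..} x * ennreal (exp (- x)) * (indicator {0..<x / k} a * h a))
        \<in> borel_measurable (lborel \<Otimes>\<^sub>M lborel)"
      by measurable
  qed
  also have "\<dots> = (\<integral>\<^sup>+a. (\<integral>\<^sup>+x. indicator {k * a<..} x * ennreal (exp (- x)) \<partial>lborel) * (indicator {0..} a * h a) \<partial>lborel)"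
  proof (rule nn_integral_cong)
    fix a :: real
    have "(\<integral>\<^sup>+x. indicator {0<..} x * ennreal (exp (- x)) * (indicator {0..<x / k} a * h a) \<partial>lborel) =
        (\<integral>\<^sup>+x. indicator {k * a<..} x * ennreal (exp (- x)) * (indicator {0..} a * h a) \<partial>lborel)"
      using k by (intro nn_integral_cong)
        (auto simp: indicator_def field_simps dest: mult_nonneg_nonneg[of a "real k", OF _ of_nat_0_le_iff])
    also have "\<dots> = (\<integral>\<^sup>+x. indicator {k * a<..} x * ennreal (exp (- x)) \<partial>lborel) * (indicator {0..} a * h a)"
      by (rule nn_integral_multc) measurable
    finally show "(\<integral>\<^sup>+x. indicator {0<..} x * ennreal (exp (- x)) * (indicator {0..<x / k} a * h a) \<partial>lborel) = \<dots>" .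
  qed
  also have "\<dots> = (\<integral>\<^sup>+a. indicator {0<..} a * ennreal (exp (- (k * a))) * h a \<partial>lborel)"
    by (rule nn_integral_cong_AE, rule AE_mp[OF AE_lborel_singleton[of 0]])
       (auto simp: exponential_tail indicator_simps split: split_indicator)
  also have "\<dots> = (\<integral>\<^sup>+x. h (x / k) \<partial>exp_clock) / of_nat k"
  proof -
    have "(\<integral>\<^sup>+x. h (x / k) \<partial>exp_clock) = (\<integral>\<^sup>+x. indicator {0<..} x * ennreal (exp (- x)) * h (x / k) \<partial>lborel)"
      by (rule exp_clock_integral) measurable
    also have "\<dots> = ennreal (real k) * (\<integral>\<^sup>+a. indicator {0<..} a * ennreal (exp (- (k * a))) * h a \<partial>lborel)"
      using k by (subst nn_integral_real_affine[where c = "real k" and t = 0])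
        (auto simp: indicator_def zero_less_mult_iff intro!: arg_cong2[where f = "(*)"] nn_integral_cong)
    finally have eq: "(\<integral>\<^sup>+x. h (x / k) \<partial>exp_clock) = of_nat k * (\<integral>\<^sup>+a. indicator {0<..} a * ennreal (exp (- (k * a))) * h a \<partial>lborel)"
      by (simp only: ennreal_of_nat_eq_real_of_nat)
    have "b = of_nat k * b / of_nat k" for b :: ennreal
      using k by (simp add: mult.commute[of "of_nat k"] mult_divide_eq_ennreal)
    then show ?thesis unfolding eq .
  qed
  finally show ?thesis .
qed

lemma jump_time_mono:
  assumes "\<And>i. 0 < h i" "m \<le> n" shows "jump_time h m \<le> jump_time h n"
  unfolding jump_time_def using assms by (intro sum_mono2) (auto intro: less_imp_le)

lemma jump_time_Suc: "jump_time h (Suc n) = jump_time h n + h n"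
  by (simp add: jump_time_def)

lemma jump_count_eq:
  assumes h: "\<And>i. 0 < h i" and "jump_time h n \<le> t" "t < jump_time h (Suc n)"
  shows "jump_count h t = n"
  unfolding jump_count_def
proof (rule Least_equality)
  fix m assume m: "t < jump_time h (Suc m)"
  show "n \<le> m"
  proof (rule ccontr)
    assume "\<not> n \<le> m"
    then have "jump_time h (Suc m) \<le> jump_time h n" by (intro jump_time_mono h) simp
    then show False using m assms(2) by simp
  qed
qed fact

lemma less_explosion_time_iff:
  assumes "0 \<le> t"
  shows "ennreal t < explosion_time h \<longleftrightarrow> (\<exists>n. t < jump_time h n)"
  using assms by (auto simp: explosion_time_def less_SUP_iff ennreal_less_iff)

lemma jump_count_bounds:
  assumes h: "\<And>i. 0 < h i" and t: "0 \<le> t" "ennreal t < explosion_time h"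
  shows "jump_time h (jump_count h t) \<le> t" "t < jump_time h (Suc (jump_count h t))"
proof -
  obtain n where n: "t < jump_time h n" using t less_explosion_time_iff by blast
  then have n': "t < jump_time h (Suc n)"
    using jump_time_mono[of h n "Suc n", OF h] by simp
  then show "t < jump_time h (Suc (jump_count h t))"
    unfolding jump_count_def by (rule LeastI)
  show "jump_time h (jump_count h t) \<le> t"
  proof (cases "jump_count h t")
    case (Suc m)
    then have "\<not> t < jump_time h (Suc m)"
      unfolding jump_count_def using not_less_Least[of m "\<lambda>n. t < jump_time h (Suc n)"] by simp
    then show ?thesis using Suc by simp
  qed (use t in \<open>simp add: jump_time_def\<close>)
qed

text \<open>Cutting the time axis at the jump times and shifting each holding interval to the origin.\<close>

lemma path_integral:
  fixes G :: "nat \<Rightarrow> real \<Rightarrow> ennreal"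
  assumes h: "\<And>i. 0 < h i" and [measurable]: "\<And>n. G n \<in> borel_measurable borel"
  shows "(\<integral>\<^sup>+t. indicator {t. 0 \<le> t \<and> ennreal t < explosion_time h} t *
      G (jump_count h t) (t - jump_time h (jump_count h t)) \<partial>lborel) =
    (\<Sum>n. \<integral>\<^sup>+a. indicator {0..<h n} a * G n a \<partial>lborel)"
proof -
  let ?A = "{t. 0 \<le> t \<and> ennreal t < explosion_time h}"
  let ?T = "jump_time h"
  have T0: "0 \<le> ?T n" for n unfolding jump_time_def by (rule sum_nonneg) (rule less_imp_le[OF h])
  have single: "indicator {?T n..<?T (Suc n)} t * G n (t - ?T n) = 0"
    if "t \<in> ?A" "n \<noteq> jump_count h t" for n t
    using that jump_count_eq[of h, OF h, of n t] by (auto simp: indicator_def)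
  have "indicator ?A t * G (jump_count h t) (t - ?T (jump_count h t)) =
      (\<Sum>n. indicator {?T n..<?T (Suc n)} t * G n (t - ?T n))" for t
  proof (cases "t \<in> ?A")
    case True
    let ?k = "jump_count h t"
    have "(\<Sum>n. indicator {?T n..<?T (Suc n)} t * G n (t - ?T n)) =
       (\<Sum>n\<in>{?k}. indicator {?T n..<?T (Suc n)} t * G n (t - ?T n))"
      using single[OF True] by (intro suminf_finite) auto
    also have "\<dots> = indicator {?T ?k..<?T (Suc ?k)} t * G ?k (t - ?T ?k)"
      by (simp only: sum.insert[OF finite.emptyI] empty_iff not_False_eq_True sum.empty add_0_right)
    also have "indicator {?T ?k..<?T (Suc ?k)} t = (indicator ?A t :: ennreal)"
      using True jump_count_bounds[of h, OF h, of t] by simp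
    finally show ?thesis by simp
  next
    case False
    have "t \<notin> {?T n..<?T (Suc n)}" for n
    proof
      assume t: "t \<in> {?T n..<?T (Suc n)}"
      then have "0 \<le> t" using T0[of n] by simp
      then show False using False t less_explosion_time_iff[of t h] by auto
    qed
    then show ?thesis using False by simp
  qed
  then have "(\<integral>\<^sup>+t. indicator ?A t * G (jump_count h t) (t - ?T (jump_count h t)) \<partial>lborel) =
      (\<integral>\<^sup>+t. (\<Sum>n. indicator {?T n..<?T (Suc n)} t * G n (t - ?T n)) \<partial>lborel)"
    by simp
  also have "\<dots> = (\<Sum>n. \<integral>\<^sup>+t. indicator {?T n..<?T (Suc n)} t * G n (t - ?T n) \<partial>lborel)"
    by (rule nn_integral_suminf) measurable
  also have "\<dots> = (\<Sum>n. \<integral>\<^sup>+a. indicator {0..<h n} a * G n a \<partial>lborel)"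
  proof (rule suminf_cong)
    fix n
    show "(\<integral>\<^sup>+t. indicator {?T n..<?T (Suc n)} t * G n (t - ?T n) \<partial>lborel) =
        (\<integral>\<^sup>+a. indicator {0..<h n} a * G n a \<partial>lborel)"
      by (subst nn_integral_real_affine[where c = 1 and t = "?T n"])
         (auto simp: indicator_def jump_time_Suc intro!: nn_integral_cong)
  qed
  finally show ?thesis .
qed

lemma lifetime_integral:
  "(\<integral>\<^sup>+t. indicator {t. 0 \<le> t \<and> ennreal t < \<tau>} t \<partial>lborel) = \<tau>"
proof (cases \<tau>)
  case (real r)
  then have "{t. 0 \<le> t \<and> ennreal t < \<tau>} = {0..<r}" by (auto simp: ennreal_less_iff)
  then show ?thesis using real by simp
next
  case top
  then have "{t. 0 \<le> t \<and> ennreal t < \<tau>} = {0..}" by (auto simp: less_top[symmetric])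
  moreover have "emeasure lborel {0::real..} = \<infinity>"
  proof (rule ccontr)
    assume "emeasure lborel {0::real..} \<noteq> \<infinity>"
    then obtain r where r: "0 \<le> r" "emeasure lborel {0::real..} = ennreal r"
      by (cases "emeasure lborel {0::real..}") auto
    have "ennreal (r + 1) = emeasure lborel {0..r + 1}" using r by simp
    also have "\<dots> \<le> emeasure lborel {0::real..}" by (rule emeasure_mono) auto
    finally show False using r by simp
  qed
  ultimately show ?thesis using top by simp
qed

section \<open>Growth processes\<close>

text \<open>A process that holds the state \<open>z\<close> for an exponential time of rate \<open>sz z\<close>, ages it by the holding
  time and then updates it by an independent random input from \<open>J\<close>. Ageing is a separate
  parameter because it must also be applied during a holding interval; it is trivial for clusters.\<close>

locale growth =
  fixes J :: "'j measure" and S :: "'s measure" and upd :: "'j \<Rightarrow> 's \<Rightarrow> 's"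
    and age :: "real \<Rightarrow> 's \<Rightarrow> 's" and sz :: "'s \<Rightarrow> nat" and z0 :: 's
  assumes prob_J: "prob_space J"
    and upd_measurable: "(\<lambda>(j, z). upd j z) \<in> J \<Otimes>\<^sub>M S \<rightarrow>\<^sub>M S"
    and age_measurable: "(\<lambda>(a, z). age a z) \<in> restrict_space borel {0..} \<Otimes>\<^sub>M S \<rightarrow>\<^sub>M S"
    and sz_measurable [measurable]: "sz \<in> S \<rightarrow>\<^sub>M count_space UNIV"
    and sz_pos: "z \<in> space S \<Longrightarrow> 0 < sz z"
    and z0: "z0 \<in> space S"
begin

abbreviation I :: "(real \<times> 'j) measure" where "I \<equiv> exp_clock \<Otimes>\<^sub>M J"

definition \<Omega> :: "(nat \<Rightarrow> real \<times> 'j) measure" where "\<Omega> = PiM UNIV (\<lambda>_. I)"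

text \<open>The initial state is a parameter, so that the chain after its first jump is again such a chain.\<close>

primrec chain :: "'s \<Rightarrow> (nat \<Rightarrow> real \<times> 'j) \<Rightarrow> nat \<Rightarrow> 's" where
  "chain z \<omega> 0 = z"
| "chain z \<omega> (Suc n) = upd (snd (\<omega> n)) (age (fst (\<omega> n) / real (sz (chain z \<omega> n))) (chain z \<omega> n))"

definition aged :: "(nat \<Rightarrow> real \<times> 'j) \<Rightarrow> nat \<Rightarrow> 's" where
  "aged \<omega> n = age (fst (\<omega> n) / real (sz (chain z0 \<omega> n))) (chain z0 \<omega> n)"

definition wait :: "(nat \<Rightarrow> real \<times> 'j) \<Rightarrow> nat \<Rightarrow> real" where
  "wait \<omega> n = fst (\<omega> n) / real (sz (chain z0 \<omega> n))"

definition lifetime :: "(nat \<Rightarrow> real \<times> 'j) \<Rightarrow> ennreal" where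
  "lifetime \<omega> = explosion_time (wait \<omega>)"

definition path :: "(nat \<Rightarrow> real \<times> 'j) \<Rightarrow> real \<Rightarrow> 's" where
  "path \<omega> t = (if 0 \<le> t \<and> ennreal t < lifetime \<omega>
     then let n = jump_count (wait \<omega>) t in age (t - jump_time (wait \<omega>) n) (chain z0 \<omega> n) else z0)"

sublocale clock: prob_space exp_clock by (rule prob_space_exp_clock)
sublocale J: prob_space J by (rule prob_J)
sublocale I: pair_prob_space exp_clock J ..
sublocale seq: sequence_space I ..
sublocale \<Omega>: prob_space \<Omega> unfolding \<Omega>_def by (rule seq.prob_space_axioms)

lemma upd_measurable' [measurable (raw)]:
  assumes "f \<in> N \<rightarrow>\<^sub>M J" "g \<in> N \<rightarrow>\<^sub>M S"
  shows "(\<lambda>x. upd (f x) (g x)) \<in> N \<rightarrow>\<^sub>M S"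
  using measurable_compose[OF measurable_Pair[OF assms] upd_measurable] by simp

lemma age_measurable':
  assumes f: "f \<in> N \<rightarrow>\<^sub>M borel" "\<And>x. x \<in> space N \<Longrightarrow> 0 \<le> f x" and g: "g \<in> N \<rightarrow>\<^sub>M S"
  shows "(\<lambda>x. age (f x) (g x)) \<in> N \<rightarrow>\<^sub>M S"
proof -
  have "f \<in> N \<rightarrow>\<^sub>M restrict_space borel {0..}"
    using f by (intro measurable_restrict_space2) auto
  from measurable_compose[OF measurable_Pair[OF this g] age_measurable] show ?thesis by simp
qed

lemma space_I: "s \<in> space I \<longleftrightarrow> 0 < fst s \<and> snd s \<in> space J"
  by (cases s) (auto simp: space_pair_measure space_exp_clock)

lemma space_\<Omega>: "\<omega> \<in> space \<Omega> \<longleftrightarrow> (\<forall>n. \<omega> n \<in> space I)"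
  by (auto simp: \<Omega>_def space_PiM PiE_iff)

lemma fst_I_measurable [measurable]: "fst \<in> borel_measurable I"
  by (rule measurable_compose[OF measurable_fst measurable_exp_clock_id])

lemma component_measurable [measurable]: "(\<lambda>\<omega>. \<omega> n) \<in> \<Omega> \<rightarrow>\<^sub>M I"
  unfolding \<Omega>_def by (rule measurable_component_singleton) simp

lemma clock_measurable [measurable]: "(\<lambda>\<omega>. fst (\<omega> n)) \<in> borel_measurable \<Omega>"
  by (rule measurable_compose[OF component_measurable fst_I_measurable])

lemma chain_measurable:
  assumes "z \<in> space S" shows "(\<lambda>\<omega>. chain z \<omega> n) \<in> \<Omega> \<rightarrow>\<^sub>M S"
proof (induction n)
  case (Suc n)
  note Suc[measurable]
  show ?case unfolding chain.simps
    by (intro upd_measurable' age_measurable') (measurable, auto simp: space_\<Omega> space_I less_imp_le)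
qed (use assms in simp)

lemmas chain_measurable0 [measurable] = chain_measurable[OF z0]

lemma chain_space: "z \<in> space S \<Longrightarrow> \<omega> \<in> space \<Omega> \<Longrightarrow> chain z \<omega> n \<in> space S"
  using chain_measurable[THEN measurable_space] .

lemma step_measurable:
  assumes "f \<in> N \<rightarrow>\<^sub>M I" "g \<in> N \<rightarrow>\<^sub>M S"
  shows "(\<lambda>x. upd (snd (f x)) (age (fst (f x) / real (sz (g x))) (g x))) \<in> N \<rightarrow>\<^sub>M S"
proof -
  note assms[measurable]
  have [measurable]: "(\<lambda>x. fst (f x)) \<in> borel_measurable N"
    by (rule measurable_compose[OF assms(1) fst_I_measurable])
  show ?thesis
    using measurable_space[OF assms(1)]
    by (intro upd_measurable' age_measurable') (measurable, auto simp: space_I less_imp_le)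
qed

lemma aged_measurable [measurable]: "(\<lambda>\<omega>. aged \<omega> n) \<in> \<Omega> \<rightarrow>\<^sub>M S"
  unfolding aged_def by (intro age_measurable') (measurable, auto simp: space_\<Omega> space_I less_imp_le)

lemma chain_peel:
  "chain z (case_nat s \<omega>) (Suc n) = chain (upd (snd s) (age (fst s / real (sz z)) z)) \<omega> n"
  by (induction n) auto

text \<open>Shift invariance of an independent sequence: its first entry and the rest are independent, and the
  rest has the same law.\<close>

lemma integral_peel:
  assumes [measurable]: "f \<in> borel_measurable \<Omega>"
  shows "(\<integral>\<^sup>+\<omega>. f \<omega> \<partial>\<Omega>) = (\<integral>\<^sup>+s. \<integral>\<^sup>+\<omega>. f (case_nat s \<omega>) \<partial>\<Omega> \<partial>I)"
proof -
  have [measurable]: "(\<lambda>(s, \<omega>). case_nat s \<omega>) \<in> I \<Otimes>\<^sub>M \<Omega> \<rightarrow>\<^sub>M \<Omega>"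
    unfolding \<Omega>_def by measurable
  have "(\<integral>\<^sup>+\<omega>. f \<omega> \<partial>\<Omega>) = (\<integral>\<^sup>+\<omega>. f \<omega> \<partial>distr (I \<Otimes>\<^sub>M \<Omega>) \<Omega> (\<lambda>(s, \<omega>). case_nat s \<omega>))"
    unfolding \<Omega>_def by (simp only: seq.PiM_iter)
  also have "\<dots> = (\<integral>\<^sup>+w. f (case_nat (fst w) (snd w)) \<partial>(I \<Otimes>\<^sub>M \<Omega>))"
    by (subst nn_integral_distr) (auto simp: split_beta')
  also have "\<dots> = (\<integral>\<^sup>+s. \<integral>\<^sup>+\<omega>. f (case_nat s \<omega>) \<partial>\<Omega> \<partial>I)"
  proof -
    have "(\<lambda>w. f (case_nat (fst w) (snd w))) \<in> borel_measurable (I \<Otimes>\<^sub>M \<Omega>)"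
      using measurable_compose[OF _ assms, of "\<lambda>(s, \<omega>). case_nat s \<omega>" "I \<Otimes>\<^sub>M \<Omega>"]
      by (simp add: split_beta')
    from \<Omega>.nn_integral_fst[OF this] show ?thesis by simp
  qed
  finally show ?thesis .
qed

text \<open>Peeling off the first input turns the chain into the chain started from its second state. By
  induction, the input at jump \<open>n\<close> is independent of the state reached by then.\<close>

lemma fresh_input:
  assumes f: "(\<lambda>(s, z). f s z) \<in> borel_measurable (I \<Otimes>\<^sub>M S)" and z: "z \<in> space S"
  shows "(\<integral>\<^sup>+\<omega>. f (\<omega> n) (chain z \<omega> n) \<partial>\<Omega>) = (\<integral>\<^sup>+\<omega>. \<integral>\<^sup>+s. f s (chain z \<omega> n) \<partial>I \<partial>\<Omega>)"
  using z
proof (induction n arbitrary: z)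
  case 0
  have "(\<lambda>s. f s z) \<in> borel_measurable I"
    using measurable_compose[OF measurable_Pair2'[OF 0] f] by simp
  then have "(\<integral>\<^sup>+s. f s z \<partial>I) = (\<integral>\<^sup>+\<omega>. f (\<omega> 0) z \<partial>\<Omega>)"
    unfolding \<Omega>_def by (subst seq.PiM_component[symmetric, of 0]) (auto simp: nn_integral_distr)
  then show ?case by (simp add: \<Omega>.emeasure_space_1)
next
  case (Suc n)
  let ?st = "\<lambda>s. upd (snd s) (age (fst s / real (sz z)) z)"
  have st: "?st s \<in> space S" if "s \<in> space I" for s
    using step_measurable[of "\<lambda>s. s" I "\<lambda>_. z"] that Suc.prems by (auto dest: measurable_space)
  have inner: "(\<lambda>z. \<integral>\<^sup>+s. f s z \<partial>I) \<in> borel_measurable S"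
  proof -
    have "(\<lambda>(z, s). f s z) \<in> borel_measurable (S \<Otimes>\<^sub>M I)"
      using measurable_compose[OF measurable_pair_swap' f] by (simp add: split_beta')
    then show ?thesis by measurable
  qed
  have "(\<integral>\<^sup>+\<omega>. f (\<omega> (Suc n)) (chain z \<omega> (Suc n)) \<partial>\<Omega>) =
      (\<integral>\<^sup>+s. \<integral>\<^sup>+\<omega>. f (\<omega> n) (chain (?st s) \<omega> n) \<partial>\<Omega> \<partial>I)"
    using measurable_compose[OF measurable_Pair[OF component_measurable chain_measurable[OF Suc.prems]] f, of "Suc n" "Suc n"]
    by (subst integral_peel) (simp_all only: chain_peel split_conv nat.case)
  also have "\<dots> = (\<integral>\<^sup>+s. \<integral>\<^sup>+\<omega>. \<integral>\<^sup>+s'. f s' (chain (?st s) \<omega> n) \<partial>I \<partial>\<Omega> \<partial>I)"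
    by (intro nn_integral_cong Suc.IH st)
  also have "\<dots> = (\<integral>\<^sup>+\<omega>. \<integral>\<^sup>+s'. f s' (chain z \<omega> (Suc n)) \<partial>I \<partial>\<Omega>)"
    using measurable_compose[OF chain_measurable[OF Suc.prems] inner, of "Suc n"]
    by (subst integral_peel) (simp_all only: chain_peel)
  finally show ?case .
qed

lemma integral_I:
  assumes "f \<in> borel_measurable I"
  shows "(\<integral>\<^sup>+s. f s \<partial>I) = (\<integral>\<^sup>+x. \<integral>\<^sup>+j. f (x, j) \<partial>J \<partial>exp_clock)"
  using J.nn_integral_fst[OF assms] by simp

lemma fresh_clock:
  assumes f: "(\<lambda>(x, z). f x z) \<in> borel_measurable (exp_clock \<Otimes>\<^sub>M S)"
  shows "(\<integral>\<^sup>+\<omega>. f (fst (\<omega> n)) (chain z0 \<omega> n) \<partial>\<Omega>) = (\<integral>\<^sup>+\<omega>. \<integral>\<^sup>+x. f x (chain z0 \<omega> n) \<partial>exp_clock \<partial>\<Omega>)"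
proof -
  have m: "(\<lambda>(s, z). f (fst s) z) \<in> borel_measurable (I \<Otimes>\<^sub>M S)"
    using measurable_compose[OF measurable_Pair[OF measurable_compose[OF measurable_fst measurable_fst] measurable_snd] f, of J]
    by (simp add: split_beta')
  have m1: "(\<lambda>s. f (fst s) z) \<in> borel_measurable I" if "z \<in> space S" for z
    using measurable_compose[OF measurable_Pair2'[OF that] m] by simp
  have "(\<integral>\<^sup>+\<omega>. f (fst (\<omega> n)) (chain z0 \<omega> n) \<partial>\<Omega>) = (\<integral>\<^sup>+\<omega>. \<integral>\<^sup>+s. f (fst s) (chain z0 \<omega> n) \<partial>I \<partial>\<Omega>)"
    by (rule fresh_input[OF m z0])
  also have "\<dots> = (\<integral>\<^sup>+\<omega>. \<integral>\<^sup>+x. f x (chain z0 \<omega> n) \<partial>exp_clock \<partial>\<Omega>)"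
    by (intro nn_integral_cong) (simp add: integral_I[OF m1[OF chain_space[OF z0]]] J.emeasure_space_1)
  finally show ?thesis .
qed

lemma age_clock_measurable:
  assumes g: "g \<in> borel_measurable S"
  shows "(\<lambda>(x, z). g (age (x / real (sz z)) z)) \<in> borel_measurable (exp_clock \<Otimes>\<^sub>M S)"
proof -
  have [measurable]: "fst \<in> borel_measurable (exp_clock \<Otimes>\<^sub>M S)"
    by (rule measurable_compose[OF measurable_fst measurable_exp_clock_id])
  have "(\<lambda>w. g (age (fst w / real (sz (snd w))) (snd w))) \<in> borel_measurable (exp_clock \<Otimes>\<^sub>M S)"
    by (rule measurable_compose[OF age_measurable' g])
       (measurable, auto simp: space_pair_measure space_exp_clock)
  then show ?thesis by (simp add: split_beta')
qed

lemma fresh_choice: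
  assumes f: "(\<lambda>(j, y). f j y) \<in> borel_measurable (J \<Otimes>\<^sub>M S)"
  shows "(\<integral>\<^sup>+\<omega>. f (snd (\<omega> n)) (aged \<omega> n) \<partial>\<Omega>) = (\<integral>\<^sup>+\<omega>. \<integral>\<^sup>+j. f j (aged \<omega> n) \<partial>J \<partial>\<Omega>)"
proof -
  let ?a = "\<lambda>x z. age (x / real (sz z)) z"
  let ?F = "\<lambda>y. \<integral>\<^sup>+j. f j y \<partial>J"
  have am: "(\<lambda>w. ?a (fst (fst w)) (snd w)) \<in> I \<Otimes>\<^sub>M S \<rightarrow>\<^sub>M S"
  proof -
    have [measurable]: "(\<lambda>w. fst (fst w)) \<in> borel_measurable (I \<Otimes>\<^sub>M S)"
      by (rule measurable_compose[OF measurable_fst fst_I_measurable])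
    show ?thesis by (rule age_measurable') (measurable, auto simp: space_pair_measure space_exp_clock)
  qed
  have Fm: "?F \<in> borel_measurable S"
  proof -
    have "(\<lambda>(y, j). f j y) \<in> borel_measurable (S \<Otimes>\<^sub>M J)"
      using measurable_compose[OF measurable_pair_swap' f] by (simp add: split_beta')
    then show ?thesis by measurable
  qed
  have m: "(\<lambda>(s, z). f (snd s) (?a (fst s) z)) \<in> borel_measurable (I \<Otimes>\<^sub>M S)"
    using measurable_compose[OF measurable_Pair[OF measurable_compose[OF measurable_fst measurable_snd] am] f]
    by (simp add: split_beta')
  have m1: "(\<lambda>s. f (snd s) (?a (fst s) z)) \<in> borel_measurable I" if "z \<in> space S" for z
    using measurable_compose[OF measurable_Pair2'[OF that] m] by simp
  have "(\<integral>\<^sup>+\<omega>. f (snd (\<omega> n)) (aged \<omega> n) \<partial>\<Omega>) =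
      (\<integral>\<^sup>+\<omega>. \<integral>\<^sup>+s. f (snd s) (?a (fst s) (chain z0 \<omega> n)) \<partial>I \<partial>\<Omega>)"
    unfolding aged_def by (rule fresh_input[OF m z0])
  also have "\<dots> = (\<integral>\<^sup>+\<omega>. \<integral>\<^sup>+x. ?F (?a x (chain z0 \<omega> n)) \<partial>exp_clock \<partial>\<Omega>)"
    by (intro nn_integral_cong) (simp add: integral_I[OF m1[OF chain_space[OF z0]]])
  also have "\<dots> = (\<integral>\<^sup>+\<omega>. ?F (aged \<omega> n) \<partial>\<Omega>)"
    unfolding aged_def by (rule fresh_clock[OF age_clock_measurable[OF Fm], symmetric])
  finally show ?thesis .
qed

lemma aged_start:
  assumes g: "g \<in> borel_measurable S"
  shows "(\<integral>\<^sup>+\<omega>. g (aged \<omega> 0) \<partial>\<Omega>) = (\<integral>\<^sup>+x. g (age (x / real (sz z0)) z0) \<partial>exp_clock)"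
  using fresh_clock[OF age_clock_measurable[OF g], of 0]
  by (simp add: aged_def \<Omega>.emeasure_space_1)

text \<open>The aged states form a Markov chain: the clock that ages state \<open>n + 1\<close> is independent of the input
  that produced it.\<close>

lemma aged_step:
  assumes g: "g \<in> borel_measurable S"
  shows "(\<integral>\<^sup>+\<omega>. g (aged \<omega> (Suc n)) \<partial>\<Omega>) =
    (\<integral>\<^sup>+\<omega>. \<integral>\<^sup>+j. \<integral>\<^sup>+x. g (age (x / real (sz (upd j (aged \<omega> n)))) (upd j (aged \<omega> n))) \<partial>exp_clock \<partial>J \<partial>\<Omega>)"
proof -
  let ?G = "\<lambda>z. \<integral>\<^sup>+x. g (age (x / real (sz z)) z) \<partial>exp_clock"
  have Gm: "?G \<in> borel_measurable S"
  proof -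
    have "(\<lambda>(z, x). g (age (x / real (sz z)) z)) \<in> borel_measurable (S \<Otimes>\<^sub>M exp_clock)"
      using measurable_compose[OF measurable_pair_swap' age_clock_measurable[OF g]] by (simp add: split_beta')
    then show ?thesis by measurable
  qed
  have "(\<integral>\<^sup>+\<omega>. g (aged \<omega> (Suc n)) \<partial>\<Omega>) = (\<integral>\<^sup>+\<omega>. ?G (chain z0 \<omega> (Suc n)) \<partial>\<Omega>)"
    unfolding aged_def by (rule fresh_clock[OF age_clock_measurable[OF g]])
  also have "\<dots> = (\<integral>\<^sup>+\<omega>. ?G (upd (snd (\<omega> n)) (aged \<omega> n)) \<partial>\<Omega>)"
    by (simp add: aged_def)
  also have "\<dots> = (\<integral>\<^sup>+\<omega>. \<integral>\<^sup>+j. ?G (upd j (aged \<omega> n)) \<partial>J \<partial>\<Omega>)"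
    by (rule fresh_choice) (use measurable_compose[OF upd_measurable Gm] in \<open>simp add: split_beta'\<close>)
  finally show ?thesis .
qed

lemma wait_pos: "\<omega> \<in> space \<Omega> \<Longrightarrow> 0 < wait \<omega> n"
  using sz_pos[OF chain_space[OF z0]] by (auto simp: wait_def space_\<Omega> space_I)

text \<open>On each holding interval, \<open>exponential_stay\<close> replaces the time integral by one observation at its end,
  weighted by the mean holding time.\<close>

lemma life_integral:
  assumes g: "g \<in> borel_measurable S"
  shows "(\<integral>\<^sup>+\<omega>. \<integral>\<^sup>+t. indicator {t. 0 \<le> t \<and> ennreal t < lifetime \<omega>} t * g (path \<omega> t) \<partial>lborel \<partial>\<Omega>) =
    (\<Sum>n. \<integral>\<^sup>+\<omega>. g (aged \<omega> n) / of_nat (sz (chain z0 \<omega> n)) \<partial>\<Omega>)"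
proof -
  let ?z = "\<lambda>\<omega> n. chain z0 \<omega> n"
  have gm: "(\<lambda>a. g (age (max 0 a) z)) \<in> borel_measurable borel" if "z \<in> space S" for z
    using that by (intro measurable_compose[OF age_measurable' g]) auto
  have gm2: "(\<lambda>(\<omega>, a). g (age (max 0 a) (?z \<omega> n))) \<in> borel_measurable (\<Omega> \<Otimes>\<^sub>M lborel)" for n
    unfolding split_beta' by (intro measurable_compose[OF age_measurable' g]) auto
  have "(\<integral>\<^sup>+\<omega>. \<integral>\<^sup>+t. indicator {t. 0 \<le> t \<and> ennreal t < lifetime \<omega>} t * g (path \<omega> t) \<partial>lborel \<partial>\<Omega>) =
      (\<integral>\<^sup>+\<omega>. (\<Sum>n. \<integral>\<^sup>+a. indicator {0..<wait \<omega> n} a * g (age (max 0 a) (?z \<omega> n)) \<partial>lborel) \<partial>\<Omega>)"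
  proof (rule nn_integral_cong)
    fix \<omega> assume \<omega>: "\<omega> \<in> space \<Omega>"
    let ?h = "wait \<omega>"
    have "(\<integral>\<^sup>+t. indicator {t. 0 \<le> t \<and> ennreal t < lifetime \<omega>} t * g (path \<omega> t) \<partial>lborel) =
       (\<integral>\<^sup>+t. indicator {t. 0 \<le> t \<and> ennreal t < explosion_time ?h} t *
          g (age (max 0 (t - jump_time ?h (jump_count ?h t))) (?z \<omega> (jump_count ?h t))) \<partial>lborel)"
      using jump_count_bounds(1)[OF wait_pos[OF \<omega>]]
      by (intro nn_integral_cong) (auto simp: path_def lifetime_def indicator_def Let_def max_def)
    also have "\<dots> = (\<Sum>n. \<integral>\<^sup>+a. indicator {0..<?h n} a * g (age (max 0 a) (?z \<omega> n)) \<partial>lborel)"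
      by (rule path_integral[OF wait_pos[OF \<omega>], where G = "\<lambda>n a. g (age (max 0 a) (?z \<omega> n))"])
         (rule gm[OF chain_space[OF z0 \<omega>]])
    finally show "(\<integral>\<^sup>+t. indicator {t. 0 \<le> t \<and> ennreal t < lifetime \<omega>} t * g (path \<omega> t) \<partial>lborel) = \<dots>" .
  qed
  also have "\<dots> = (\<Sum>n. \<integral>\<^sup>+\<omega>. \<integral>\<^sup>+a. indicator {0..<wait \<omega> n} a * g (age (max 0 a) (?z \<omega> n)) \<partial>lborel \<partial>\<Omega>)"
  proof (rule nn_integral_suminf)
    fix n
    note gm2[measurable]
    show "(\<lambda>\<omega>. \<integral>\<^sup>+a. indicator {0..<wait \<omega> n} a * g (age (max 0 a) (?z \<omega> n)) \<partial>lborel) \<in> borel_measurable \<Omega>"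
      unfolding wait_def by measurable
  qed
  also have "\<dots> = (\<Sum>n. \<integral>\<^sup>+\<omega>. g (aged \<omega> n) / of_nat (sz (?z \<omega> n)) \<partial>\<Omega>)"
  proof (rule suminf_cong)
    fix n
    let ?f = "\<lambda>x z. \<integral>\<^sup>+a. indicator {0..<x / real (sz z)} a * g (age (max 0 a) z) \<partial>lborel"
    have fm: "(\<lambda>(x, z). ?f x z) \<in> borel_measurable (exp_clock \<Otimes>\<^sub>M S)"
    proof -
      have [measurable]: "(\<lambda>w. fst (fst w)) \<in> borel_measurable ((exp_clock \<Otimes>\<^sub>M S) \<Otimes>\<^sub>M lborel)"
        by (rule measurable_compose[OF measurable_compose[OF measurable_fst measurable_fst] measurable_exp_clock_id])
      have [measurable]: "(\<lambda>w. g (age (max 0 (snd w)) (snd (fst w)))) \<in> borel_measurable ((exp_clock \<Otimes>\<^sub>M S) \<Otimes>\<^sub>M lborel)"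
        by (intro measurable_compose[OF age_measurable' g]) auto
      have "(\<lambda>w. indicator {0..<fst (fst w) / real (sz (snd (fst w)))} (snd w) * g (age (max 0 (snd w)) (snd (fst w))))
          \<in> borel_measurable ((exp_clock \<Otimes>\<^sub>M S) \<Otimes>\<^sub>M lborel)"
        by measurable
      then show ?thesis by (simp add: split_beta' lborel.borel_measurable_nn_integral)
    qed
    have dm: "(\<lambda>(x, z). g (age (x / real (sz z)) z) / of_nat (sz z)) \<in> borel_measurable (exp_clock \<Otimes>\<^sub>M S)"
    proof -
      note age_clock_measurable[OF g, measurable]
      show ?thesis by measurable
    qed
    have "(\<integral>\<^sup>+\<omega>. \<integral>\<^sup>+a. indicator {0..<wait \<omega> n} a * g (age (max 0 a) (?z \<omega> n)) \<partial>lborel \<partial>\<Omega>) =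
        (\<integral>\<^sup>+\<omega>. \<integral>\<^sup>+x. ?f x (?z \<omega> n) \<partial>exp_clock \<partial>\<Omega>)"
      unfolding wait_def by (rule fresh_clock[OF fm])
    also have "\<dots> = (\<integral>\<^sup>+\<omega>. \<integral>\<^sup>+x. g (age (x / real (sz (?z \<omega> n))) (?z \<omega> n)) / of_nat (sz (?z \<omega> n)) \<partial>exp_clock \<partial>\<Omega>)"
    proof (rule nn_integral_cong)
      fix \<omega> assume "\<omega> \<in> space \<Omega>"
      then have z: "?z \<omega> n \<in> space S" by (rule chain_space[OF z0])
      define k where "k = sz (?z \<omega> n)"
      have k: "0 < k" unfolding k_def by (rule sz_pos[OF z])
      have "(\<integral>\<^sup>+x. ?f x (?z \<omega> n) \<partial>exp_clock) = (\<integral>\<^sup>+x. g (age (max 0 (x / k)) (?z \<omega> n)) \<partial>exp_clock) / of_nat k"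
        unfolding k_def[symmetric] by (rule exponential_stay[OF k gm[OF z]])
      also have "\<dots> = (\<integral>\<^sup>+x. g (age (x / k) (?z \<omega> n)) \<partial>exp_clock) / of_nat k"
        by (intro arg_cong[where f = "\<lambda>a. a / of_nat k"] nn_integral_cong) (simp add: space_exp_clock max_def)
      also have "\<dots> = (\<integral>\<^sup>+x. g (age (x / k) (?z \<omega> n)) / of_nat k \<partial>exp_clock)"
      proof (rule nn_integral_divide[symmetric])
        show "(\<lambda>x. g (age (x / k) (?z \<omega> n))) \<in> borel_measurable exp_clock"
          using measurable_compose[OF measurable_Pair2'[OF z] age_clock_measurable[OF g]] by (simp add: k_def)
      qed
      finally show "(\<integral>\<^sup>+x. ?f x (?z \<omega> n) \<partial>exp_clock) =
          (\<integral>\<^sup>+x. g (age (x / real (sz (?z \<omega> n))) (?z \<omega> n)) / of_nat (sz (?z \<omega> n)) \<partial>exp_clock)"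
        by (simp only: k_def)
    qed
    also have "\<dots> = (\<integral>\<^sup>+\<omega>. g (aged \<omega> n) / of_nat (sz (?z \<omega> n)) \<partial>\<Omega>)"
      unfolding aged_def by (rule fresh_clock[OF dm, symmetric])
    finally show "(\<integral>\<^sup>+\<omega>. \<integral>\<^sup>+a. indicator {0..<wait \<omega> n} a * g (age (max 0 a) (?z \<omega> n)) \<partial>lborel \<partial>\<Omega>) = \<dots>" .
  qed
  finally show ?thesis .
qed

lemma lifetime_measurable [measurable]: "lifetime \<in> borel_measurable \<Omega>"
  unfolding lifetime_def[abs_def] explosion_time_def jump_time_def wait_def by measurable

lemma expected_lifetime:
  "(\<integral>\<^sup>+\<omega>. lifetime \<omega> \<partial>\<Omega>) = (\<Sum>n. \<integral>\<^sup>+\<omega>. 1 / of_nat (sz (chain z0 \<omega> n)) \<partial>\<Omega>)"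
  using life_integral[of "\<lambda>_. 1"] by (simp add: lifetime_integral)

lemma expected_lifetime_pos: "0 < (\<integral>\<^sup>+\<omega>. lifetime \<omega> \<partial>\<Omega>)"
proof -
  have "0 < 1 / (of_nat (sz z0) :: ennreal)"
    by (simp add: ennreal_zero_less_divide of_nat_less_top)
  also have "\<dots> = (\<integral>\<^sup>+\<omega>. 1 / of_nat (sz (chain z0 \<omega> 0)) \<partial>\<Omega>)" by (simp add: \<Omega>.emeasure_space_1)
  also have "\<dots> \<le> (\<integral>\<^sup>+\<omega>. lifetime \<omega> \<partial>\<Omega>)"
    unfolding expected_lifetime
    using sum_le_suminf[of "\<lambda>n. \<integral>\<^sup>+\<omega>. 1 / of_nat (sz (chain z0 \<omega> n)) \<partial>\<Omega>" "{0}"] by simp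
  finally show ?thesis .
qed

lemma path_measurable [measurable]: "(\<lambda>(\<omega>, t). path \<omega> t) \<in> \<Omega> \<Otimes>\<^sub>M borel \<rightarrow>\<^sub>M S"
proof -
  have [measurable]: "(\<lambda>w. jump_time (wait (fst w)) n) \<in> borel_measurable (\<Omega> \<Otimes>\<^sub>M borel)" for n
    unfolding jump_time_def wait_def by measurable
  have N [measurable]: "(\<lambda>w. jump_count (wait (fst w)) (snd w)) \<in> \<Omega> \<Otimes>\<^sub>M borel \<rightarrow>\<^sub>M count_space UNIV"
    unfolding jump_count_def by measurable
  have A: "(\<lambda>w. age (max 0 (snd w - jump_time (wait (fst w)) n)) (chain z0 (fst w) n)) \<in> \<Omega> \<Otimes>\<^sub>M borel \<rightarrow>\<^sub>M S" for n
  proof (rule age_measurable')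
    show "(\<lambda>w. max 0 (snd w - jump_time (wait (fst w)) n)) \<in> borel_measurable (\<Omega> \<Otimes>\<^sub>M borel)"
      by measurable
    show "(\<lambda>w. chain z0 (fst w) n) \<in> \<Omega> \<Otimes>\<^sub>M borel \<rightarrow>\<^sub>M S"
      by measurable
  qed simp
  have [measurable]: "(\<lambda>w. age (max 0 (snd w - jump_time (wait (fst w)) (jump_count (wait (fst w)) (snd w))))
      (chain z0 (fst w) (jump_count (wait (fst w)) (snd w)))) \<in> \<Omega> \<Otimes>\<^sub>M borel \<rightarrow>\<^sub>M S"
    by (rule measurable_compose_countable[OF A N])
  have "(\<lambda>w. if 0 \<le> snd w \<and> ennreal (snd w) < lifetime (fst w)
      then age (max 0 (snd w - jump_time (wait (fst w)) (jump_count (wait (fst w)) (snd w))))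
      (chain z0 (fst w) (jump_count (wait (fst w)) (snd w))) else z0) \<in> \<Omega> \<Otimes>\<^sub>M borel \<rightarrow>\<^sub>M S"
    using z0 by measurable
  also have "?this \<longleftrightarrow> ?thesis"
    using jump_count_bounds(1)[OF wait_pos]
    by (intro measurable_cong) (auto simp: space_pair_measure path_def Let_def lifetime_def max_def)
  finally show ?thesis .
qed

end

section \<open>The stationary growth process\<close>

context growth begin

abbreviation stat :: "((int \<Rightarrow> nat \<Rightarrow> real \<times> 'j) \<times> real) measure" where
  "stat \<equiv> stationary_space \<Omega> lifetime"

abbreviation present :: "((int \<Rightarrow> nat \<Rightarrow> real \<times> 'j) \<times> real) \<Rightarrow> 's" where
  "present w \<equiv> stationary_process lifetime path w 0"

lemma sets_stat: "sets stat = sets (PiM UNIV (\<lambda>_. \<Omega>) \<Otimes>\<^sub>M borel)"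
  unfolding stationary_space_def
  by (intro sets_pair_measure_cong sets_PiM_cong) auto

lemma cycle_start_Suc:
  "cycle_start \<tau> w (i + 1) = cycle_start \<tau> w i + enn2real (\<tau> (fst w i))"
proof (cases "0 \<le> i")
  case True
  then have "{0..<i + 1} = insert i {0..<i}" "{i + 1..<0} = {}" "{i..<0} = {}" by auto
  then show ?thesis by (simp add: cycle_start_def split_beta)
next
  case False
  then have "{i..<0} = insert i {i + 1..<0}" "{0..<i + 1} = {}" "{0..<i} = {}" by auto
  then show ?thesis by (simp add: cycle_start_def split_beta)
qed

lemma cycle_start_mono: "i \<le> j \<Longrightarrow> cycle_start \<tau> w i \<le> cycle_start \<tau> w j"
proof (induction j rule: int_ge_induct)
  case (step j)
  then show ?case by (simp add: cycle_start_Suc add_increasing2)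
qed simp

text \<open>Consecutive cycles occupy disjoint intervals, so the index in the definition of the stationary process
  is unique whenever it exists. Where it does not exist, the definite description still depends on the point
  only through an empty predicate, and measurability holds on the whole space.\<close>

lemma cycle_unique:
  assumes "cycle_start \<tau> w i \<le> t \<and> t < cycle_start \<tau> w (i + 1)"
    and "cycle_start \<tau> w j \<le> t \<and> t < cycle_start \<tau> w (j + 1)"
  shows "i = j"
proof (rule ccontr)
  assume "i \<noteq> j"
  then consider "i + 1 \<le> j" | "j + 1 \<le> i" by linarith
  then show False
    using assms cycle_start_mono[of "i + 1" j \<tau> w] cycle_start_mono[of "j + 1" i \<tau> w] by cases auto
qed

lemma present_measurable: "present \<in> stat \<rightarrow>\<^sub>M S"
proof -
  let ?N = "PiM UNIV (\<lambda>_. \<Omega>) \<Otimes>\<^sub>M borel :: ((int \<Rightarrow> nat \<Rightarrow> real \<times> 'j) \<times> real) measure"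
  have comp [measurable]: "(\<lambda>w. fst w i) \<in> ?N \<rightarrow>\<^sub>M \<Omega>" for i by measurable
  have start [measurable]: "(\<lambda>w. cycle_start lifetime w i) \<in> borel_measurable ?N" for i
    unfolding cycle_start_def split_beta' by measurable
  let ?i = "\<lambda>w. THE i. cycle_start lifetime w i \<le> 0 \<and> 0 < cycle_start lifetime w (i + 1)"
  have idx: "?i \<in> ?N \<rightarrow>\<^sub>M count_space UNIV"
  proof (rule measurable_THE[where I = UNIV])
    fix w i j assume "cycle_start lifetime w i \<le> 0 \<and> 0 < cycle_start lifetime w (i + 1)"
      "cycle_start lifetime w j \<le> 0 \<and> 0 < cycle_start lifetime w (j + 1)"
    then show "i = j" by (rule cycle_unique)
  qed auto
  have A: "(\<lambda>w. path (fst w i) (0 - cycle_start lifetime w i)) \<in> ?N \<rightarrow>\<^sub>M S" for i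
  proof -
    have "(\<lambda>w. (fst w i, 0 - cycle_start lifetime w i)) \<in> ?N \<rightarrow>\<^sub>M \<Omega> \<Otimes>\<^sub>M borel" by measurable
    from measurable_compose[OF this path_measurable] show ?thesis by simp
  qed
  have "(\<lambda>w. path (fst w (?i w)) (0 - cycle_start lifetime w (?i w))) \<in> ?N \<rightarrow>\<^sub>M S"
    by (rule measurable_compose_countable[OF A idx])
  then show ?thesis
    unfolding stationary_process_def[abs_def] Let_def by (simp only: measurable_cong_sets[OF sets_stat refl])
qed

lemma size_biased_prob:
  assumes "(\<integral>\<^sup>+\<omega>. lifetime \<omega> \<partial>\<Omega>) < \<infinity>"
  shows "prob_space (density \<Omega> (\<lambda>\<omega>. lifetime \<omega> / (\<integral>\<^sup>+\<omega>'. lifetime \<omega>' \<partial>\<Omega>)))" (is "prob_space ?D")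
proof
  let ?\<theta> = "\<integral>\<^sup>+\<omega>. lifetime \<omega> \<partial>\<Omega>"
  have "emeasure ?D (space ?D) = (\<integral>\<^sup>+\<omega>. lifetime \<omega> / ?\<theta> \<partial>\<Omega>)"
    by (subst emeasure_density) (auto intro!: nn_integral_cong)
  also have "\<dots> = ?\<theta> / ?\<theta>" by (rule nn_integral_divide) measurable
  also have "\<dots> = 1" using assms expected_lifetime_pos by (intro ennreal_divide_self) auto
  finally show "emeasure ?D (space ?D) = 1" .
qed

text \<open>Almost surely cycle 0 covers time 0, and time 0 is a uniform point of it. Size-biasing by the
  lifetime cancels the normalisation of that uniform point, which leaves the time integral over one life
  divided by the expected lifetime.\<close>

lemma present_integral:
  assumes fin: "(\<integral>\<^sup>+\<omega>. lifetime \<omega> \<partial>\<Omega>) < \<infinity>" and g: "g \<in> borel_measurable S"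
  shows "(\<integral>\<^sup>+\<omega>. lifetime \<omega> \<partial>\<Omega>) * (\<integral>\<^sup>+w. g (present w) \<partial>stat) =
    (\<Sum>n. \<integral>\<^sup>+\<omega>. g (aged \<omega> n) / of_nat (sz (chain z0 \<omega> n)) \<partial>\<Omega>)"
proof -
  define \<theta> where "\<theta> = (\<integral>\<^sup>+\<omega>. lifetime \<omega> \<partial>\<Omega>)"
  have \<theta>: "0 < \<theta>" "\<theta> < \<infinity>" using fin expected_lifetime_pos by (auto simp: \<theta>_def)
  define D where "D = density \<Omega> (\<lambda>\<omega>. lifetime \<omega> / \<theta>)"
  define Q where "Q = (\<lambda>i::int. if i = 0 then D else \<Omega>)"
  define U where "U = uniform_measure lborel {0..1::real}"
  have stat: "stat = PiM UNIV Q \<Otimes>\<^sub>M U"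
    unfolding stationary_space_def Q_def D_def U_def \<theta>_def ..
  have sD: "sets D = sets \<Omega>" "space D = space \<Omega>" by (simp_all add: D_def)
  have sQ: "sets (Q i) = sets \<Omega>" for i by (simp add: Q_def sD)
  have sU [measurable_cong]: "sets U = sets borel" by (simp add: U_def)
  have pQ: "prob_space (Q i)" for i
    using size_biased_prob[OF fin] \<Omega>.prob_space_axioms by (simp add: Q_def D_def \<theta>_def)
  interpret U: prob_space U unfolding U_def by (rule prob_space_uniform_measure) auto
  interpret P: prob_space "PiM UNIV Q" by (rule prob_space_PiM) (rule pQ)
  have life: "AE \<omega> in \<Omega>. lifetime \<omega> < \<infinity> \<and> 0 < lifetime \<omega>"
  proof (rule AE_conjI)
    show "AE \<omega> in \<Omega>. lifetime \<omega> < \<infinity>"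
      using nn_integral_PInf_AE[OF lifetime_measurable] fin by (auto simp: less_top)
    show "AE \<omega> in \<Omega>. 0 < lifetime \<omega>"
    proof (rule AE_I2)
      fix \<omega> assume "\<omega> \<in> space \<Omega>"
      then have "0 < ennreal (jump_time (wait \<omega>) 1)" by (simp add: jump_time_def wait_pos)
      also have "\<dots> \<le> lifetime \<omega>" unfolding lifetime_def explosion_time_def by (rule SUP_upper) simp
      finally show "0 < lifetime \<omega>" .
    qed
  qed
  then have "AE \<omega> in D. lifetime \<omega> < \<infinity> \<and> 0 < lifetime \<omega>"
    unfolding D_def by (subst AE_density) auto
  moreover have dist: "distr (PiM UNIV Q) D (\<lambda>p. p 0) = D"
    using distr_PiM_component[of UNIV Q 0, OF pQ] by (simp add: Q_def)
  moreover have p0: "(\<lambda>p. p 0) \<in> PiM UNIV Q \<rightarrow>\<^sub>M D"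
    using measurable_component_singleton[of 0 UNIV Q] by (simp add: Q_def)
  ultimately have AEp: "AE p in PiM UNIV Q. lifetime (p 0) < \<infinity> \<and> 0 < lifetime (p 0)"
    by (intro AE_distrD[of "\<lambda>p. p 0" "PiM UNIV Q" D "\<lambda>\<omega>. lifetime \<omega> < \<infinity> \<and> 0 < lifetime \<omega>"]) (simp_all only:)
  have AEu: "AE u in U. 0 \<le> u \<and> u < 1"
  proof -
    have "AE u::real in lborel. u \<in> {0..1} \<longrightarrow> 0 \<le> u \<and> u < 1"
      by (rule AE_mp[OF AE_lborel_singleton[of "1::real"]]) auto
    then show ?thesis unfolding U_def by (intro AE_uniform_measureI) auto
  qed
  let ?F = "\<lambda>\<omega> u. g (path \<omega> (u * enn2real (lifetime \<omega>)))"
  have Fm: "(\<lambda>(\<omega>, u). ?F \<omega> u) \<in> borel_measurable (\<Omega> \<Otimes>\<^sub>M borel)"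
  proof -
    have "(\<lambda>w. (fst w, snd w * enn2real (lifetime (fst w)))) \<in> \<Omega> \<Otimes>\<^sub>M borel \<rightarrow>\<^sub>M \<Omega> \<Otimes>\<^sub>M borel" by measurable
    from measurable_compose[OF measurable_compose[OF this path_measurable] g] show ?thesis
      by (simp add: split_beta')
  qed
  have FmU: "(\<lambda>\<omega>. \<integral>\<^sup>+u. ?F \<omega> u \<partial>U) \<in> borel_measurable \<Omega>"
    using Fm by measurable
  have eq: "present (p, u) = path (p 0) (u * enn2real (lifetime (p 0)))"
    if "lifetime (p 0) < \<infinity>" "0 < lifetime (p 0)" "0 \<le> u" "u < 1" for p u
  proof -
    define r where "r = enn2real (lifetime (p 0))"
    have r: "0 < r" using that by (simp add: r_def enn2real_positive_iff)
    have s0: "cycle_start lifetime (p, u) 0 = - u * r" by (simp add: cycle_start_def r_def)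
    have s1: "cycle_start lifetime (p, u) (0 + 1) = r - u * r"
      using cycle_start_Suc[of lifetime "(p, u)" 0] s0 by (simp add: r_def)
    have ur: "0 \<le> u * r" "u * r < r" using r that by auto
    have "(THE i. cycle_start lifetime (p, u) i \<le> 0 \<and> 0 < cycle_start lifetime (p, u) (i + 1)) = 0"
    proof (rule the_equality)
      show c: "cycle_start lifetime (p, u) 0 \<le> 0 \<and> 0 < cycle_start lifetime (p, u) (0 + 1)"
        unfolding s0 s1 using ur by simp
      show "i = 0" if "cycle_start lifetime (p, u) i \<le> 0 \<and> 0 < cycle_start lifetime (p, u) (i + 1)" for i
        by (rule cycle_unique[OF that c])
    qed
    then show ?thesis by (simp add: stationary_process_def s0 r_def)
  qed
  have gp: "(\<lambda>w. g (present w)) \<in> borel_measurable (PiM UNIV Q \<Otimes>\<^sub>M U)"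
    using measurable_compose[OF present_measurable g] by (simp add: stat)
  have "(\<integral>\<^sup>+w. g (present w) \<partial>stat) = (\<integral>\<^sup>+p. \<integral>\<^sup>+u. g (present (p, u)) \<partial>U \<partial>PiM UNIV Q)"
    unfolding stat by (rule U.nn_integral_fst[OF gp, symmetric])
  also have "\<dots> = (\<integral>\<^sup>+p. \<integral>\<^sup>+u. ?F (p 0) u \<partial>U \<partial>PiM UNIV Q)"
    using AEp
  proof (intro nn_integral_cong_AE, eventually_elim)
    case (elim p)
    have "g (present (p, u)) = ?F (p 0) u" if "0 \<le> u \<and> u < 1" for u
      using that elim by (intro arg_cong[where f = g] eq) simp_all
    then show ?case
      by (intro nn_integral_cong_AE AE_mp[OF AEu AE_I2] impI)
  qed
  also have "\<dots> = (\<integral>\<^sup>+\<omega>. \<integral>\<^sup>+u. ?F \<omega> u \<partial>U \<partial>distr (PiM UNIV Q) D (\<lambda>p. p 0))"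
    using FmU by (intro nn_integral_distr[OF p0, symmetric]) (simp add: measurable_cong_sets[OF sD(1) refl])
  also have "\<dots> = (\<integral>\<^sup>+\<omega>. lifetime \<omega> / \<theta> * (\<integral>\<^sup>+u. ?F \<omega> u \<partial>U) \<partial>\<Omega>)"
    unfolding dist unfolding D_def by (rule nn_integral_density[OF _ FmU]) measurable
  also have "\<dots> = (\<integral>\<^sup>+\<omega>. (\<integral>\<^sup>+t. indicator {t. 0 \<le> t \<and> ennreal t < lifetime \<omega>} t * g (path \<omega> t) \<partial>lborel) / \<theta> \<partial>\<Omega>)"
    using life AE_space[of \<Omega>]
  proof (intro nn_integral_cong_AE, eventually_elim)
    case (elim \<omega>)
    show ?case
    proof -
      have True: "\<omega> \<in> space \<Omega>" using elim by simp
      define r where "r = enn2real (lifetime \<omega>)"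
      have r: "0 < r" using elim by (simp add: r_def enn2real_positive_iff)
      have lr: "lifetime \<omega> = ennreal r" using elim by (simp add: r_def)
      let ?G = "\<lambda>t. g (path \<omega> t)"
      have G [measurable]: "?G \<in> borel_measurable borel"
        using measurable_compose[OF measurable_Pair1'[OF True] measurable_compose[OF path_measurable g]] by simp
      have set: "{t. 0 \<le> t \<and> ennreal t < lifetime \<omega>} = {0..<r}"
        using r by (auto simp: lr ennreal_less_iff)
      have "(\<integral>\<^sup>+t. indicator {0..<r} t * ?G t \<partial>lborel) = \<bar>r\<bar> * (\<integral>\<^sup>+u. indicator {0..<r} (0 + r * u) * ?G (0 + r * u) \<partial>lborel)"
        using r by (intro nn_integral_real_affine) auto
      also have "(\<integral>\<^sup>+u. indicator {0..<r} (0 + r * u) * ?G (0 + r * u) \<partial>lborel) =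
          (\<integral>\<^sup>+u. ?G (u * r) * indicator {0..1} u \<partial>lborel)"
      proof (rule nn_integral_cong_AE)
        show "AE u::real in lborel. indicator {0..<r} (0 + r * u) * ?G (0 + r * u) = ?G (u * r) * indicator {0..1} u"
          using AE_lborel_singleton[of "1::real"]
        proof eventually_elim
          case (elim u)
          then show ?case using r by (auto simp: indicator_def zero_le_mult_iff mult.commute)
        qed
      qed
      also have "\<dots> = (\<integral>\<^sup>+u. ?G (u * r) \<partial>U)"
        unfolding U_def by (subst nn_integral_uniform_measure) (auto simp: divide_ennreal_def)
      finally have "(\<integral>\<^sup>+t. indicator {t. 0 \<le> t \<and> ennreal t < lifetime \<omega>} t * ?G t \<partial>lborel) =
          lifetime \<omega> * (\<integral>\<^sup>+u. ?F \<omega> u \<partial>U)"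
        using r unfolding set unfolding lr by (simp only: abs_of_pos enn2real_ennreal less_imp_le)
      then show ?thesis by (simp add: divide_ennreal_def mult_ac)
    qed
  qed
  also have "\<dots> = (\<integral>\<^sup>+\<omega>. (\<integral>\<^sup>+t. indicator {t. 0 \<le> t \<and> ennreal t < lifetime \<omega>} t * g (path \<omega> t) \<partial>lborel) \<partial>\<Omega>) / \<theta>"
  proof (rule nn_integral_divide)
    have ind: "(\<lambda>w. indicator {t. 0 \<le> t \<and> ennreal t < lifetime (fst w)} (snd w) :: ennreal) \<in> borel_measurable (\<Omega> \<Otimes>\<^sub>M lborel)"
      by measurable
    have gp: "(\<lambda>w. g (path (fst w) (snd w))) \<in> borel_measurable (\<Omega> \<Otimes>\<^sub>M lborel)"
      using measurable_compose[OF path_measurable g] by (simp add: split_beta')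
    show "(\<lambda>\<omega>. \<integral>\<^sup>+t. indicator {t. 0 \<le> t \<and> ennreal t < lifetime \<omega>} t * g (path \<omega> t) \<partial>lborel) \<in> borel_measurable \<Omega>"
      using lborel.borel_measurable_nn_integral_fst[OF borel_measurable_times_ennreal[OF ind gp]] by simp
  qed
  also have "\<dots> = (\<Sum>n. \<integral>\<^sup>+\<omega>. g (aged \<omega> n) / of_nat (sz (chain z0 \<omega> n)) \<partial>\<Omega>) / \<theta>"
    by (simp only: life_integral[OF g])
  finally have "\<theta> * (\<integral>\<^sup>+w. g (present w) \<partial>stat) = \<theta> * ((\<Sum>n. \<integral>\<^sup>+\<omega>. g (aged \<omega> n) / of_nat (sz (chain z0 \<omega> n)) \<partial>\<Omega>) / \<theta>)"
    by simp
  also have "\<dots> = (\<Sum>n. \<integral>\<^sup>+\<omega>. g (aged \<omega> n) / of_nat (sz (chain z0 \<omega> n)) \<partial>\<Omega>)"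
    using \<theta> by (simp add: ennreal_times_divide mult.commute[of \<theta>] mult_divide_eq_ennreal)
  finally show ?thesis by (simp add: \<theta>_def)
qed

lemma AE_lifetime_finite:
  "(\<integral>\<^sup>+\<omega>. lifetime \<omega> \<partial>\<Omega>) < \<infinity> \<Longrightarrow> AE \<omega> in \<Omega>. lifetime \<omega> < \<infinity>"
  using nn_integral_PInf_AE[OF lifetime_measurable] by (auto simp: less_top)

end

section \<open>Plane trees\<close>

definition node :: "vertex set \<Rightarrow> vertex set \<Rightarrow> vertex set" where
  "node L R = insert [] ((#) False ` L \<union> (#) True ` R)"

lemma in_node [simp]:
  "[] \<in> node L R" "c # v \<in> node L R \<longleftrightarrow> (if c then v \<in> R else v \<in> L)"
  by (auto simp: node_def)

lemma node_inject [simp]: "node L R = node L' R' \<longleftrightarrow> L = L' \<and> R = R'"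
proof
  assume e: "node L R = node L' R'"
  have "v \<in> L \<longleftrightarrow> v \<in> L'" "v \<in> R \<longleftrightarrow> v \<in> R'" for v
    using arg_cong[OF e, of "\<lambda>T. False # v \<in> T"] arg_cong[OF e, of "\<lambda>T. True # v \<in> T"] by simp_all
  then show "L = L' \<and> R = R'" by auto
qed simp

lemma plane_tree_root: "plane_tree T \<Longrightarrow> [] \<in> T" and plane_tree_finite: "plane_tree T \<Longrightarrow> finite T"
  by (auto simp: plane_tree_def)

lemma plane_tree_leaf [simp]: "plane_tree {[]}"
  by (auto simp: plane_tree_def)

lemma node_neq_leaf [simp]: "plane_tree L \<Longrightarrow> node L R \<noteq> {[]}"
  using plane_tree_root[of L] in_node(2)[of False "[]" L R] by (metis (full_types) list.distinct(1) singletonD)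

lemma plane_tree_node [simp]:
  assumes "plane_tree L" "plane_tree R" shows "plane_tree (node L R)"
  unfolding plane_tree_def
proof (intro conjI allI impI ballI)
  show "finite (node L R)" using assms by (simp add: node_def plane_tree_def)
  fix v b assume "v @ [b] \<in> node L R"
  then show "v \<in> node L R" using assms by (cases v) (auto simp: plane_tree_def split: if_splits)
next
  fix v assume "v \<in> node L R"
  then show "v @ [False] \<in> node L R \<longleftrightarrow> v @ [True] \<in> node L R"
    using assms by (cases v) (auto simp: plane_tree_def split: if_splits)
qed simp

lemma plane_tree_prefix: "plane_tree T \<Longrightarrow> u @ w \<in> T \<Longrightarrow> u \<in> T"
proof (induction w rule: rev_induct)
  case (snoc b w)
  have "\<forall>v b. v @ [b] \<in> T \<longrightarrow> v \<in> T" using snoc.prems(1) by (simp add: plane_tree_def)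
  then have "u @ w \<in> T" using snoc.prems(2) by (metis append.assoc)
  then show ?case using snoc by blast
qed simp

text \<open>The root of a plane tree with more than one vertex has both children, and the strings above each of
  them form a plane tree.\<close>

lemma plane_tree_cases:
  assumes T: "plane_tree T"
  obtains "T = {[]}" | L R where "plane_tree L" "plane_tree R" "T = node L R"
proof (cases "T = {[]}")
  case False
  define L R where "L = {v. False # v \<in> T}" and "R = {v. True # v \<in> T}"
  have eq: "T = node L R"
  proof (rule set_eqI)
    fix v show "v \<in> T \<longleftrightarrow> v \<in> node L R"
      using plane_tree_root[OF T] by (cases v) (auto simp: L_def R_def)
  qed
  obtain c w where "c # w \<in> T"
    using False plane_tree_root[OF T] by (metis (full_types) list.exhaust singleton_iff subsetI subset_antisym)
  then have "[c] \<in> T" using plane_tree_prefix[OF T, of "[c]" w] by simp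
  moreover have "[] @ [False] \<in> T \<longleftrightarrow> [] @ [True] \<in> T"
    using T unfolding plane_tree_def by blast
  ultimately have "[False] \<in> T" "[True] \<in> T" by (cases c; simp)+
  moreover have "plane_tree {v. d # v \<in> T}" if "[d] \<in> T" for d
    unfolding plane_tree_def
  proof (intro conjI allI impI ballI)
    have "(#) d ` {v. d # v \<in> T} \<subseteq> T" by auto
    then show "finite {v. d # v \<in> T}"
      using plane_tree_finite[OF T] by (meson finite_imageD finite_subset inj_on_Cons1)
    fix v b assume "v @ [b] \<in> {v. d # v \<in> T}"
    then show "v \<in> {v. d # v \<in> T}" using plane_tree_prefix[OF T, of "d # v" "[b]"] by simp
  next
    fix v assume "v \<in> {v. d # v \<in> T}"
    then have "(d # v) @ [False] \<in> T \<longleftrightarrow> (d # v) @ [True] \<in> T"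
      using T unfolding plane_tree_def by blast
    then show "v @ [False] \<in> {v. d # v \<in> T} \<longleftrightarrow> v @ [True] \<in> {v. d # v \<in> T}" by simp
  qed (use that in simp)
  ultimately have "plane_tree L" "plane_tree R" by (simp_all add: L_def R_def)
  then show ?thesis using eq by (rule that(2))
qed (use that in simp)

lemma card_node:
  assumes "finite L" "finite R" shows "card (node L R) = Suc (card L + card R)"
proof -
  have "card ((#) False ` L \<union> (#) True ` R) = card L + card R"
    using assms by (subst card_Un_disjoint) (auto simp: card_image)
  then show ?thesis using assms unfolding node_def by (subst card_insert_disjoint) auto
qed

lemma plane_tree_induct [consumes 1, case_names leaf node]:
  assumes "plane_tree T" "P {[]}"
    "\<And>L R. plane_tree L \<Longrightarrow> plane_tree R \<Longrightarrow> P L \<Longrightarrow> P R \<Longrightarrow> P (node L R)"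
  shows "P T"
  using assms(1)
proof (induction "card T" arbitrary: T rule: less_induct)
  case less
  from less.prems show ?case
  proof (cases rule: plane_tree_cases)
    case 1 then show ?thesis using assms(2) by simp
  next
    case (2 L R)
    then have "card L < card T" "card R < card T" by (simp_all add: card_node plane_tree_finite)
    then show ?thesis using 2 less.hyps assms(3) by simp
  qed
qed

lemma leaves_leaf [simp]: "leaves {[]} = {[]}" and nonleaves_leaf [simp]: "nonleaves {[]} = {}"
  by (auto simp: leaves_def nonleaves_def)

lemma leaves_node_iff:
  assumes "plane_tree L" "plane_tree R"
  shows "[] \<notin> leaves (node L R)" "c # v \<in> leaves (node L R) \<longleftrightarrow> v \<in> leaves (if c then R else L)"
  using assms by (auto simp: leaves_def plane_tree_root)

lemma leaves_node:
  assumes "plane_tree L" "plane_tree R"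
  shows "leaves (node L R) = (#) False ` leaves L \<union> (#) True ` leaves R"
proof (rule set_eqI)
  fix v show "v \<in> leaves (node L R) \<longleftrightarrow> v \<in> (#) False ` leaves L \<union> (#) True ` leaves R"
    using leaves_node_iff[OF assms] by (cases v) auto
qed

lemma nonleaves_node_iff:
  assumes "plane_tree L" "plane_tree R"
  shows "[] \<in> nonleaves (node L R)" "c # v \<in> nonleaves (node L R) \<longleftrightarrow> v \<in> nonleaves (if c then R else L)"
  using leaves_node_iff[OF assms] by (auto simp: nonleaves_def)

lemma nonleaves_node:
  assumes "plane_tree L" "plane_tree R"
  shows "nonleaves (node L R) = insert [] ((#) False ` nonleaves L \<union> (#) True ` nonleaves R)"
proof (rule set_eqI)
  fix v show "v \<in> nonleaves (node L R) \<longleftrightarrow> v \<in> insert [] ((#) False ` nonleaves L \<union> (#) True ` nonleaves R)"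
    using nonleaves_node_iff[OF assms] by (cases v) auto
qed

lemma finite_leaves: "plane_tree T \<Longrightarrow> finite (leaves T)"
  and finite_nonleaves: "plane_tree T \<Longrightarrow> finite (nonleaves T)"
  by (auto simp: leaves_def nonleaves_def plane_tree_def)

lemma leaves_nonempty: "plane_tree T \<Longrightarrow> leaves T \<noteq> {}"
  by (induction rule: plane_tree_induct) (auto simp: leaves_node)

lemma card_leaves_pos: "plane_tree T \<Longrightarrow> 0 < card (leaves T)"
  by (simp add: card_gt_0_iff finite_leaves leaves_nonempty)

lemma card_leaves_node:
  assumes "plane_tree L" "plane_tree R"
  shows "card (leaves (node L R)) = card (leaves L) + card (leaves R)"
  unfolding leaves_node[OF assms] using assms
  by (subst card_Un_disjoint) (auto simp: card_image finite_leaves)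

lemma leaves_above_Nil [simp]: "leaves_above T [] = leaves T"
  by (simp add: leaves_above_def)

lemma leaves_above_node:
  assumes "plane_tree L" "plane_tree R"
  shows "leaves_above (node L R) (c # v) = (#) c ` leaves_above (if c then R else L) v"
proof (rule set_eqI)
  fix w show "w \<in> leaves_above (node L R) (c # v) \<longleftrightarrow> w \<in> (#) c ` leaves_above (if c then R else L) v"
    using leaves_node_iff[OF assms] by (cases w) (auto simp: leaves_above_def)
qed

lemma card_leaves_above_node:
  assumes "plane_tree L" "plane_tree R"
  shows "card (leaves_above (node L R) (c # v)) = card (leaves_above (if c then R else L) v)"
  by (simp only: leaves_above_node[OF assms] card_image[OF inj_on_Cons1])

lemma finite_leaves_above: "plane_tree T \<Longrightarrow> finite (leaves_above T v)"
  by (simp add: leaves_above_def finite_leaves)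

lemma leaves_above_nonempty: "plane_tree T \<Longrightarrow> v \<in> T \<Longrightarrow> leaves_above T v \<noteq> {}"
proof (induction T arbitrary: v rule: plane_tree_induct)
  case leaf
  then show ?case by (simp add: leaves_above_def)
next
  case (node L R)
  then show ?case
    by (cases v) (auto simp: leaves_above_node leaves_nonempty split: if_splits)
qed

lemma card_leaves_above_pos: "plane_tree T \<Longrightarrow> v \<in> T \<Longrightarrow> 0 < card (leaves_above T v)"
  by (simp add: card_gt_0_iff finite_leaves_above leaves_above_nonempty)

lemma children_of_nonleaf:
  assumes "plane_tree T" "x \<in> nonleaves T" shows "x @ [c] \<in> T"
proof -
  obtain b where b: "x \<in> T" "x @ [b] \<in> T" using assms(2) by (auto simp: nonleaves_def leaves_def)
  then have "x @ [False] \<in> T \<longleftrightarrow> x @ [True] \<in> T" using assms(1) unfolding plane_tree_def by blast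
  then show ?thesis using b by (cases b; cases c) simp_all
qed

section \<open>Grafting\<close>

lemma verts_graft [simp]: "verts (graft b v g h) = (#) b ` verts g \<union> (#) (\<not> b) ` verts h"
  and root_graft [simp]: "root_of (graft b v g h) = b # root_of g"
  and edges_graft: "edges (graft b v g h) = insert {b # v, (\<not> b) # root_of h}
        ((`) ((#) b) ` edges g \<union> (`) ((#) (\<not> b)) ` edges h)"
  by (simp_all add: graft_def)

lemma rooted_graph_graft:
  assumes g: "rooted_graph g" and h: "rooted_graph h" and v: "v \<in> verts g"
  shows "rooted_graph (graft b v g h)"
  unfolding rooted_graph_def
proof (intro conjI ballI)
  fix e assume "e \<in> edges (graft b v g h)"
  then consider "e = {b # v, (\<not> b) # root_of h}" | e' where "e' \<in> edges g" "e = (#) b ` e'"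
    | e' where "e' \<in> edges h" "e = (#) (\<not> b) ` e'"
    by (auto simp: edges_graft)
  then have "e \<subseteq> verts (graft b v g h) \<and> card e = 2"
    using assms by cases (auto simp: rooted_graph_def card_image, blast+)
  then show "e \<subseteq> verts (graft b v g h)" "card e = 2" by auto
qed (use assms in \<open>auto simp: rooted_graph_def\<close>)

lemma card_verts_graft:
  assumes "finite (verts g)" "finite (verts h)"
  shows "card (verts (graft b v g h)) = card (verts g) + card (verts h)"
  using assms unfolding verts_graft by (subst card_Un_disjoint) (auto simp: card_image)

abbreviation adj :: "rgraph \<Rightarrow> (vertex \<times> vertex) set" where
  "adj g \<equiv> {(a, b). {a, b} \<in> edges g}"

lemma reachable_sym: "(u, v) \<in> (adj g)\<^sup>* \<Longrightarrow> (v, u) \<in> (adj g)\<^sup>*"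
proof -
  have "sym (adj g)" by (auto intro!: symI simp: insert_commute)
  then show "(u, v) \<in> (adj g)\<^sup>* \<Longrightarrow> (v, u) \<in> (adj g)\<^sup>*" by (meson sym_rtrancl symD)
qed

lemma reachable_map:
  assumes "(u, w) \<in> (adj g)\<^sup>*" and "\<And>e. e \<in> edges g \<Longrightarrow> f ` e \<in> edges k"
  shows "(f u, f w) \<in> (adj k)\<^sup>*"
  using assms(1)
proof induction
  case (step y z)
  then have "f ` {y, z} \<in> edges k" by (intro assms(2)) simp
  then show ?case using step.IH by (auto intro: rtrancl.rtrancl_into_rtrancl)
qed simp

lemma connected_graft:
  assumes g: "connected_graph g" and h: "connected_graph h"
    and v: "v \<in> verts g" and r: "root_of h \<in> verts h"
  shows "connected_graph (graft b v g h)"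
proof -
  let ?k = "graft b v g h"
  have to_hub: "(w, b # v) \<in> (adj ?k)\<^sup>*" if w: "w \<in> verts ?k" for w
  proof -
    consider u where "u \<in> verts g" "w = b # u" | u where "u \<in> verts h" "w = (\<not> b) # u" using w by auto
    then show ?thesis
    proof cases
      case 1
      then have "(u, v) \<in> (adj g)\<^sup>*" using g v by (simp add: connected_graph_def)
      then show ?thesis using 1 reachable_map[of u v g "(#) b" ?k] by (auto simp: edges_graft)
    next
      case 2
      then have "(u, root_of h) \<in> (adj h)\<^sup>*" using h r by (simp add: connected_graph_def)
      then have "(w, (\<not> b) # root_of h) \<in> (adj ?k)\<^sup>*"
        using 2 reachable_map[of u "root_of h" h "(#) (\<not> b)" ?k] by (auto simp: edges_graft)
      moreover have "((\<not> b) # root_of h, b # v) \<in> adj ?k" by (simp add: edges_graft insert_commute)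
      ultimately show ?thesis by (rule rtrancl.rtrancl_into_rtrancl)
    qed
  qed
  show ?thesis
    unfolding connected_graph_def using to_hub reachable_sym by (meson rtrancl_trans)
qed

lemma shift_mod_neq:
  fixes i k n :: nat
  assumes "i < n" "0 < k" "k < n" shows "(i + k) mod n \<noteq> i"
proof (cases "i + k < n")
  case False
  then have "(i + k) mod n = i + k - n" using assms by (simp add: le_mod_geq)
  then show ?thesis using assms False by linarith
qed (use assms in simp)

text \<open>A cycle visiting both sides would have to cross the new edge in both directions, at
  consecutive steps of the cycle, so that it would have length two.\<close>

lemma acyclic_graft:
  assumes g: "rooted_graph g" "\<nexists>p. is_cycle g p" and h: "rooted_graph h" "\<nexists>p. is_cycle h p"
  shows "\<nexists>p. is_cycle (graft b v g h) p"
proof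
  let ?k = "graft b v g h"
  assume "\<exists>p. is_cycle ?k p"
  then obtain p where n: "3 \<le> length p" and d: "distinct p"
    and E: "\<And>i. i < length p \<Longrightarrow> {p ! i, p ! (Suc i mod length p)} \<in> edges ?k"
    by (auto simp: is_cycle_def)
  let ?n = "length p" and ?s = "\<lambda>i. Suc i mod length p"
  let ?x = "b # v" and ?y = "(\<not> b) # root_of h"
  have s: "?s i < ?n" for i using n by (intro mod_less_divisor) linarith
  have side: "{p ! i, p ! ?s i} = {?x, ?y} \<or> (\<exists>c u w. p ! i = c # u \<and> p ! ?s i = c # w \<and>
      {u, w} \<in> edges (if c = b then g else h))" if "i < ?n" for i
  proof -
    have pull: "\<exists>u w. P = c # u \<and> Q = c # w \<and> {u, w} = e" if "{P, Q} = (#) c ` e" for P Q c and e :: "vertex set"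
    proof -
      have "P \<in> (#) c ` e" "Q \<in> (#) c ` e" using that by auto
      then obtain u w where uw: "P = c # u" "Q = c # w" by auto
      then have "(#) c ` {u, w} = (#) c ` e" using that by simp
      then have "{u, w} = e" by (simp add: inj_image_eq_iff del: image_insert)
      then show ?thesis using uw by blast
    qed
    from E[OF that] consider "{p ! i, p ! ?s i} = {?x, ?y}"
      | e where "e \<in> edges g" "{p ! i, p ! ?s i} = (#) b ` e"
      | e where "e \<in> edges h" "{p ! i, p ! ?s i} = (#) (\<not> b) ` e"
      by (auto simp: edges_graft)
    then show ?thesis
    proof cases
      case 2
      then obtain u w where "p ! i = b # u" "p ! ?s i = b # w" "{u, w} = e"
        using pull[OF 2(2)] by blast
      then show ?thesis using 2(1) by (intro disjI2 exI[of _ b] exI[of _ u] exI[of _ w]) simp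
    next
      case 3
      then obtain u w where "p ! i = (\<not> b) # u" "p ! ?s i = (\<not> b) # w" "{u, w} = e"
        using pull[OF 3(2)] by blast
      then show ?thesis using 3(1) by (intro disjI2 exI[of _ "\<not> b"] exI[of _ u] exI[of _ w]) simp
    qed simp
  qed
  show False
  proof (cases "\<exists>i<?n. {p ! i, p ! ?s i} = {?x, ?y}")
    case False
    then have sd: "\<exists>c u w. p ! i = c # u \<and> p ! ?s i = c # w \<and> {u, w} \<in> edges (if c = b then g else h)"
      if "i < ?n" for i using side that by blast
    define c where "c = hd (p ! 0)"
    have hd: "hd (p ! i) = c" if "i < ?n" for i
      using that
    proof (induction i)
      case (Suc i)
      then have "?s i = Suc i" by simp
      then show ?case using sd[of i] Suc by auto
    qed (simp add: c_def)
    have nonempty: "p ! i = c # tl (p ! i)" if "i < ?n" for i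
      using sd[OF that] hd[OF that] by auto
    have "is_cycle (if c = b then g else h) (map tl p)"
      unfolding is_cycle_def
    proof (intro conjI allI impI)
      show "distinct (map tl p)"
      proof (subst distinct_map, intro conjI d inj_onI)
        fix P Q assume "P \<in> set p" "Q \<in> set p" "tl P = tl Q"
        then show "P = Q" using nonempty by (metis in_set_conv_nth)
      qed
      fix i assume "i < length (map tl p)"
      then have i: "i < ?n" by simp
      then obtain c' u w where "p ! i = c' # u" "p ! ?s i = c' # w" "{u, w} \<in> edges (if c' = b then g else h)"
        using sd by blast
      then show "{map tl p ! i, map tl p ! (Suc i mod length (map tl p))} \<in> edges (if c = b then g else h)"
        using hd[OF i] i s[of i] by auto
    qed (use n in simp)
    then show False using g h by (auto split: if_splits)
  next
    case True
    then obtain i where i: "i < ?n" "{p ! i, p ! ?s i} = {?x, ?y}" by blast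
    define j where "j = ?s i"
    have next_eq: "m = m'" if "m < ?n" "m' < ?n" "p ! m = p ! m'" for m m'
      using that d by (simp add: nth_eq_iff_index_eq)
    \<comment> \<open>The walk that crosses the new edge at step \<open>i\<close> must cross it again to return to \<open>p ! i\<close>.\<close>
    have "\<exists>m<?n. m \<noteq> i \<and> {p ! m, p ! ?s m} = {?x, ?y}"
    proof (rule ccontr)
      assume none: "\<not> ?thesis"
      have same: "hd (p ! ((i + Suc m) mod ?n)) = hd (p ! j)" if "m < ?n" for m
        using that
      proof (induction m)
        case (Suc m)
        have ne: "(i + Suc m) mod ?n \<noteq> i"
          using Suc.prems by (intro shift_mod_neq i(1)) simp_all
        have lt: "(i + Suc m) mod ?n < ?n" using n by (intro mod_less_divisor) linarith
        have "hd (p ! ((i + Suc m) mod ?n)) = hd (p ! ?s ((i + Suc m) mod ?n))"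
          using side[OF lt] none ne lt by auto
        moreover have "?s ((i + Suc m) mod ?n) = (i + Suc (Suc m)) mod ?n" by (simp add: mod_Suc_eq)
        ultimately show ?case using Suc by simp
      qed (simp add: j_def)
      have "i + Suc (?n - 1) = i + ?n" using n by simp
      then have "(i + Suc (?n - 1)) mod ?n = i" using i by simp
      then have "hd (p ! i) = hd (p ! j)" using same[of "?n - 1"] n by simp
      then show False using i(2) by (auto simp: j_def doubleton_eq_iff)
    qed
    then obtain m where m: "m < ?n" "m \<noteq> i" "{p ! m, p ! ?s m} = {?x, ?y}" by blast
    then have "p ! m \<noteq> p ! i" using next_eq i by blast
    then have "p ! m = p ! ?s i" "p ! ?s m = p ! i"
      using m(3) i(2) by (auto simp: doubleton_eq_iff)
    then have "m = ?s i" "?s m = i" using next_eq m i s by blast+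
    then have "(i + 2) mod ?n = i" by (simp add: mod_Suc_eq)
    then show False using n shift_mod_neq[OF i(1), of 2] by simp
  qed
qed

lemma rooted_tree_graft:
  assumes "rooted_tree g" "rooted_tree h" "v \<in> verts g"
  shows "rooted_tree (graft b v g h)"
  using assms acyclic_graft[of g h b v] connected_graft[of g h v b] rooted_graph_graft[of g h v b]
  by (auto simp: rooted_tree_def rooted_graph_def)

lemma rooted_tree_singleton: "rooted_tree singleton_graph"
proof -
  have "\<not> is_cycle ({[]}, {}, [])  p" for p
    unfolding is_cycle_def by (cases p) auto
  then show ?thesis
    by (simp add: rooted_tree_def rooted_graph_def connected_graph_def singleton_graph_def)
qed

section \<open>Isomorphism\<close>

lemma rooted_iso_refl: "rooted_iso g g"
  unfolding rooted_iso_def by (intro exI[of _ id]) auto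

lemma rooted_iso_trans:
  assumes "rooted_iso g h" "rooted_iso h k" shows "rooted_iso g k"
proof -
  obtain f f' where "bij_betw f (verts g) (verts h)" "(`) f ` edges g = edges h" "f (root_of g) = root_of h"
    "bij_betw f' (verts h) (verts k)" "(`) f' ` edges h = edges k" "f' (root_of h) = root_of k"
    using assms unfolding rooted_iso_def by blast
  moreover have "(`) (f' \<circ> f) ` edges g = (`) f' ` (`) f ` edges g"
    by (subst image_image, rule image_cong[OF refl]) (simp add: image_comp)
  ultimately show ?thesis
    unfolding rooted_iso_def
    by (intro exI[of _ "f' \<circ> f"]) (simp add: bij_betw_trans)
qed

lemma rooted_iso_sym:
  assumes "rooted_graph g" "rooted_iso g h" shows "rooted_iso h g"
proof -
  obtain f where f: "bij_betw f (verts g) (verts h)" "(`) f ` edges g = edges h" "f (root_of g) = root_of h"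
    using assms unfolding rooted_iso_def by blast
  let ?i = "inv_into (verts g) f"
  have "?i ` (f ` e) = e" if "e \<in> edges g" for e
    using that assms(1) f(1) by (intro inv_into_image_cancel) (auto simp: bij_betw_def rooted_graph_def)
  then have "(`) ?i ` edges h = edges g" by (force simp: f(2)[symmetric] image_image)
  moreover have "?i (root_of h) = root_of g"
    using f assms(1) by (auto simp: f(3)[symmetric] bij_betw_def rooted_graph_def)
  ultimately show ?thesis unfolding rooted_iso_def using bij_betw_inv_into[OF f(1)] by blast
qed

lemma iso_class_eq_iff:
  assumes "rooted_graph g" "rooted_graph h"
  shows "iso_class g = iso_class h \<longleftrightarrow> rooted_iso g h"
proof
  assume "iso_class g = iso_class h"
  moreover have "h \<in> iso_class h" using assms by (simp add: iso_class_def rooted_iso_refl)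
  ultimately show "rooted_iso g h" by (auto simp: iso_class_def)
next
  assume "rooted_iso g h"
  then show "iso_class g = iso_class h"
    unfolding iso_class_def
    using rooted_iso_trans[of g h] rooted_iso_trans[OF rooted_iso_sym[OF assms(1)], of h] by blast
qed

lemma rooted_iso_card: "rooted_iso g h \<Longrightarrow> card (verts g) = card (verts h)"
  by (auto simp: rooted_iso_def bij_betw_same_card)

abbreviation repr :: "rgraph set \<Rightarrow> rgraph" where "repr c \<equiv> SOME h. h \<in> c"

text \<open>Representatives are chosen as in the definition of the cluster process.\<close>

lemma repr_iso_class:
  assumes "rooted_graph g" shows "rooted_graph (repr (iso_class g))" "rooted_iso g (repr (iso_class g))"
proof -
  have "g \<in> iso_class g" using assms by (simp add: iso_class_def rooted_iso_refl)
  then have "repr (iso_class g) \<in> iso_class g" by (rule someI)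
  then show "rooted_graph (repr (iso_class g))" "rooted_iso g (repr (iso_class g))"
    by (auto simp: iso_class_def)
qed

text \<open>The two isomorphisms are glued along the first letter, which may be flipped.\<close>

lemma rooted_iso_graft:
  assumes g: "rooted_graph g" and h: "rooted_graph h" and v: "v \<in> verts g"
    and f: "bij_betw f (verts g) (verts g')" "(`) f ` edges g = edges g'" "f (root_of g) = root_of g'"
    and hh: "rooted_iso h h'"
  shows "rooted_iso (graft b v g h) (graft b' (f v) g' h')"
proof -
  obtain k where k: "bij_betw k (verts h) (verts h')" "(`) k ` edges h = edges h'" "k (root_of h) = root_of h'"
    using hh unfolding rooted_iso_def by blast
  define q where "q w = (if hd w = b then b' # f (tl w) else (\<not> b') # k (tl w))" for w
  have q: "q (b # w) = b' # f w" "q ((\<not> b) # w) = (\<not> b') # k w" for w by (simp_all add: q_def)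
  have im: "q ` (#) b ` A = (#) b' ` f ` A" "q ` (#) (\<not> b) ` A = (#) (\<not> b') ` k ` A" for A
    by (auto simp: image_image q)
  have "bij_betw q (verts (graft b v g h)) (verts (graft b' (f v) g' h'))"
    unfolding bij_betw_def
  proof
    show "inj_on q (verts (graft b v g h))"
    proof (rule inj_onI)
      note inj = inj_onD[OF bij_betw_imp_inj_on[OF f(1)]] inj_onD[OF bij_betw_imp_inj_on[OF k(1)]]
      fix x y assume "x \<in> verts (graft b v g h)" "y \<in> verts (graft b v g h)" "q x = q y"
      then show "x = y"
        unfolding verts_graft by (elim UnE imageE) (auto simp: q intro: inj)
    qed
    show "q ` verts (graft b v g h) = verts (graft b' (f v) g' h')"
      using f(1) k(1) by (simp add: image_Un im bij_betw_def)
  qed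
  moreover have "(`) q ` edges (graft b v g h) = edges (graft b' (f v) g' h')"
  proof -
    have "(`) q ` (`) ((#) b) ` edges g = (`) ((#) b') ` (`) f ` edges g" by (simp add: image_image im[unfolded image_image])
    moreover have "(`) q ` (`) ((#) (\<not> b)) ` edges h = (`) ((#) (\<not> b')) ` (`) k ` edges h" by (simp add: image_image im[unfolded image_image])
    ultimately show ?thesis by (simp add: edges_graft image_Un q f(2) k(2,3))
  qed
  ultimately show ?thesis unfolding rooted_iso_def using f(3) by (intro exI[of _ q]) (simp add: q)
qed

section \<open>Crossing edges\<close>

definition choices :: "vertex set \<Rightarrow> (vertex \<Rightarrow> vertex \<times> vertex) set" where
  "choices T = PiE_dflt (nonleaves T) ([], [])
     (\<lambda>x. leaves_above T (x @ [False]) \<times> leaves_above T (x @ [True]))"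

lemma choicesD:
  assumes "e \<in> choices T"
  shows "x \<in> nonleaves T \<Longrightarrow> fst (e x) \<in> leaves_above T (x @ [False]) \<and> snd (e x) \<in> leaves_above T (x @ [True])"
    "x \<notin> nonleaves T \<Longrightarrow> e x = ([], [])"
  using assms by (auto simp: choices_def PiE_dflt_def mem_Times_iff)

lemma pair_pmf_of_set:
  assumes "finite A" "A \<noteq> {}" "finite B" "B \<noteq> {}"
  shows "pair_pmf (pmf_of_set A) (pmf_of_set B) = pmf_of_set (A \<times> B)"
proof (rule pmf_eqI)
  fix x show "pmf (pair_pmf (pmf_of_set A) (pmf_of_set B)) x = pmf (pmf_of_set (A \<times> B)) x"
    using assms by (cases x) (simp add: pmf_pair pmf_of_set indicator_def card_cartesian_product)
qed

text \<open>Uniform independent end points make all families of crossing edges equally likely. The uniform form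
  turns the recursive structure into a bijection of finite sets.\<close>

lemma crossing_edges_law_uniform:
  assumes "plane_tree T" shows "crossing_edges_law T = pmf_of_set (choices T)"
proof -
  have ne: "finite (leaves_above T (x @ [c]))" "leaves_above T (x @ [c]) \<noteq> {}" if "x \<in> nonleaves T" for x c
    using assms that finite_leaves_above leaves_above_nonempty children_of_nonleaf by auto
  have "crossing_edges_law T = Pi_pmf (nonleaves T) ([], [])
      (\<lambda>x. pmf_of_set (leaves_above T (x @ [False]) \<times> leaves_above T (x @ [True])))"
    unfolding crossing_edges_law_def by (intro Pi_pmf_cong refl) (simp add: pair_pmf_of_set ne)
  also have "\<dots> = pmf_of_set (choices T)"
    unfolding choices_def using ne
    by (intro Pi_pmf_of_set finite_nonleaves assms) auto
  finally show ?thesis .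
qed

lemma finite_choices: "plane_tree T \<Longrightarrow> finite (choices T)"
  unfolding choices_def by (intro finite_PiE_dflt finite_nonleaves) (auto intro: finite_leaves_above)

lemma choices_nonempty: "plane_tree T \<Longrightarrow> choices T \<noteq> {}"
  unfolding choices_def
  by (subst PiE_dflt_empty_iff) (auto simp: finite_nonleaves leaves_above_nonempty children_of_nonleaf)

lemma choices_leaf: "choices {[]} = {\<lambda>_. ([], [])}"
  by (auto simp: choices_def PiE_dflt_def)

text \<open>The crossing edge \<open>p\<close> at the root and families of crossing edges of the two subtrees make a family for
  \<open>node L R\<close>. The dummy value at vertices other than non-leaves must not be prefixed.\<close>

definition combine :: "vertex set \<Rightarrow> vertex set \<Rightarrow> vertex \<times> vertex \<Rightarrow>
    (vertex \<Rightarrow> vertex \<times> vertex) \<Rightarrow> (vertex \<Rightarrow> vertex \<times> vertex) \<Rightarrow> vertex \<Rightarrow> vertex \<times> vertex" where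
  "combine L R p eL eR x = (case x of [] \<Rightarrow> map_prod ((#) False) ((#) True) p
     | c # y \<Rightarrow> if y \<in> nonleaves (if c then R else L)
                then map_prod ((#) c) ((#) c) ((if c then eR else eL) y) else ([], []))"

lemma combine_simps:
  "combine L R p eL eR [] = (False # fst p, True # snd p)"
  "y \<in> nonleaves L \<Longrightarrow> combine L R p eL eR (False # y) = (False # fst (eL y), False # snd (eL y))"
  "y \<in> nonleaves R \<Longrightarrow> combine L R p eL eR (True # y) = (True # fst (eR y), True # snd (eR y))"
  "y \<notin> nonleaves (if c then R else L) \<Longrightarrow> combine L R p eL eR (c # y) = ([], [])"
  by (simp_all add: combine_def map_prod_def split_beta)

lemma leaves_above_child:
  assumes "plane_tree L" "plane_tree R"
  shows "leaves_above (node L R) [c] = (#) c ` leaves (if c then R else L)"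
  using leaves_above_node[OF assms, of c "[]"] by simp

lemma combine_bij:
  assumes L: "plane_tree L" and R: "plane_tree R"
  shows "bij_betw (\<lambda>(p, eL, eR). combine L R p eL eR)
    ((leaves L \<times> leaves R) \<times> choices L \<times> choices R) (choices (node L R))"
proof (rule bij_betw_byWitness[where f' = "\<lambda>e. ((tl (fst (e [])), tl (snd (e []))),
    (\<lambda>y. map_prod tl tl (e (False # y))), (\<lambda>y. map_prod tl tl (e (True # y))))"])
  have tl: "map_prod tl tl (combine L R p eL eR (c # y)) = (if c then eR else eL) y"
    if "eL \<in> choices L" "eR \<in> choices R" for p eL eR c y
    using choicesD(2)[OF that(1), of y] choicesD(2)[OF that(2), of y]
    by (cases c; cases "y \<in> nonleaves (if c then R else L)") (auto simp: combine_simps)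
  show "\<forall>a\<in>(leaves L \<times> leaves R) \<times> choices L \<times> choices R.
       (\<lambda>e. ((tl (fst (e [])), tl (snd (e []))), (\<lambda>y. map_prod tl tl (e (False # y))),
          (\<lambda>y. map_prod tl tl (e (True # y))))) ((\<lambda>(p, eL, eR). combine L R p eL eR) a) = a"
    by (auto simp: tl combine_simps)
  have nl: "c # y \<in> nonleaves (node L R) \<longleftrightarrow> y \<in> nonleaves (if c then R else L)" for c y
    by (rule nonleaves_node_iff[OF L R])
  have e0: "fst (e []) \<in> (#) False ` leaves L" "snd (e []) \<in> (#) True ` leaves R" if "e \<in> choices (node L R)" for e
    using choicesD(1)[OF that nonleaves_node_iff(1)[OF L R]] by (simp_all add: leaves_above_child L R)
  have e1: "fst (e (c # y)) \<in> (#) c ` leaves_above (if c then R else L) (y @ [False])"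
      "snd (e (c # y)) \<in> (#) c ` leaves_above (if c then R else L) (y @ [True])"
    if "e \<in> choices (node L R)" "y \<in> nonleaves (if c then R else L)" for e c y
  proof -
    have "c # y \<in> nonleaves (node L R)" using that(2) nl by simp
    from choicesD(1)[OF that(1) this] show "fst (e (c # y)) \<in> (#) c ` leaves_above (if c then R else L) (y @ [False])"
      "snd (e (c # y)) \<in> (#) c ` leaves_above (if c then R else L) (y @ [True])"
      by (simp_all only: append_Cons leaves_above_node[OF L R])
  qed
  have e2: "e (c # y) = ([], [])" if "e \<in> choices (node L R)" "y \<notin> nonleaves (if c then R else L)" for e c y
    using choicesD(2)[OF that(1), of "c # y"] that(2) nl by simp
  show "\<forall>e\<in>choices (node L R). (\<lambda>(p, eL, eR). combine L R p eL eR)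
      ((tl (fst (e [])), tl (snd (e []))), (\<lambda>y. map_prod tl tl (e (False # y))),
          (\<lambda>y. map_prod tl tl (e (True # y)))) = e"
  proof (intro ballI)
    fix e assume e: "e \<in> choices (node L R)"
    have "combine L R (tl (fst (e [])), tl (snd (e []))) (\<lambda>y. map_prod tl tl (e (False # y)))
          (\<lambda>y. map_prod tl tl (e (True # y))) x = e x" for x
    proof (cases x)
      case Nil
      then show ?thesis using e0[OF e] by (auto simp: combine_simps prod_eq_iff)
    next
      case (Cons c y)
      show ?thesis
      proof (cases "y \<in> nonleaves (if c then R else L)")
        case True
        then show ?thesis using e1[OF e True] Cons by (cases c) (auto simp: combine_simps prod_eq_iff)
      next
        case False
        then show ?thesis using e2[OF e False] Cons by (simp add: combine_simps(4)[OF False])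
      qed
    qed
    then show "(\<lambda>(p, eL, eR). combine L R p eL eR)
      ((tl (fst (e [])), tl (snd (e []))), (\<lambda>y. map_prod tl tl (e (False # y))),
          (\<lambda>y. map_prod tl tl (e (True # y)))) = e" by (simp add: fun_eq_iff)
  qed
  show "(\<lambda>(p, eL, eR). combine L R p eL eR) ` ((leaves L \<times> leaves R) \<times> choices L \<times> choices R) \<subseteq> choices (node L R)"
  proof safe
    fix a b eL eR assume a: "a \<in> leaves L" "b \<in> leaves R" and e: "eL \<in> choices L" "eR \<in> choices R"
    have "combine L R (a, b) eL eR x \<in> leaves_above (node L R) (x @ [False]) \<times> leaves_above (node L R) (x @ [True])"
      if x: "x \<in> nonleaves (node L R)" for x
    proof (cases x)
      case Nil
      then show ?thesis using a by (simp add: combine_simps leaves_above_child[OF L R])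
    next
      case (Cons c y)
      then have y: "y \<in> nonleaves (if c then R else L)" using x nl by simp
      show ?thesis
        using y choicesD(1)[OF e(1), of y] choicesD(1)[OF e(2), of y] Cons
        by (cases c) (simp_all add: combine_simps leaves_above_node[OF L R])
    qed
    moreover have "combine L R (a, b) eL eR x = ([], [])" if x: "x \<notin> nonleaves (node L R)" for x
      using x nonleaves_node_iff[OF L R] by (cases x) (simp_all add: combine_simps)
    ultimately show "combine L R (a, b) eL eR \<in> choices (node L R)"
      by (simp add: choices_def PiE_dflt_def)
  qed
  show "(\<lambda>e. ((tl (fst (e [])), tl (snd (e []))), (\<lambda>y. map_prod tl tl (e (False # y))),
      (\<lambda>y. map_prod tl tl (e (True # y))))) ` choices (node L R)
      \<subseteq> (leaves L \<times> leaves R) \<times> choices L \<times> choices R"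
  proof (rule image_subsetI)
    fix e assume e: "e \<in> choices (node L R)"
    have sub: "(\<lambda>y. map_prod tl tl (e (c # y))) \<in> choices (if c then R else L)" for c
      unfolding choices_def PiE_dflt_def
    proof (intro CollectI allI conjI impI)
      fix y assume y: "y \<in> nonleaves (if c then R else L)"
      show "map_prod tl tl (e (c # y)) \<in> leaves_above (if c then R else L) (y @ [False]) \<times> leaves_above (if c then R else L) (y @ [True])"
        using e1[OF e y] by (auto simp: mem_Times_iff)
    next
      fix y assume y: "y \<notin> nonleaves (if c then R else L)"
      show "map_prod tl tl (e (c # y)) = ([], [])" using e2[OF e y] by simp
    qed
    show "((tl (fst (e [])), tl (snd (e []))), (\<lambda>y. map_prod tl tl (e (False # y))), (\<lambda>y. map_prod tl tl (e (True # y))))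
        \<in> (leaves L \<times> leaves R) \<times> choices L \<times> choices R"
      using sub[of False] sub[of True] e0[OF e] by auto
  qed
qed

definition tree_cluster :: "vertex set \<Rightarrow> vertex \<Rightarrow> (vertex \<Rightarrow> vertex \<times> vertex) \<Rightarrow> rgraph" where
  "tree_cluster T \<rho> e = (leaves T, (\<lambda>x. {fst (e x), snd (e x)}) ` nonleaves T, \<rho>)"

lemma tree_cluster_leaf: "tree_cluster {[]} [] e = singleton_graph"
  by (simp add: tree_cluster_def singleton_graph_def)

lemma edges_tree_cluster_node:
  assumes "plane_tree L" "plane_tree R"
  shows "edges (tree_cluster (node L R) \<rho> (combine L R p eL eR)) = insert {False # fst p, True # snd p}
    ((`) ((#) False) ` edges (tree_cluster L \<rho>L eL) \<union> (`) ((#) True) ` edges (tree_cluster R \<rho>R eR))"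
proof -
  have "(\<lambda>x. {fst (combine L R p eL eR (c # x)), snd (combine L R p eL eR (c # x))}) ` nonleaves (if c then R else L) =
      (\<lambda>x. (#) c ` {fst ((if c then eR else eL) x), snd ((if c then eR else eL) x)}) ` nonleaves (if c then R else L)" for c
    by (intro image_cong refl) (cases c; simp add: combine_simps)
  from this[of False] this[of True] show ?thesis
    by (simp add: tree_cluster_def nonleaves_node[OF assms] image_Un image_image combine_simps)
qed

text \<open>Grafting at \<open>v\<close> creates the crossing edge from \<open>v\<close> to the root of the grafted cluster and keeps the
  other root; the mirror image follows.\<close>

lemma graft_tree_cluster_left:
  assumes "plane_tree L" "plane_tree R"
  shows "graft False v (tree_cluster L \<rho>L eL) (tree_cluster R \<rho>R eR) =
    tree_cluster (node L R) (False # \<rho>L) (combine L R (v, \<rho>R) eL eR)"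
  using edges_tree_cluster_node[OF assms, of "False # \<rho>L" "(v, \<rho>R)" eL eR \<rho>L \<rho>R]
  by (simp add: prod_eq_iff edges_graft) (simp add: tree_cluster_def leaves_node[OF assms])

lemma graft_tree_cluster_right:
  assumes "plane_tree L" "plane_tree R"
  shows "graft True v (tree_cluster R \<rho>R eR) (tree_cluster L \<rho>L eL) =
    tree_cluster (node L R) (True # \<rho>R) (combine L R (\<rho>L, v) eL eR)"
  using edges_tree_cluster_node[OF assms, of "True # \<rho>R" "(\<rho>L, v)" eL eR \<rho>L \<rho>R]
  by (simp add: prod_eq_iff edges_graft Un_commute)
     (simp add: tree_cluster_def leaves_node[OF assms] Un_commute insert_commute)

text \<open>Every such cluster arises by successive graftings, which preserve trees.\<close>

lemma rooted_tree_tree_cluster: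
  assumes "plane_tree T" "\<rho> \<in> leaves T" "e \<in> choices T"
  shows "rooted_tree (tree_cluster T \<rho> e)"
  using assms
proof (induction T arbitrary: \<rho> e rule: plane_tree_induct)
  case leaf
  then show ?case by (simp add: tree_cluster_leaf rooted_tree_singleton)
next
  case (node L R)
  note LR = node.hyps(1,2)
  have verts: "verts (tree_cluster T \<rho> e) = leaves T" "root_of (tree_cluster T \<rho> e) = \<rho>" for T \<rho> e
    by (simp_all add: tree_cluster_def)
  have "e \<in> (\<lambda>(p, eL, eR). combine L R p eL eR) ` ((leaves L \<times> leaves R) \<times> choices L \<times> choices R)"
    using node.prems(2) combine_bij[OF LR] by (simp add: bij_betw_def)
  then obtain a b eL eR where
    p: "a \<in> leaves L" "b \<in> leaves R" "eL \<in> choices L" "eR \<in> choices R" "e = combine L R (a, b) eL eR"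
    by auto
  from node.prems(1) consider \<rho>' where "\<rho>' \<in> leaves L" "\<rho> = False # \<rho>'" | \<rho>' where "\<rho>' \<in> leaves R" "\<rho> = True # \<rho>'"
    unfolding leaves_node[OF LR] by blast
  then show ?case
  proof cases
    case 1
    have "rooted_tree (graft False a (tree_cluster L \<rho>' eL) (tree_cluster R b eR))"
      using node.IH 1 p by (intro rooted_tree_graft) (simp_all add: verts)
    then show ?thesis using p 1 by (simp add: graft_tree_cluster_left[OF LR])
  next
    case 2
    have "rooted_tree (graft True b (tree_cluster R \<rho>' eR) (tree_cluster L a eL))"
      using node.IH 2 p by (intro rooted_tree_graft) (simp_all add: verts)
    then show ?thesis using p 2 by (simp add: graft_tree_cluster_right[OF LR])
  qed
qed

text \<open>The first letter at which two strings differ determines their longest common prefix.\<close>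

lemma branching_point_unique:
  assumes "prefix (x @ [c]) a" "prefix (x @ [\<not> c]) b" "prefix (y @ [d]) a" "prefix (y @ [\<not> d]) b"
  shows "x = y \<and> c = d"
proof -
  have nth: "w ! i = (u @ [k]) ! i" if "prefix (u @ [k]) w" "i \<le> length u" for u w :: vertex and i k
    using that by (auto simp: prefix_def nth_append)
  have len: "length x = length y"
  proof (rule ccontr)
    assume "length x \<noteq> length y"
    then consider "length x < length y" | "length y < length x" by linarith
    then show False
    proof cases
      case 1
      then have "a ! length x = b ! length x"
        using nth[OF assms(3), of "length x"] nth[OF assms(4), of "length x"] by (simp add: nth_append)
      then show False using nth[OF assms(1), of "length x"] nth[OF assms(2), of "length x"] by simp
    next
      case 2
      then have "a ! length y = b ! length y"
        using nth[OF assms(1), of "length y"] nth[OF assms(2), of "length y"] by (simp add: nth_append)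
      then show False using nth[OF assms(3), of "length y"] nth[OF assms(4), of "length y"] by simp
    qed
  qed
  moreover have "prefix (x @ [c]) (y @ [d])"
    using len by (intro prefix_length_prefix[OF assms(1,3)]) simp
  ultimately show ?thesis by (auto simp: prefix_def)
qed

text \<open>The longest common prefix of the end points of \<open>e x\<close> is \<open>x\<close>, so no other edge of the cluster crosses
  at \<open>x\<close>.\<close>

lemma crossing_edge_char:
  assumes e: "e \<in> choices T" and x: "x \<in> nonleaves T"
  shows "joins_subtrees T x (a, b) \<and> {a, b} \<in> edges (tree_cluster T \<rho> e) \<longleftrightarrow> (a, b) = e x"
proof
  assume l: "joins_subtrees T x (a, b) \<and> {a, b} \<in> edges (tree_cluster T \<rho> e)"
  then obtain y where y: "y \<in> nonleaves T" "{a, b} = {fst (e y), snd (e y)}"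
    by (auto simp: tree_cluster_def)
  have ab: "prefix (x @ [False]) a" "prefix (x @ [\<not> False]) b"
    using l by (auto simp: joins_subtrees_def leaves_above_def)
  have ey: "prefix (y @ [False]) (fst (e y))" "prefix (y @ [\<not> False]) (snd (e y))"
    using choicesD(1)[OF e y(1)] by (auto simp: leaves_above_def)
  from y(2) consider "a = fst (e y)" "b = snd (e y)" | "a = snd (e y)" "b = fst (e y)"
    by (auto simp: doubleton_eq_iff)
  then show "(a, b) = e x"
  proof cases
    case 1
    then show ?thesis using branching_point_unique[OF ab] ey by (metis prod.collapse)
  next
    case 2
    then show ?thesis using branching_point_unique[OF ab, of y True] ey by simp
  qed
next
  assume "(a, b) = e x"
  then have "a = fst (e x)" "b = snd (e x)" by (auto dest: arg_cong[where f = fst] arg_cong[where f = snd])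
  then show "joins_subtrees T x (a, b) \<and> {a, b} \<in> edges (tree_cluster T \<rho> e)"
    using choicesD(1)[OF e x] x by (auto simp: joins_subtrees_def tree_cluster_def)
qed

lemma crossing_edge_tree_cluster:
  assumes "e \<in> choices T"
  shows "crossing_edge ((T, s), tree_cluster T \<rho> e) = e"
proof
  fix x
  show "crossing_edge ((T, s), tree_cluster T \<rho> e) x = e x"
  proof (cases "x \<in> nonleaves T")
    case True
    have "(THE p. case p of (a, b) \<Rightarrow> joins_subtrees T x (a, b) \<and> {a, b} \<in> edges (tree_cluster T \<rho> e)) = e x"
    proof (rule the_equality)
      show "case e x of (a, b) \<Rightarrow> joins_subtrees T x (a, b) \<and> {a, b} \<in> edges (tree_cluster T \<rho> e)"
        using crossing_edge_char[OF assms True] by (simp add: split_beta)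
      show "p = e x" if "case p of (a, b) \<Rightarrow> joins_subtrees T x (a, b) \<and> {a, b} \<in> edges (tree_cluster T \<rho> e)" for p
        using that crossing_edge_char[OF assms True, of "fst p" "snd p" \<rho>] by (simp add: split_beta)
    qed
    then show ?thesis using True by (simp add: crossing_edge_def)
  next
    case False
    then show ?thesis using choicesD(2)[OF assms False] by (simp add: crossing_edge_def)
  qed
qed

lemma unique_crossing_edge:
  assumes e: "e \<in> choices T" and x: "x \<in> nonleaves T"
  shows "\<exists>!d. d \<in> edges (tree_cluster T \<rho> e) \<and> (\<exists>a b. d = {a, b} \<and> joins_subtrees T x (a, b))"
proof (rule ex1I[of _ "{fst (e x), snd (e x)}"])
  show "{fst (e x), snd (e x)} \<in> edges (tree_cluster T \<rho> e) \<and>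
      (\<exists>a b. {fst (e x), snd (e x)} = {a, b} \<and> joins_subtrees T x (a, b))"
    using crossing_edge_char[OF e x, of "fst (e x)" "snd (e x)" \<rho>] by (cases "e x") auto
  fix d assume "d \<in> edges (tree_cluster T \<rho> e) \<and> (\<exists>a b. d = {a, b} \<and> joins_subtrees T x (a, b))"
  then obtain a b where "d = {a, b}" "joins_subtrees T x (a, b) \<and> {a, b} \<in> edges (tree_cluster T \<rho> e)" by blast
  then show "d = {fst (e x), snd (e x)}"
    using crossing_edge_char[OF e x, of a b \<rho>] by (metis fst_conv snd_conv)
qed

section \<open>The critical binary Galton--Watson tree\<close>

abbreviation plane_trees :: "vertex set set" where "plane_trees \<equiv> {T. plane_tree T}"

lemma countable_plane_trees: "countable plane_trees"
  by (rule countable_subset[OF _ countable_Collect_finite]) (auto simp: plane_tree_finite)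

text \<open>The tree depends on the coins at its own vertices only, so the event is a finite cylinder.\<close>

lemma gw_tree_iff:
  assumes T: "plane_tree T"
  shows "gw_tree c = T \<longleftrightarrow> (\<forall>v\<in>T. c v \<longleftrightarrow> v \<in> nonleaves T)"
proof
  have ext: "v @ [b] \<in> gw_tree c \<longleftrightarrow> v \<in> gw_tree c \<and> c v" for v b
  proof -
    have "strict_prefix u (v @ [b]) \<longleftrightarrow> strict_prefix u v \<or> u = v" for u
      unfolding strict_prefix_def prefix_snoc by (auto dest: prefix_length_le)
    then show ?thesis by (auto simp: gw_tree_def)
  qed
  show "\<forall>v\<in>T. c v \<longleftrightarrow> v \<in> nonleaves T" if "gw_tree c = T"
    using ext unfolding that by (auto simp: nonleaves_def leaves_def)
  assume c: "\<forall>v\<in>T. c v \<longleftrightarrow> v \<in> nonleaves T"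
  have "v \<in> gw_tree c \<longleftrightarrow> v \<in> T" for v
  proof (induction v rule: rev_induct)
    case Nil
    then show ?case using plane_tree_root[OF T] by (simp add: gw_tree_def)
  next
    case (snoc b v)
    have "v @ [b] \<in> T \<longleftrightarrow> v \<in> nonleaves T"
      using children_of_nonleaf[OF T] plane_tree_prefix[OF T] by (auto simp: nonleaves_def leaves_def)
    then show ?case using snoc c ext by (auto simp: nonleaves_def)
  qed
  then show "gw_tree c = T" by auto
qed

lemma prob_space_gw_coins: "prob_space gw_coins"
  unfolding gw_coins_def by (intro prob_space_PiM prob_space_measure_pmf)

lemma cylinder_sets:
  assumes "finite J" "\<And>j. j \<in> J \<Longrightarrow> A j \<in> sets (M j)"
  shows "{x \<in> space (PiM UNIV M). \<forall>j\<in>J. x j \<in> A j} \<in> sets (PiM UNIV M)"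
proof -
  have "{x \<in> space (PiM UNIV M). \<forall>j\<in>J. x j \<in> A j} = prod_emb UNIV M J (Pi\<^sub>E J A)"
    unfolding prod_emb_def using assms by (auto simp: space_PiM Pi_iff)
  then show ?thesis using assms by (simp add: sets_PiM_I)
qed

lemma gw_event_emeasure:
  assumes T: "plane_tree T"
  shows "{c \<in> space gw_coins. gw_tree c = T} \<in> sets gw_coins"
    and "emeasure gw_coins {c \<in> space gw_coins. gw_tree c = T} = ennreal ((1/2) ^ card T)"
proof -
  let ?M = "\<lambda>_::vertex. measure_pmf (bernoulli_pmf (1/2))"
  interpret product_prob_space ?M UNIV ..
  have eq: "{c \<in> space gw_coins. gw_tree c = T} = {c \<in> space (PiM UNIV ?M). \<forall>v\<in>T. c v \<in> {v \<in> nonleaves T}}"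
    by (auto simp: gw_coins_def gw_tree_iff[OF T])
  show "{c \<in> space gw_coins. gw_tree c = T} \<in> sets gw_coins"
    unfolding eq unfolding gw_coins_def by (intro cylinder_sets plane_tree_finite[OF T]) auto
  have "emeasure (PiM UNIV ?M) {c \<in> space (PiM UNIV ?M). \<forall>v\<in>T. c v \<in> {v \<in> nonleaves T}} =
      (\<Prod>v\<in>T. emeasure (measure_pmf (bernoulli_pmf (1/2))) {v \<in> nonleaves T})"
    using plane_tree_finite[OF T] by (intro emeasure_PiM_Collect) auto
  also have "\<dots> = (\<Prod>v\<in>T. ennreal (1/2))"
  proof (intro prod.cong refl)
    fix v show "emeasure (measure_pmf (bernoulli_pmf (1/2))) {v \<in> nonleaves T} = ennreal (1/2)"
      by (cases "v \<in> nonleaves T") (simp_all add: emeasure_pmf_single)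
  qed
  also have "\<dots> = ennreal ((1/2) ^ card T)" by (simp add: ennreal_power del: ennreal_half)
  finally show "emeasure gw_coins {c \<in> space gw_coins. gw_tree c = T} = ennreal ((1/2) ^ card T)"
    unfolding eq unfolding gw_coins_def .
qed

lemma gw_prob_eq: "plane_tree T \<Longrightarrow> gw_prob T = (1/2) ^ card T"
  by (simp add: gw_prob_def measure_def gw_event_emeasure)

lemma two_halves: "2 * (ennreal (1/2) * a) = a"
proof -
  have "2 * ennreal (1/2) = 1"
    by (subst ennreal_numeral[symmetric], subst ennreal_mult'[symmetric]) simp_all
  then show ?thesis by (simp add: mult.assoc[symmetric])
qed

lemma gw_weight_node:
  assumes "plane_tree L" "plane_tree R"
  shows "ennreal ((1/2) ^ card (node L R)) = ennreal (1/2) * (ennreal ((1/2) ^ card L) * ennreal ((1/2) ^ card R))"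
  using assms by (simp add: card_node plane_tree_finite ennreal_mult'[symmetric] power_add del: ennreal_half)

lemma plane_trees_integral:
  fixes F :: "vertex set \<Rightarrow> ennreal"
  shows "(\<integral>\<^sup>+T. F T \<partial>count_space plane_trees) =
    F {[]} + (\<integral>\<^sup>+L. \<integral>\<^sup>+R. F (node L R) \<partial>count_space plane_trees \<partial>count_space plane_trees)"
proof -
  let ?P = plane_trees
  let ?I = "(\<lambda>(L, R). node L R) ` (?P \<times> ?P)"
  have P: "T \<in> ?P \<longleftrightarrow> T = {[]} \<or> T \<in> ?I" for T
  proof
    assume "T \<in> ?P"
    then have "plane_tree T" by simp
    then show "T = {[]} \<or> T \<in> ?I" by (cases rule: plane_tree_cases) auto
  qed auto
  have disj: "{[]} \<notin> ?I"
  proof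
    assume "{[]} \<in> ?I"
    then obtain L R where "plane_tree L" "{[]} = node L R" by auto
    then show False using node_neq_leaf[of L R] by simp
  qed
  have ind: "indicator ?P T = (indicator {{[]}} T + indicator ?I T :: ennreal)" for T
    using P[of T] disj by (cases "T = {[]}"; cases "T \<in> ?I") (simp_all only: indicator_simps singleton_iff, simp_all)
  have "(\<integral>\<^sup>+T. F T \<partial>count_space ?P) = (\<integral>\<^sup>+T. F T * indicator ?P T \<partial>count_space UNIV)"
    by (simp add: nn_integral_count_space_indicator)
  also have "\<dots> = (\<integral>\<^sup>+T. F T * indicator {{[]}} T + F T * indicator ?I T \<partial>count_space UNIV)"
    by (simp only: ind distrib_left)
  also have "\<dots> = (\<integral>\<^sup>+T. F T \<partial>count_space {{[]}}) + (\<integral>\<^sup>+T. F T \<partial>count_space ((\<lambda>(L, R). node L R) ` (?P \<times> ?P)))"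
    by (simp add: nn_integral_add nn_integral_count_space_indicator)
  also have "(\<integral>\<^sup>+T. F T \<partial>count_space {{[]}}) = F {[]}"
    by (simp add: nn_integral_count_space_finite)
  also have "(\<integral>\<^sup>+T. F T \<partial>count_space ((\<lambda>(L, R). node L R) ` (?P \<times> ?P))) =
      (\<integral>\<^sup>+p. F ((\<lambda>(L, R). node L R) p) \<partial>count_space (?P \<times> ?P))"
    by (intro nn_integral_bij_count_space[symmetric] inj_on_imp_bij_betw) (auto simp: inj_on_def)
  also have "\<dots> = (\<integral>\<^sup>+p. F (node (fst p) (snd p)) * indicator (?P \<times> ?P) p \<partial>count_space UNIV)"
    by (simp add: nn_integral_count_space_indicator split_beta)
  also have "\<dots> = (\<integral>\<^sup>+L. \<integral>\<^sup>+R. F (node L R) * indicator (?P \<times> ?P) (L, R) \<partial>count_space UNIV \<partial>count_space UNIV)"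
    by (subst nn_integral_fst_count_space[symmetric]) simp
  also have "\<dots> = (\<integral>\<^sup>+L. (\<integral>\<^sup>+R. F (node L R) * indicator ?P R \<partial>count_space UNIV) * indicator ?P L \<partial>count_space UNIV)"
    by (intro nn_integral_cong) (auto simp: indicator_def)
  also have "\<dots> = (\<integral>\<^sup>+L. \<integral>\<^sup>+R. F (node L R) \<partial>count_space ?P \<partial>count_space ?P)"
    by (simp add: nn_integral_count_space_indicator)
  finally show ?thesis .
qed

text \<open>The probability \<open>q\<close> of a finite tree solves \<open>q = 1/2 + q^2/2\<close>, a double root at \<open>q = 1\<close>.\<close>

lemma gw_weights_sum: "(\<integral>\<^sup>+T. ennreal ((1/2) ^ card T) \<partial>count_space plane_trees) = 1" (is "?S = 1")
proof -
  interpret G: prob_space gw_coins by (rule prob_space_gw_coins)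
  have "?S = (\<integral>\<^sup>+T. emeasure gw_coins {c \<in> space gw_coins. gw_tree c = T} \<partial>count_space plane_trees)"
    by (intro nn_integral_cong) (simp add: gw_event_emeasure)
  also have "\<dots> = emeasure gw_coins (\<Union>T\<in>plane_trees. {c \<in> space gw_coins. gw_tree c = T})"
    by (intro emeasure_UN_countable[symmetric] countable_plane_trees)
       (auto simp: disjoint_family_on_def gw_event_emeasure)
  also have "\<dots> \<le> 1" by (rule G.emeasure_le_1)
  finally obtain s where s: "0 \<le> s" "?S = ennreal s"
    by (cases ?S) (auto simp: top_unique)
  have "?S = ennreal (1/2) + (\<integral>\<^sup>+L. \<integral>\<^sup>+R. ennreal (1/2) * (ennreal ((1/2) ^ card L) * ennreal ((1/2) ^ card R)) \<partial>count_space plane_trees \<partial>count_space plane_trees)"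
    by (subst plane_trees_integral) (auto intro!: arg_cong2[where f = "(+)"] nn_integral_cong simp: gw_weight_node)
  also have "\<dots> = ennreal (1/2) + ennreal (1/2) * (?S * ?S)"
    by (simp add: nn_integral_cmult nn_integral_multc)
  finally have "s = 1/2 + 1/2 * (s * s)"
    using s by (simp add: ennreal_mult'[symmetric] ennreal_plus[symmetric] del: ennreal_plus ennreal_half)
  then have "(s - 1) * (s - 1) = 0" by (simp add: field_simps)
  then show ?thesis using s by simp
qed

definition gw_pmf :: "vertex set pmf" where
  "gw_pmf = embed_pmf (\<lambda>T. if plane_tree T then (1/2) ^ card T else 0)"

lemma pmf_gw: "pmf gw_pmf T = (if plane_tree T then (1/2) ^ card T else 0)"
  unfolding gw_pmf_def
proof (rule pmf_embed_pmf)
  have "(\<integral>\<^sup>+T. ennreal (if plane_tree T then (1/2) ^ card T else 0) \<partial>count_space UNIV) =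
      (\<integral>\<^sup>+T. ennreal ((1/2) ^ card T) \<partial>count_space plane_trees)"
    by (auto simp: nn_integral_count_space_indicator indicator_def intro!: nn_integral_cong)
  then show "(\<integral>\<^sup>+T. ennreal (if plane_tree T then (1/2) ^ card T else 0) \<partial>count_space UNIV) = 1"
    by (simp only: gw_weights_sum)
qed simp

lemma set_gw_pmf: "set_pmf gw_pmf = plane_trees"
  by (auto simp: set_pmf_iff pmf_gw split: if_splits)

lemma gw_pmf_integral:
  "(\<integral>\<^sup>+T. f T \<partial>gw_pmf) = (\<integral>\<^sup>+T. ennreal ((1/2) ^ card T) * f T \<partial>count_space plane_trees)"
  by (auto simp: nn_integral_measure_pmf pmf_gw nn_integral_count_space_indicator indicator_def intro!: nn_integral_cong)

text \<open>Branching property at the root, multiplied by 2 to avoid fractions.\<close>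

lemma gw_pmf_recursion:
  fixes f :: "vertex set \<Rightarrow> ennreal"
  shows "2 * (\<integral>\<^sup>+T. f T \<partial>gw_pmf) = f {[]} + (\<integral>\<^sup>+L. \<integral>\<^sup>+R. f (node L R) \<partial>gw_pmf \<partial>gw_pmf)"
proof -
  let ?w = "\<lambda>T::vertex set. ennreal ((1/2) ^ card T)"
  have "(\<integral>\<^sup>+T. f T \<partial>gw_pmf) = ennreal (1/2) * f {[]} +
      (\<integral>\<^sup>+L. \<integral>\<^sup>+R. ennreal (1/2) * (?w L * (?w R * f (node L R))) \<partial>count_space plane_trees \<partial>count_space plane_trees)"
    unfolding gw_pmf_integral
    by (subst plane_trees_integral)
       (auto intro!: arg_cong2[where f = "(+)"] nn_integral_cong simp: gw_weight_node mult.assoc)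
  also have "\<dots> = ennreal (1/2) * (f {[]} + (\<integral>\<^sup>+L. \<integral>\<^sup>+R. f (node L R) \<partial>gw_pmf \<partial>gw_pmf))"
    by (simp add: gw_pmf_integral nn_integral_cmult distrib_left)
  finally show ?thesis by (simp only: two_halves)
qed

section \<open>Spent times\<close>

text \<open>One unit rate clock per vertex of the infinite tree. Scaling the clock at a vertex by the number of leaves
  above it gives the spent time. As the clocks do not refer to the tree, they split into the clocks of
  the two subtrees without any conditioning.\<close>

definition clocks :: "(vertex \<Rightarrow> real) measure" where
  "clocks = PiM UNIV (\<lambda>_. exp_clock)"

lemma prob_space_clocks: "prob_space clocks"
  unfolding clocks_def by (intro prob_space_PiM prob_space_exp_clock)

lemma space_clocks: "X \<in> space clocks \<longleftrightarrow> (\<forall>v. 0 < X v)"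
  by (auto simp: clocks_def space_PiM PiE_iff space_exp_clock)

lemma clock_component: "(\<lambda>X. X v) \<in> clocks \<rightarrow>\<^sub>M exp_clock"
  unfolding clocks_def by (rule measurable_component_singleton) simp

lemma clock_component_borel: "(\<lambda>X. X v) \<in> borel_measurable clocks"
  by (rule measurable_compose[OF clock_component measurable_exp_clock_id])

definition join_clocks :: "real \<Rightarrow> (vertex \<Rightarrow> real) \<Rightarrow> (vertex \<Rightarrow> real) \<Rightarrow> vertex \<Rightarrow> real" where
  "join_clocks x XL XR v = (case v of [] \<Rightarrow> x | c # w \<Rightarrow> if c then XR w else XL w)"

lemma join_clocks_simps [simp]:
  "join_clocks x XL XR [] = x" "join_clocks x XL XR (c # w) = (if c then XR w else XL w)"
  by (simp_all add: join_clocks_def)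

lemma join_clocks_measurable:
  "(\<lambda>(x, XL, XR). join_clocks x XL XR) \<in> exp_clock \<Otimes>\<^sub>M clocks \<Otimes>\<^sub>M clocks \<rightarrow>\<^sub>M clocks"
proof -
  have "(\<lambda>w. join_clocks (fst w) (fst (snd w)) (snd (snd w)) v) \<in> exp_clock \<Otimes>\<^sub>M clocks \<Otimes>\<^sub>M clocks \<rightarrow>\<^sub>M exp_clock" for v
  proof (cases v)
    case (Cons c w)
    then show ?thesis
      using measurable_compose[OF _ clock_component[of w], of "\<lambda>w. fst (snd w)" "exp_clock \<Otimes>\<^sub>M clocks \<Otimes>\<^sub>M clocks"]
        measurable_compose[OF _ clock_component[of w], of "\<lambda>w. snd (snd w)" "exp_clock \<Otimes>\<^sub>M clocks \<Otimes>\<^sub>M clocks"]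
      by simp
  qed simp
  then have "(\<lambda>w v. join_clocks (fst w) (fst (snd w)) (snd (snd w)) v) \<in> exp_clock \<Otimes>\<^sub>M clocks \<Otimes>\<^sub>M clocks \<rightarrow>\<^sub>M PiM UNIV (\<lambda>_. exp_clock)"
    by (intro measurable_PiM_single') (auto simp: space_PiM PiE_iff dest: measurable_space)
  then show ?thesis by (simp add: clocks_def split_beta')
qed

text \<open>Independent clocks on the binary tree are a root clock and independent clocks on its two halves.\<close>

lemma join_clocks_distr:
  "distr (exp_clock \<Otimes>\<^sub>M clocks \<Otimes>\<^sub>M clocks) clocks (\<lambda>(x, XL, XR). join_clocks x XL XR) = clocks"
proof -
  interpret E: prob_space exp_clock by (rule prob_space_exp_clock)
  interpret P: product_prob_space "\<lambda>_::vertex. exp_clock" UNIV ..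
  interpret C: prob_space clocks by (rule prob_space_clocks)
  interpret CC: pair_prob_space clocks clocks ..
  have "distr (exp_clock \<Otimes>\<^sub>M clocks \<Otimes>\<^sub>M clocks) clocks (\<lambda>(x, XL, XR). join_clocks x XL XR) = PiM UNIV (\<lambda>_. exp_clock)"
  proof (rule P.PiM_eq)
    fix J :: "vertex set" and F :: "vertex \<Rightarrow> real set"
    assume J: "finite J" "J \<subseteq> UNIV" and F: "\<And>j. j \<in> J \<Longrightarrow> F j \<in> sets exp_clock"
    define F' where "F' j = (if j \<in> J then F j else space exp_clock)" for j
    have F' [measurable]: "F' j \<in> sets exp_clock" for j using F by (simp add: F'_def)
    define K where "K c = {w. c # w \<in> J}" for c
    have K: "finite (K c)" for c
    proof -
      have "(#) c ` K c \<subseteq> J" by (auto simp: K_def)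
      then show ?thesis using J by (meson finite_imageD finite_subset inj_on_Cons1)
    qed
    let ?emb = "prod_emb UNIV (\<lambda>_. exp_clock) J (Pi\<^sub>E J F)"
    let ?A = "\<lambda>c. {X \<in> space clocks. \<forall>w\<in>K c. X w \<in> F' (c # w)}"
    have A [measurable]: "?A c \<in> sets clocks" for c
      unfolding clocks_def by (intro cylinder_sets K F')
    have mA: "emeasure clocks (?A c) = (\<Prod>w\<in>K c. emeasure exp_clock (F' (c # w)))" for c
      unfolding clocks_def using K[of c] by (intro P.emeasure_PiM_Collect) auto
    have "emeasure (distr (exp_clock \<Otimes>\<^sub>M clocks \<Otimes>\<^sub>M clocks) clocks (\<lambda>(x, XL, XR). join_clocks x XL XR)) ?emb =
        emeasure (exp_clock \<Otimes>\<^sub>M clocks \<Otimes>\<^sub>M clocks) ((\<lambda>(x, XL, XR). join_clocks x XL XR) -` ?emb \<inter> space (exp_clock \<Otimes>\<^sub>M clocks \<Otimes>\<^sub>M clocks))"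
      using J F by (intro emeasure_distr join_clocks_measurable) (auto simp: clocks_def intro!: sets_PiM_I)
    also have "(\<lambda>(x, XL, XR). join_clocks x XL XR) -` ?emb \<inter> space (exp_clock \<Otimes>\<^sub>M clocks \<Otimes>\<^sub>M clocks) =
        F' [] \<times> ?A False \<times> ?A True" (is "?l = ?r")
    proof (rule set_eqI)
      fix w :: "real \<times> (vertex \<Rightarrow> real) \<times> (vertex \<Rightarrow> real)"
      obtain x XL XR where w: "w = (x, XL, XR)" by (cases w) auto
      have sub: "F' [] \<subseteq> space exp_clock" using sets.sets_into_space[OF F'] .
      have "w \<in> ?l \<longleftrightarrow> (\<forall>j\<in>J. join_clocks x XL XR j \<in> F j) \<and> x \<in> space exp_clock \<and> XL \<in> space clocks \<and> XR \<in> space clocks"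
        using measurable_space[OF join_clocks_measurable, of w]
        by (auto simp: w prod_emb_iff PiE_iff space_pair_measure clocks_def space_PiM)
      also have "(\<forall>j\<in>J. join_clocks x XL XR j \<in> F j) \<longleftrightarrow> ([] \<in> J \<longrightarrow> x \<in> F []) \<and>
          (\<forall>w\<in>K False. XL w \<in> F (False # w)) \<and> (\<forall>w\<in>K True. XR w \<in> F (True # w))"
      proof
        assume "\<forall>j\<in>J. join_clocks x XL XR j \<in> F j"
        then show "([] \<in> J \<longrightarrow> x \<in> F []) \<and>
          (\<forall>w\<in>K False. XL w \<in> F (False # w)) \<and> (\<forall>w\<in>K True. XR w \<in> F (True # w))"
          by (auto simp: K_def)
      next
        assume r: "([] \<in> J \<longrightarrow> x \<in> F []) \<and>
          (\<forall>w\<in>K False. XL w \<in> F (False # w)) \<and> (\<forall>w\<in>K True. XR w \<in> F (True # w))"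
        show "\<forall>j\<in>J. join_clocks x XL XR j \<in> F j"
        proof
          fix j assume "j \<in> J"
          then show "join_clocks x XL XR j \<in> F j" using r by (cases j) (auto simp: K_def)
        qed
      qed
      also have "(([] \<in> J \<longrightarrow> x \<in> F []) \<and> (\<forall>w\<in>K False. XL w \<in> F (False # w)) \<and> (\<forall>w\<in>K True. XR w \<in> F (True # w))) \<and>
          x \<in> space exp_clock \<and> XL \<in> space clocks \<and> XR \<in> space clocks \<longleftrightarrow> w \<in> ?r"
        using sub by (auto simp: w F'_def K_def split: if_splits)
      finally show "w \<in> ?l \<longleftrightarrow> w \<in> ?r" .
    qed
    also have "emeasure (exp_clock \<Otimes>\<^sub>M clocks \<Otimes>\<^sub>M clocks) (F' [] \<times> ?A False \<times> ?A True) =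
        emeasure exp_clock (F' []) * (emeasure clocks (?A False) * emeasure clocks (?A True))"
      by (simp add: CC.emeasure_pair_measure_Times C.emeasure_pair_measure_Times)
    also have "\<dots> = emeasure exp_clock (F' []) * (\<Prod>c\<in>UNIV. \<Prod>w\<in>K c. emeasure exp_clock (F' (c # w)))"
      by (simp only: mA UNIV_bool) simp
    also have "\<dots> = (\<Prod>j\<in>J. emeasure exp_clock (F j))"
    proof -
      have Jeq: "J = (J \<inter> {[]}) \<union> ((#) False ` K False \<union> (#) True ` K True)"
      proof (rule set_eqI)
        fix v show "v \<in> J \<longleftrightarrow> v \<in> (J \<inter> {[]}) \<union> ((#) False ` K False \<union> (#) True ` K True)"
        proof (cases v)
          case (Cons c w)
          then show ?thesis by (cases c) (auto simp: K_def image_iff)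
        qed (simp add: image_iff)
      qed
      have "(\<Prod>j\<in>J. emeasure exp_clock (F j)) = (\<Prod>j\<in>J. emeasure exp_clock (F' j))"
        by (simp add: F'_def)
      also have "\<dots> = (\<Prod>j\<in>J \<inter> {[]}. emeasure exp_clock (F' j)) *
          ((\<Prod>j\<in>(#) False ` K False. emeasure exp_clock (F' j)) * (\<Prod>j\<in>(#) True ` K True. emeasure exp_clock (F' j)))"
        using J K by (subst Jeq, subst prod.union_disjoint; (subst prod.union_disjoint)?) auto
      also have "(\<Prod>j\<in>J \<inter> {[]}. emeasure exp_clock (F' j)) = emeasure exp_clock (F' [])"
        by (cases "[] \<in> J") (auto simp: F'_def E.emeasure_space_1)
      finally show ?thesis by (simp add: prod.reindex UNIV_bool mult.commute)
    qed
    finally show "emeasure (distr (exp_clock \<Otimes>\<^sub>M clocks \<Otimes>\<^sub>M clocks) clocks (\<lambda>(x, XL, XR). join_clocks x XL XR)) ?emb =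
        (\<Prod>j\<in>J. emeasure exp_clock (F j))" .
  qed (simp add: clocks_def)
  then show ?thesis by (simp add: clocks_def)
qed

lemma clocks_split:
  assumes F: "F \<in> borel_measurable clocks"
  shows "(\<integral>\<^sup>+X. F X \<partial>clocks) = (\<integral>\<^sup>+x. \<integral>\<^sup>+XL. \<integral>\<^sup>+XR. F (join_clocks x XL XR) \<partial>clocks \<partial>clocks \<partial>exp_clock)"
proof -
  interpret C: prob_space clocks by (rule prob_space_clocks)
  interpret CC: pair_prob_space clocks clocks ..
  have m: "(\<lambda>(x, XL, XR). F (join_clocks x XL XR)) \<in> borel_measurable (exp_clock \<Otimes>\<^sub>M clocks \<Otimes>\<^sub>M clocks)"
    using measurable_compose[OF join_clocks_measurable F] by (simp add: split_beta')
  have "(\<integral>\<^sup>+X. F X \<partial>clocks) = (\<integral>\<^sup>+w. F ((\<lambda>(x, XL, XR). join_clocks x XL XR) w) \<partial>(exp_clock \<Otimes>\<^sub>M clocks \<Otimes>\<^sub>M clocks))"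
    by (subst (1) join_clocks_distr[symmetric], subst nn_integral_distr[OF join_clocks_measurable])
       (simp_all add: F)
  also have "\<dots> = (\<integral>\<^sup>+x. \<integral>\<^sup>+w. F (join_clocks x (fst w) (snd w)) \<partial>(clocks \<Otimes>\<^sub>M clocks) \<partial>exp_clock)"
    using CC.nn_integral_fst[OF m] by (simp add: split_beta')
  also have "\<dots> = (\<integral>\<^sup>+x. \<integral>\<^sup>+XL. \<integral>\<^sup>+XR. F (join_clocks x XL XR) \<partial>clocks \<partial>clocks \<partial>exp_clock)"
  proof (rule nn_integral_cong)
    fix x assume x: "x \<in> space exp_clock"
    have "(\<lambda>w. F (join_clocks x (fst w) (snd w))) \<in> borel_measurable (clocks \<Otimes>\<^sub>M clocks)"
      using measurable_compose[OF measurable_Pair1'[OF x] m] by (simp add: split_beta')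
    from C.nn_integral_fst[OF this]
    show "(\<integral>\<^sup>+w. F (join_clocks x (fst w) (snd w)) \<partial>(clocks \<Otimes>\<^sub>M clocks)) = (\<integral>\<^sup>+XL. \<integral>\<^sup>+XR. F (join_clocks x XL XR) \<partial>clocks \<partial>clocks)"
      by simp
  qed
  finally show ?thesis .
qed

definition spent_times :: "vertex set \<Rightarrow> (vertex \<Rightarrow> real) \<Rightarrow> vertex \<Rightarrow> real" where
  "spent_times T X v = (if v \<in> T then X v / real (card (leaves_above T v)) else 0)"

lemma spent_times_measurable [measurable]: "spent_times T \<in> clocks \<rightarrow>\<^sub>M PiM UNIV (\<lambda>_. borel)"
proof -
  have "(\<lambda>X v. spent_times T X v) \<in> clocks \<rightarrow>\<^sub>M PiM UNIV (\<lambda>_. borel)"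
    unfolding spent_times_def using clock_component_borel by (intro measurable_PiM_single') auto
  then show ?thesis by simp
qed

lemma exp_clock_scale:
  assumes k: "0 < (k::nat)"
  shows "distr exp_clock borel (\<lambda>x. x / real k) = density lborel (exponential_density (real k))"
proof (rule measure_eqI)
  fix A assume "A \<in> sets (distr exp_clock borel (\<lambda>x. x / real k))"
  then have [measurable]: "A \<in> sets borel" by simp
  have m: "(\<lambda>x. x / real k) \<in> exp_clock \<rightarrow>\<^sub>M borel"
    using measurable_compose[OF measurable_exp_clock_id, of "\<lambda>x. x / real k" borel] by simp
  have "emeasure (distr exp_clock borel (\<lambda>x. x / real k)) A = (\<integral>\<^sup>+x. indicator A x \<partial>distr exp_clock borel (\<lambda>x. x / real k))"
    by simp
  also have "\<dots> = (\<integral>\<^sup>+x. indicator A (x / real k) \<partial>exp_clock)"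
    by (rule nn_integral_distr[OF m]) simp
  also have "\<dots> = (\<integral>\<^sup>+x. indicator {0<..} x * ennreal (exp (- x)) * indicator A (x / real k) \<partial>lborel)"
    by (rule exp_clock_integral) measurable
  also have "\<dots> = ennreal (real k) * (\<integral>\<^sup>+a. indicator {0<..} a * ennreal (exp (- (real k * a))) * indicator A a \<partial>lborel)"
    using k by (subst nn_integral_real_affine[where c = "real k" and t = 0])
      (auto simp: indicator_def zero_less_mult_iff intro!: arg_cong2[where f = "(*)"] nn_integral_cong)
  also have "\<dots> = (\<integral>\<^sup>+a. ennreal (real k) * (indicator {0<..} a * ennreal (exp (- (real k * a))) * indicator A a) \<partial>lborel)"
    by (rule nn_integral_cmult[symmetric]) measurable
  also have "\<dots> = (\<integral>\<^sup>+a. ennreal (exponential_density (real k) a) * indicator A a \<partial>lborel)"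
    by (rule nn_integral_cong_AE, rule AE_mp[OF AE_lborel_singleton[of 0]])
       (auto simp: exponential_density_def indicator_def ennreal_mult' mult.commute)
  also have "\<dots> = emeasure (density lborel (exponential_density (real k))) A"
    by (simp add: emeasure_density)
  finally show "emeasure (distr exp_clock borel (\<lambda>x. x / real k)) A = \<dots>" .
qed simp

abbreviation spent_marginal :: "vertex set \<Rightarrow> vertex \<Rightarrow> real measure" where
  "spent_marginal T v \<equiv> (if v \<in> T then density lborel (exponential_density (real (card (leaves_above T v)))) else return borel 0)"

lemma spent_marginal_distr:
  assumes T: "plane_tree T"
  shows "distr exp_clock borel (\<lambda>x. if v \<in> T then x / real (card (leaves_above T v)) else 0) = spent_marginal T v"
proof (cases "v \<in> T")
  case True
  then show ?thesis by (simp add: exp_clock_scale card_leaves_above_pos T)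
next
  case False
  interpret E: prob_space exp_clock by (rule prob_space_exp_clock)
  show ?thesis
  proof (rule measure_eqI)
    fix A assume "A \<in> sets (distr exp_clock borel (\<lambda>x. if v \<in> T then x / real (card (leaves_above T v)) else 0))"
    then show "emeasure (distr exp_clock borel (\<lambda>x. if v \<in> T then x / real (card (leaves_above T v)) else 0)) A =
        emeasure (spent_marginal T v) A"
      using False by (simp add: emeasure_distr E.emeasure_space_1 split: split_indicator)
  qed (use False in simp)
qed

lemma prob_space_spent_marginal:
  assumes "plane_tree T" shows "prob_space (spent_marginal T v)"
  unfolding spent_marginal_distr[OF assms, symmetric]
  by (intro prob_space.prob_space_distr prob_space_exp_clock)
     (use measurable_compose[OF measurable_exp_clock_id, of "\<lambda>x. x / real k" borel for k] in auto)

text \<open>The coordinates of the image are functions of independent clocks, with the required marginals.\<close>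

lemma spent_times_distr:
  assumes T: "plane_tree T"
  shows "distr clocks (PiM UNIV (\<lambda>_. borel)) (spent_times T) = spent_time_law T"
proof -
  interpret E: prob_space exp_clock by (rule prob_space_exp_clock)
  interpret P: product_prob_space "\<lambda>_::vertex. exp_clock" UNIV ..
  interpret Q: product_prob_space "spent_marginal T" UNIV
    by (intro product_prob_spaceI prob_space_spent_marginal T)
  let ?f = "\<lambda>v x. if v \<in> T then x / real (card (leaves_above T v)) else 0"
  have fm: "?f v \<in> exp_clock \<rightarrow>\<^sub>M borel" for v
    using measurable_compose[OF measurable_exp_clock_id, of "\<lambda>x. x / real k" borel for k] by auto
  have ss: "sets (PiM UNIV (\<lambda>_::vertex. borel :: real measure)) = sets (PiM UNIV (spent_marginal T))"
    by (intro sets_PiM_cong) auto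
  have "distr clocks (PiM UNIV (\<lambda>_. borel)) (spent_times T) = PiM UNIV (spent_marginal T)"
  proof (rule Q.PiM_eq)
    fix J :: "vertex set" and F :: "vertex \<Rightarrow> real set"
    assume J: "finite J" "J \<subseteq> UNIV" and F: "\<And>j. j \<in> J \<Longrightarrow> F j \<in> sets (spent_marginal T j)"
    then have Fb: "F j \<in> sets borel" if "j \<in> J" for j using F[OF that] by (cases "j \<in> T") simp_all
    let ?emb = "prod_emb UNIV (spent_marginal T) J (Pi\<^sub>E J F)"
    have emb: "?emb \<in> sets (PiM UNIV (\<lambda>_. borel))"
      unfolding ss using J F by (intro sets_PiM_I) auto
    have sp: "space (spent_marginal T v) = UNIV" for v by simp
    have "emeasure (distr clocks (PiM UNIV (\<lambda>_. borel)) (spent_times T)) ?emb = emeasure clocks (spent_times T -` ?emb \<inter> space clocks)"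
      using emb by (intro emeasure_distr) measurable
    also have "spent_times T -` ?emb \<inter> space clocks = {X \<in> space (PiM UNIV (\<lambda>_::vertex. exp_clock)). \<forall>j\<in>J. X j \<in> ?f j -` F j \<inter> space exp_clock}"
      by (auto simp: prod_emb_iff PiE_iff sp clocks_def spent_times_def space_PiM) fastforce+
    also have "emeasure clocks \<dots> = (\<Prod>j\<in>J. emeasure exp_clock (?f j -` F j \<inter> space exp_clock))"
      unfolding clocks_def using J measurable_sets[OF fm Fb] by (intro P.emeasure_PiM_Collect) auto
    also have "\<dots> = (\<Prod>j\<in>J. emeasure (spent_marginal T j) (F j))"
      by (intro prod.cong refl) (simp only: spent_marginal_distr[OF T, symmetric] emeasure_distr[OF fm Fb])
    finally show "emeasure (distr clocks (PiM UNIV (\<lambda>_. borel)) (spent_times T)) ?emb = (\<Prod>j\<in>J. emeasure (spent_marginal T j) (F j))" .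
  qed (simp add: ss)
  then show ?thesis by (simp add: spent_time_law_def)
qed

section \<open>Discrete measurability\<close>

lemma discrete_compose:
  assumes "f \<in> N \<rightarrow>\<^sub>M count_space A" "\<And>a. a \<in> A \<Longrightarrow> g a \<in> B"
  shows "(\<lambda>x. g (f x)) \<in> N \<rightarrow>\<^sub>M count_space B"
  by (rule measurable_compose[OF assms(1)]) (use assms(2) in \<open>simp add: Pi_iff\<close>)

lemma discrete_pair:
  assumes "f \<in> N \<rightarrow>\<^sub>M count_space A" "h \<in> N \<rightarrow>\<^sub>M count_space B" "countable A" "countable B"
  shows "(\<lambda>x. (f x, h x)) \<in> N \<rightarrow>\<^sub>M count_space (A \<times> B)"
  using measurable_Pair[OF assms(1,2)] by (simp add: pair_measure_countable assms)

lemma countable_rooted_graphs: "countable {g. rooted_graph g}"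
proof -
  let ?F = "{A::vertex set. finite A}"
  have F: "countable ?F" by (rule countable_Collect_finite)
  have "{g. rooted_graph g} \<subseteq> ?F \<times> {E. finite E \<and> E \<subseteq> ?F} \<times> UNIV"
  proof safe
    fix V E r assume g: "rooted_graph (V, E, r)"
    then show V: "finite V" by (simp add: rooted_graph_def)
    have "E \<subseteq> Pow V" using g by (auto simp: rooted_graph_def)
    then show "finite E" using V finite_subset by blast
    show "finite e" if "e \<in> E" for e
      using that g V by (auto simp: rooted_graph_def intro: finite_subset)
  qed simp
  then show ?thesis
    by (rule countable_subset) (intro countable_SIGMA F countable_Collect_finite_subset, auto)
qed

lemma countable_rooted_trees: "countable {g. rooted_tree g}"
  by (rule countable_subset[OF _ countable_rooted_graphs]) (auto simp: rooted_tree_def)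

text \<open>A probability mass function has countable support, so the exchange needs measurability only
  for each point of the support separately. The types of the discrete data are uncountable, which
  rules out the product measure version.\<close>

lemma pmf_integral_swap:
  fixes p :: "'i pmf"
  assumes "\<And>i. i \<in> set_pmf p \<Longrightarrow> f i \<in> borel_measurable M"
  shows "(\<integral>\<^sup>+x. \<integral>\<^sup>+i. f i x \<partial>p \<partial>M) = (\<integral>\<^sup>+i. \<integral>\<^sup>+x. f i x \<partial>M \<partial>p)"
proof -
  have p: "(\<integral>\<^sup>+i. h i \<partial>p) = (\<integral>\<^sup>+i. ennreal (pmf p i) * h i \<partial>count_space (set_pmf p))" for h :: "'i \<Rightarrow> ennreal"
    by (auto simp: nn_integral_measure_pmf nn_integral_count_space_indicator indicator_def set_pmf_iff intro!: nn_integral_cong)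
  have "(\<integral>\<^sup>+x. \<integral>\<^sup>+i. f i x \<partial>p \<partial>M) = (\<integral>\<^sup>+i. \<integral>\<^sup>+x. ennreal (pmf p i) * f i x \<partial>M \<partial>count_space (set_pmf p))"
    unfolding p by (rule nn_integral_count_space_nn_integral) (use assms in auto)
  also have "\<dots> = (\<integral>\<^sup>+i. ennreal (pmf p i) * (\<integral>\<^sup>+x. f i x \<partial>M) \<partial>count_space (set_pmf p))"
    by (intro nn_integral_cong nn_integral_cmult) (use assms in auto)
  finally show ?thesis by (simp only: p)
qed

lemma pmf_pmf_swap:
  fixes p :: "'i pmf" and q :: "'j pmf"
  shows "(\<integral>\<^sup>+x. \<integral>\<^sup>+y. f x y \<partial>q \<partial>p) = (\<integral>\<^sup>+y. \<integral>\<^sup>+x. f x y \<partial>p \<partial>q)"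
  by (rule pmf_integral_swap) simp

section \<open>Uniform choices\<close>

lemma prob_space_uniform_choices: "prob_space uniform_choices"
  unfolding uniform_choices_def by (intro prob_space_PiM prob_space_uniform_count_measure) auto

lemma chosen_in:
  assumes "p \<in> space uniform_choices" "finite A" "A \<noteq> {}" shows "p A \<in> A"
  using assms by (auto simp: uniform_choices_def space_PiM PiE_iff space_uniform_count_measure)

lemma choice_measurable:
  assumes p: "p \<in> N \<rightarrow>\<^sub>M uniform_choices" and A: "A \<in> N \<rightarrow>\<^sub>M count_space {A. finite A \<and> A \<noteq> {}}"
  shows "(\<lambda>x. p x (A x)) \<in> N \<rightarrow>\<^sub>M count_space UNIV"
proof (rule measurable_compose_countable'[OF _ A])
  show "countable {A::vertex set. finite A \<and> A \<noteq> {}}"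
    by (rule countable_subset[OF _ countable_Collect_finite]) auto
  fix B :: "vertex set" assume B: "B \<in> {A. finite A \<and> A \<noteq> {}}"
  have "(\<lambda>x. x) \<in> uniform_count_measure B \<rightarrow>\<^sub>M count_space UNIV"
    by (simp add: measurable_cong_sets[OF sets_uniform_count_measure_count_space refl])
  then have "(\<lambda>q. q B) \<in> uniform_choices \<rightarrow>\<^sub>M count_space UNIV"
    unfolding uniform_choices_def by (rule measurable_compose[OF measurable_component_singleton[OF B]])
  from measurable_compose[OF p this] show "(\<lambda>x. p x B) \<in> N \<rightarrow>\<^sub>M count_space UNIV" .
qed

lemma uniform_choice_integral:
  fixes f :: "vertex \<Rightarrow> ennreal"
  assumes A: "finite A" "A \<noteq> {}"
  shows "(\<integral>\<^sup>+p. f (p A) \<partial>uniform_choices) = (\<integral>\<^sup>+v. f v \<partial>pmf_of_set A)"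
proof -
  let ?I = "{A::vertex set. finite A \<and> A \<noteq> {}}"
  have AI: "A \<in> ?I" using A by simp
  have m: "(\<lambda>p. p A) \<in> uniform_choices \<rightarrow>\<^sub>M uniform_count_measure A"
    unfolding uniform_choices_def by (rule measurable_component_singleton[OF AI])
  have d: "distr uniform_choices (uniform_count_measure A) (\<lambda>p. p A) = uniform_count_measure A"
    unfolding uniform_choices_def
    by (intro distr_PiM_component[OF _ AI] prob_space_uniform_count_measure) auto
  have fm: "f \<in> borel_measurable (uniform_count_measure A)"
    by (simp add: measurable_cong_sets[OF sets_uniform_count_measure_count_space refl])
  have "(\<integral>\<^sup>+p. f (p A) \<partial>uniform_choices) = (\<integral>\<^sup>+v. f v \<partial>uniform_count_measure A)"
    by (subst d[symmetric], subst nn_integral_distr[OF m]) (simp_all add: fm)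
  also have "\<dots> = (\<Sum>v\<in>A. ennreal (1 / real (card A)) * f v)"
    unfolding uniform_count_measure_def using A by (subst nn_integral_point_measure_finite) auto
  also have "\<dots> = sum f A / of_nat (card A)"
  proof -
    have "0 < card A" using A by (simp add: card_gt_0_iff)
    then have "ennreal (1 / real (card A)) = inverse (of_nat (card A))"
      by (simp add: ennreal_of_nat_eq_real_of_nat inverse_ennreal inverse_eq_divide)
    then show ?thesis by (simp only: divide_ennreal_def mult.commute[of "inverse (of_nat (card A))"] sum_distrib_right[symmetric])
  qed
  also have "\<dots> = (\<integral>\<^sup>+v. f v \<partial>pmf_of_set A)"
    using A by (simp add: nn_integral_pmf_of_set)
  finally show ?thesis .
qed

section \<open>The space of genealogies with clusters\<close>

lemma space_gen: "space gen_space = T_gen"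
  by (auto simp: gen_space_def space_restrict_space gtree_space_def space_pair_measure space_PiM PiE_iff T_gen_def)

lemma T_genD:
  assumes "z \<in> T_gen"
  shows "plane_tree (shape z)" "0 \<le> spent z v" "v \<notin> shape z \<Longrightarrow> spent z v = 0"
    "rooted_tree (cluster z)" "verts (cluster z) = leaves (shape z)"
  using assms by (auto simp: T_gen_def)

lemma T_genI:
  assumes "plane_tree (shape z)" "\<And>v. 0 \<le> spent z v" "\<And>v. v \<notin> shape z \<Longrightarrow> spent z v = 0"
    "rooted_tree (cluster z)" "verts (cluster z) = leaves (shape z)"
  shows "z \<in> T_gen"
  using assms by (cases z) (auto simp: T_gen_def split_beta)

lemma measurable_genI:
  assumes "\<And>x. x \<in> space N \<Longrightarrow> f x \<in> T_gen"
    and shape: "(\<lambda>x. shape (f x)) \<in> N \<rightarrow>\<^sub>M count_space plane_trees"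
    and spent: "\<And>v. (\<lambda>x. spent (f x) v) \<in> borel_measurable N"
    and cluster: "(\<lambda>x. cluster (f x)) \<in> N \<rightarrow>\<^sub>M count_space {C. rooted_tree C}"
  shows "f \<in> N \<rightarrow>\<^sub>M gen_space"
proof -
  have "(\<lambda>x v. spent (f x) v) \<in> N \<rightarrow>\<^sub>M PiM UNIV (\<lambda>_. borel)"
    using spent by (intro measurable_PiM_single') auto
  then have "(\<lambda>x. ((shape (f x), spent (f x)), cluster (f x))) \<in> N \<rightarrow>\<^sub>M gtree_space \<Otimes>\<^sub>M count_space {C. rooted_tree C}"
    unfolding gtree_space_def using shape cluster by (intro measurable_Pair) auto
  then show ?thesis
    unfolding gen_space_def using assms(1) by (intro measurable_restrict_space2) auto
qed

lemma fst_gen_measurable: "fst \<in> gen_space \<rightarrow>\<^sub>M gtree_space"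
  and cluster_measurable: "cluster \<in> gen_space \<rightarrow>\<^sub>M count_space {C. rooted_tree C}"
  unfolding gen_space_def by (intro measurable_restrict_space1 measurable_fst measurable_snd)+

lemma shape_measurable: "shape \<in> gen_space \<rightarrow>\<^sub>M count_space plane_trees"
  by (rule measurable_compose[OF fst_gen_measurable]) (simp add: gtree_space_def)

lemma spents_measurable: "spent \<in> gen_space \<rightarrow>\<^sub>M PiM UNIV (\<lambda>_. borel)"
  by (rule measurable_compose[OF fst_gen_measurable]) (simp add: gtree_space_def)

lemma spent_measurable: "(\<lambda>z. spent z v) \<in> borel_measurable gen_space"
  using measurable_compose[OF spents_measurable measurable_component_singleton[of v UNIV]] by simp

text \<open>There are only countably many pairs of a plane tree and a cluster.\<close>

lemma discrete_part_measurable: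
  assumes "\<And>z. z \<in> T_gen \<Longrightarrow> F (shape z) (cluster z) \<in> B"
  shows "(\<lambda>z. F (shape z) (cluster z)) \<in> gen_space \<rightarrow>\<^sub>M count_space B"
proof -
  \<comment> \<open>a value for the pairs that no state realises\<close>
  define o0 where "o0 = (SOME b. b \<in> B)"
  show ?thesis
  proof (cases "B = {}")
    case True
    then have "space gen_space = {}" using assms by (auto simp: space_gen)
    then show ?thesis by (simp add: measurable_def True)
  next
    case False
    then have o0: "o0 \<in> B" unfolding o0_def by (rule some_in_eq[THEN iffD2])
    have "(\<lambda>z. (\<lambda>(T, C). if F T C \<in> B then F T C else o0) (shape z, cluster z)) \<in> gen_space \<rightarrow>\<^sub>M count_space B"
      using o0 by (intro discrete_compose[OF discrete_pair[OF shape_measurable cluster_measurable countable_plane_trees countable_rooted_trees]]) auto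
    also have "?this \<longleftrightarrow> ?thesis"
      using assms by (intro measurable_cong) (simp add: space_gen)
    finally show ?thesis .
  qed
qed

definition leaf_count :: "gstate \<Rightarrow> nat" where
  "leaf_count z = card (leaves (shape z))"

lemma leaf_count_measurable: "leaf_count \<in> gen_space \<rightarrow>\<^sub>M count_space UNIV"
  unfolding leaf_count_def[abs_def] by (rule discrete_part_measurable) simp

lemma leaf_count_pos: "z \<in> T_gen \<Longrightarrow> 0 < leaf_count z"
  by (simp add: leaf_count_def card_leaves_pos T_genD)

lemma singleton_state_T_gen: "singleton_state \<in> T_gen"
  by (rule T_genI) (simp_all add: singleton_state_def rooted_tree_singleton, simp add: singleton_graph_def)

lemma age_simps [simp]: "shape (age a z) = shape z" "cluster (age a z) = cluster z"
  "spent (age a z) = (spent z)([] := spent z [] + a)"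
  by (simp_all add: age_def)

lemma leaf_count_age [simp]: "leaf_count (age a z) = leaf_count z"
  by (simp add: leaf_count_def)

lemma age_T_gen:
  assumes z: "z \<in> T_gen" and a: "0 \<le> a" shows "age a z \<in> T_gen"
  by (rule T_genI) (use T_genD[OF z] a plane_tree_root in \<open>auto\<close>)

lemma age_measurable_gen: "(\<lambda>(a, z). age a z) \<in> restrict_space borel {0..} \<Otimes>\<^sub>M gen_space \<rightarrow>\<^sub>M gen_space"
proof (rule measurable_genI)
  let ?N = "restrict_space borel {0..} \<Otimes>\<^sub>M gen_space :: (real \<times> gstate) measure"
  have a: "fst \<in> borel_measurable ?N"
    by (rule measurable_compose[OF measurable_fst]) (simp add: measurable_restrict_space1)
  have s: "(\<lambda>w. spent (snd w) v) \<in> borel_measurable ?N" for v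
    by (rule measurable_compose[OF measurable_snd spent_measurable])
  show "(case w of (a, z) \<Rightarrow> age a z) \<in> T_gen" if "w \<in> space ?N" for w
    using that by (auto simp: space_pair_measure space_restrict_space space_gen age_T_gen)
  show "(\<lambda>w. shape (case w of (a, z) \<Rightarrow> age a z)) \<in> ?N \<rightarrow>\<^sub>M count_space plane_trees"
    using measurable_compose[OF measurable_snd shape_measurable] by (simp add: split_beta')
  show "(\<lambda>w. cluster (case w of (a, z) \<Rightarrow> age a z)) \<in> ?N \<rightarrow>\<^sub>M count_space {C. rooted_tree C}"
    using measurable_compose[OF measurable_snd cluster_measurable] by (simp add: split_beta')
  show "(\<lambda>w. spent (case w of (a, z) \<Rightarrow> age a z) v) \<in> borel_measurable ?N" for v
    using a s[of v] s[of "[]"] by (cases "v = []") (simp_all add: split_beta')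
qed

lemma merge_simps [simp]:
  "shape (merge b v z z') = (if b then node (shape z') (shape z) else node (shape z) (shape z'))"
  "cluster (merge b v z z') = graft b v (cluster z) (cluster z')"
  "spent (merge b v z z') [] = 0"
  "spent (merge b v z z') (d # w) = (if d = b then spent z w else spent z' w)"
  by (auto simp: merge_def node_def)

lemma leaf_count_merge:
  assumes "z \<in> T_gen" "z' \<in> T_gen"
  shows "leaf_count (merge b v z z') = leaf_count z + leaf_count z'"
  using assms by (simp add: leaf_count_def card_leaves_node T_genD)

lemma merge_T_gen:
  assumes z: "z \<in> T_gen" and z': "z' \<in> T_gen" and v: "v \<in> verts (cluster z)"
  shows "merge b v z z' \<in> T_gen"
proof (rule T_genI)
  note zs = T_genD[OF z] T_genD[OF z']
  show "plane_tree (shape (merge b v z z'))" using zs by simp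
  show "rooted_tree (cluster (merge b v z z'))" using zs v by (simp add: rooted_tree_graft)
  show "verts (cluster (merge b v z z')) = leaves (shape (merge b v z z'))"
    using zs by (cases b) (simp_all add: leaves_node Un_commute)
  show "0 \<le> spent (merge b v z z') w" for w
    using zs by (cases w) simp_all
  show "spent (merge b v z z') w = 0" if "w \<notin> shape (merge b v z z')" for w
    using zs that by (cases w; cases b) (auto split: if_splits)
qed

lemma merge_measurable:
  assumes b: "b \<in> N \<rightarrow>\<^sub>M count_space UNIV" and v: "v \<in> N \<rightarrow>\<^sub>M count_space UNIV"
    and z: "z \<in> N \<rightarrow>\<^sub>M gen_space" and z': "z' \<in> N \<rightarrow>\<^sub>M gen_space"
    and vz: "\<And>x. x \<in> space N \<Longrightarrow> v x \<in> verts (cluster (z x))"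
  shows "(\<lambda>x. merge (b x) (v x) (z x) (z' x)) \<in> N \<rightarrow>\<^sub>M gen_space"
proof (rule measurable_genI)
  have zT: "z x \<in> T_gen" "z' x \<in> T_gen" if "x \<in> space N" for x
    using measurable_space[OF z that] measurable_space[OF z' that] by (simp_all add: space_gen)
  show T: "merge (b x) (v x) (z x) (z' x) \<in> T_gen" if "x \<in> space N" for x
    by (intro merge_T_gen zT vz that)
  note sh = measurable_compose[OF z shape_measurable] measurable_compose[OF z' shape_measurable]
  note cl = measurable_compose[OF z cluster_measurable] measurable_compose[OF z' cluster_measurable]
  have "(\<lambda>x. (\<lambda>(c, L, R). if c then node R L else node L R) (b x, shape (z x), shape (z' x))) \<in> N \<rightarrow>\<^sub>M count_space plane_trees"
    by (rule discrete_compose[OF discrete_pair[OF b discrete_pair[OF sh]]])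
       (auto simp: countable_plane_trees countable_SIGMA split: if_splits)
  then show "(\<lambda>x. shape (merge (b x) (v x) (z x) (z' x))) \<in> N \<rightarrow>\<^sub>M count_space plane_trees" by simp
  let ?R = "{C. rooted_tree C}"
  \<comment> \<open>a discrete map must be defined for every vertex, hence the default value outside \<open>C\<close>\<close>
  have "(\<lambda>x. (\<lambda>((c, u), C, C'). if u \<in> verts C then graft c u C C' else C) ((b x, v x), cluster (z x), cluster (z' x))) \<in> N \<rightarrow>\<^sub>M count_space ?R"
    by (rule discrete_compose[OF discrete_pair[OF discrete_pair[OF b v] discrete_pair[OF cl]]])
       (auto simp: countable_rooted_trees countable_SIGMA rooted_tree_graft split: if_splits)
  also have "?this \<longleftrightarrow> (\<lambda>x. cluster (merge (b x) (v x) (z x) (z' x))) \<in> N \<rightarrow>\<^sub>M count_space ?R"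
    by (intro measurable_cong) (simp add: vz)
  finally show "(\<lambda>x. cluster (merge (b x) (v x) (z x) (z' x))) \<in> N \<rightarrow>\<^sub>M count_space ?R" .
  show "(\<lambda>x. spent (merge (b x) (v x) (z x) (z' x)) w) \<in> borel_measurable N" for w
  proof (cases w)
    case (Cons d u)
    note b[measurable] measurable_compose[OF z spent_measurable[of u], measurable]
      measurable_compose[OF z' spent_measurable[of u], measurable]
    have "(\<lambda>x. if d = b x then spent (z x) u else spent (z' x) u) \<in> borel_measurable N" by measurable
    then show ?thesis by (simp add: Cons)
  qed simp
qed

section \<open>The candidate environment\<close>

type_synonym decoration = "vertex set \<times> vertex \<times> (vertex \<Rightarrow> vertex \<times> vertex)"

definition valid :: "decoration \<Rightarrow> bool" where
  "valid = (\<lambda>(T, \<rho>, e). plane_tree T \<and> \<rho> \<in> leaves T \<and> e \<in> choices T)"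

definition decoration_pmf :: "decoration pmf" where
  "decoration_pmf = bind_pmf gw_pmf (\<lambda>T. map_pmf (Pair T)
     (pair_pmf (pmf_of_set (leaves T)) (pmf_of_set (choices T))))"

definition sample :: "decoration \<Rightarrow> (vertex \<Rightarrow> real) \<Rightarrow> gstate" where
  "sample = (\<lambda>(T, \<rho>, e) X. ((T, spent_times T X), tree_cluster T \<rho> e))"

lemma sample_simps [simp]: "shape (sample (T, \<rho>, e) X) = T"
  "spent (sample (T, \<rho>, e) X) = spent_times T X" "cluster (sample (T, \<rho>, e) X) = tree_cluster T \<rho> e"
  by (simp_all add: sample_def)

lemma tree_cluster_simps [simp]: "verts (tree_cluster T \<rho> e) = leaves T" "root_of (tree_cluster T \<rho> e) = \<rho>"
  by (simp_all add: tree_cluster_def)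

lemma decoration_integral:
  "(\<integral>\<^sup>+d. f d \<partial>decoration_pmf) =
    (\<integral>\<^sup>+T. \<integral>\<^sup>+\<rho>. \<integral>\<^sup>+e. f (T, \<rho>, e) \<partial>pmf_of_set (choices T) \<partial>pmf_of_set (leaves T) \<partial>gw_pmf)"
  by (simp add: decoration_pmf_def nn_integral_pair_pmf')

lemma set_decoration: "d \<in> set_pmf decoration_pmf \<longleftrightarrow> valid d"
  by (cases d) (auto simp: decoration_pmf_def valid_def set_gw_pmf finite_leaves leaves_nonempty
      finite_choices choices_nonempty image_iff)

lemma sample_T_gen:
  assumes "valid d" "X \<in> space clocks" shows "sample d X \<in> T_gen"
  using assms
  by (cases d) (auto simp: valid_def spent_times_def space_clocks less_imp_le rooted_tree_tree_cluster intro!: T_genI)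

lemma sample_measurable:
  assumes "valid d" shows "sample d \<in> clocks \<rightarrow>\<^sub>M gen_space"
proof (rule measurable_genI)
  obtain T \<rho> e where d: "d = (T, \<rho>, e)" by (cases d) auto
  show "sample d X \<in> T_gen" if "X \<in> space clocks" for X by (rule sample_T_gen[OF assms that])
  show "(\<lambda>X. shape (sample d X)) \<in> clocks \<rightarrow>\<^sub>M count_space plane_trees"
    "(\<lambda>X. cluster (sample d X)) \<in> clocks \<rightarrow>\<^sub>M count_space {C. rooted_tree C}"
    using assms by (auto simp: d valid_def rooted_tree_tree_cluster)
  show "(\<lambda>X. spent (sample d X) v) \<in> borel_measurable clocks" for v
    using clock_component_borel[of v] by (simp add: d spent_times_def)
qed

text \<open>The default value on decorations of probability zero makes this a kernel on the whole type.\<close>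

definition sample_law :: "decoration \<Rightarrow> gstate measure" where
  "sample_law d = (if valid d then distr clocks gen_space (sample d) else return gen_space singleton_state)"

text \<open>The explicit law: a Galton--Watson tree with scaled clocks, a uniform root and independent uniform crossing
  edges. It turns out to be the unique steady environment.\<close>

definition gw_environment :: "gstate measure" where
  "gw_environment = measure_pmf decoration_pmf \<bind> sample_law"

lemma prob_space_sample_law: "prob_space (sample_law d)"
  unfolding sample_law_def
  by (auto intro!: prob_space.prob_space_distr prob_space_clocks sample_measurable prob_space_return simp: space_gen singleton_state_T_gen)

lemma sets_sample_law: "sets (sample_law d) = sets gen_space"
  by (simp add: sample_law_def)

lemma sample_law_measurable: "sample_law \<in> measure_pmf decoration_pmf \<rightarrow>\<^sub>M subprob_algebra gen_space"
  using prob_space_sample_law sets_sample_law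
  by (auto simp: space_subprob_algebra prob_space_imp_subprob_space)

lemma gw_environment_law: "law_on gen_space gw_environment"
  unfolding law_on_def
proof
  show "sets gw_environment = sets gen_space"
    unfolding gw_environment_def by (rule sets_bind) (simp_all add: sets_sample_law)
  show "prob_space gw_environment"
    unfolding gw_environment_def
    by (rule prob_space.prob_space_bind[OF prob_space_measure_pmf _ sample_law_measurable])
       (simp add: prob_space_sample_law)
qed

lemma gw_environment_integral:
  assumes g: "g \<in> borel_measurable gen_space"
  shows "(\<integral>\<^sup>+z. g z \<partial>gw_environment) = (\<integral>\<^sup>+d. \<integral>\<^sup>+X. g (sample d X) \<partial>clocks \<partial>decoration_pmf)"
proof -
  have "(\<integral>\<^sup>+z. g z \<partial>gw_environment) = (\<integral>\<^sup>+d. \<integral>\<^sup>+z. g z \<partial>sample_law d \<partial>decoration_pmf)"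
    unfolding gw_environment_def by (rule nn_integral_bind[OF g sample_law_measurable])
  also have "\<dots> = (\<integral>\<^sup>+d. \<integral>\<^sup>+X. g (sample d X) \<partial>clocks \<partial>decoration_pmf)"
  proof (rule nn_integral_cong_AE, rule AE_pmfI)
    fix d assume "d \<in> set_pmf decoration_pmf"
    then have v: "valid d" by (simp add: set_decoration)
    show "(\<integral>\<^sup>+z. g z \<partial>sample_law d) = (\<integral>\<^sup>+X. g (sample d X) \<partial>clocks)"
      using nn_integral_distr[OF sample_measurable[OF v], of g] g v by (simp add: sample_law_def)
  qed
  finally show ?thesis .
qed

section \<open>The candidate environment is balanced\<close>

abbreviation coin :: "bool measure" where "coin \<equiv> measure_pmf (bernoulli_pmf (1/2))"

definition merge_noise :: "(real \<times> bool \<times> (vertex set \<Rightarrow> vertex)) measure" where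
  "merge_noise = exp_clock \<Otimes>\<^sub>M coin \<Otimes>\<^sub>M uniform_choices"

definition aged_merge :: "real \<times> bool \<times> (vertex set \<Rightarrow> vertex) \<Rightarrow> gstate \<Rightarrow> gstate \<Rightarrow> gstate" where
  "aged_merge = (\<lambda>(x, b, p) y z. let m = merge b (p (verts (cluster y))) y z in age (x / real (leaf_count m)) m)"

definition aged_singleton :: "gstate measure" where
  "aged_singleton = distr exp_clock gen_space (\<lambda>x. age (x / real (leaf_count singleton_state)) singleton_state)"

lemma verts_cluster_measurable:
  "(\<lambda>z. verts (cluster z)) \<in> gen_space \<rightarrow>\<^sub>M count_space {A. finite A \<and> A \<noteq> {}}"
  by (rule discrete_part_measurable) (simp add: T_genD finite_leaves leaves_nonempty)

lemma choose_vertex: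
  assumes "p \<in> space uniform_choices" "z \<in> T_gen" shows "p (verts (cluster z)) \<in> verts (cluster z)"
  using chosen_in[OF assms(1)] T_genD[OF assms(2)] finite_leaves leaves_nonempty by simp

lemma choice_merge_measurable:
  assumes b: "b \<in> N \<rightarrow>\<^sub>M coin" and p: "p \<in> N \<rightarrow>\<^sub>M uniform_choices"
    and y: "y \<in> N \<rightarrow>\<^sub>M gen_space" and z: "z \<in> N \<rightarrow>\<^sub>M gen_space"
  shows "(\<lambda>w. merge (b w) (p w (verts (cluster (y w)))) (y w) (z w)) \<in> N \<rightarrow>\<^sub>M gen_space"
proof (rule merge_measurable[OF _ _ y z])
  show "b \<in> N \<rightarrow>\<^sub>M count_space UNIV" using b by (simp add: measurable_cong_sets[OF refl sets_measure_pmf_count_space])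
  show "(\<lambda>w. p w (verts (cluster (y w)))) \<in> N \<rightarrow>\<^sub>M count_space UNIV"
    by (rule choice_measurable[OF p measurable_compose[OF y verts_cluster_measurable]])
  show "p w (verts (cluster (y w))) \<in> verts (cluster (y w))" if "w \<in> space N" for w
    using choose_vertex measurable_space[OF p that] measurable_space[OF y that] by (simp add: space_gen)
qed

lemma age_by_clock_measurable:
  assumes x: "x \<in> N \<rightarrow>\<^sub>M exp_clock" and m: "m \<in> N \<rightarrow>\<^sub>M gen_space"
  shows "(\<lambda>w. age (x w / real (leaf_count (m w))) (m w)) \<in> N \<rightarrow>\<^sub>M gen_space"
proof -
  note measurable_compose[OF x measurable_exp_clock_id, measurable] measurable_compose[OF m leaf_count_measurable, measurable]
  have "(\<lambda>w. x w / real (leaf_count (m w))) \<in> borel_measurable N" by measurable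
  moreover have "0 \<le> x w / real (leaf_count (m w))" if "w \<in> space N" for w
    using measurable_space[OF x that] by (simp add: space_exp_clock)
  ultimately have "(\<lambda>w. x w / real (leaf_count (m w))) \<in> N \<rightarrow>\<^sub>M restrict_space borel {0..}"
    by (intro measurable_restrict_space2) auto
  from measurable_compose[OF measurable_Pair[OF this m] age_measurable_gen] show ?thesis by simp
qed

lemma aged_merge_measurable:
  "(\<lambda>(\<xi>, y, z). aged_merge \<xi> y z) \<in> merge_noise \<Otimes>\<^sub>M gen_space \<Otimes>\<^sub>M gen_space \<rightarrow>\<^sub>M gen_space"
proof -
  let ?N = "merge_noise \<Otimes>\<^sub>M gen_space \<Otimes>\<^sub>M gen_space"
  have x: "(\<lambda>w. fst (fst w)) \<in> ?N \<rightarrow>\<^sub>M exp_clock"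
    and b: "(\<lambda>w. fst (snd (fst w))) \<in> ?N \<rightarrow>\<^sub>M coin"
    and p: "(\<lambda>w. snd (snd (fst w))) \<in> ?N \<rightarrow>\<^sub>M uniform_choices"
    unfolding merge_noise_def
    by (auto intro!: measurable_compose[OF measurable_fst] measurable_compose[OF measurable_snd] measurable_fst measurable_snd
       measurable_compose[OF measurable_fst measurable_fst] measurable_compose[OF measurable_compose[OF measurable_fst measurable_snd] measurable_fst]
       measurable_compose[OF measurable_compose[OF measurable_fst measurable_snd] measurable_snd] simp del: measurable_pmf_measure2)
  have "(\<lambda>w. merge (fst (snd (fst w))) (snd (snd (fst w)) (verts (cluster (fst (snd w))))) (fst (snd w)) (snd (snd w))) \<in> ?N \<rightarrow>\<^sub>M gen_space"
    by (rule choice_merge_measurable[OF b p]) measurable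
  from age_by_clock_measurable[OF x this] show ?thesis
    by (simp add: aged_merge_def split_beta' Let_def)
qed

lemma singleton_leaf_count [simp]: "leaf_count singleton_state = 1"
  by (simp add: leaf_count_def singleton_state_def)

lemma aged_singleton_measurable:
  "(\<lambda>x. age (x / real (leaf_count singleton_state)) singleton_state) \<in> exp_clock \<rightarrow>\<^sub>M gen_space"
  by (rule age_by_clock_measurable) (simp_all add: space_gen singleton_state_T_gen)

interpretation gen: merging gen_space leaf_count merge_noise aged_merge aged_singleton
proof (rule merging.intro)
  interpret E: prob_space exp_clock by (rule prob_space_exp_clock)
  interpret U: prob_space uniform_choices by (rule prob_space_uniform_choices)
  interpret CU: pair_prob_space coin uniform_choices ..
  interpret N: pair_prob_space exp_clock "coin \<Otimes>\<^sub>M uniform_choices" ..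
  show "prob_space merge_noise" unfolding merge_noise_def by (rule N.prob_space_axioms)
  show "(\<lambda>(\<xi>, y, z). aged_merge \<xi> y z) \<in> merge_noise \<Otimes>\<^sub>M gen_space \<Otimes>\<^sub>M gen_space \<rightarrow>\<^sub>M gen_space"
    by (rule aged_merge_measurable)
  show "leaf_count \<in> gen_space \<rightarrow>\<^sub>M count_space UNIV" by (rule leaf_count_measurable)
  show "0 < leaf_count z" if "z \<in> space gen_space" for z using that by (simp add: space_gen leaf_count_pos)
  show "leaf_count (aged_merge \<xi> y z) = leaf_count y + leaf_count z"
    if "\<xi> \<in> space merge_noise" "y \<in> space gen_space" "z \<in> space gen_space" for \<xi> y z
    using that(2,3) by (simp add: aged_merge_def split_beta Let_def space_gen leaf_count_merge)
  show "prob_space aged_singleton"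
    unfolding aged_singleton_def by (rule E.prob_space_distr[OF aged_singleton_measurable])
  show "sets aged_singleton = sets gen_space" by (simp add: aged_singleton_def)
  show "AE z in aged_singleton. leaf_count z = 1"
  proof -
    have "{z \<in> space gen_space. leaf_count z = 1} \<in> sets gen_space"
      using leaf_count_measurable by measurable
    then show ?thesis unfolding aged_singleton_def
      by (subst AE_distr_iff[OF aged_singleton_measurable]) auto
  qed
qed

lemma aged_singleton_integral:
  assumes "g \<in> borel_measurable gen_space"
  shows "(\<integral>\<^sup>+z. g z \<partial>aged_singleton) = (\<integral>\<^sup>+x. g (age x singleton_state) \<partial>exp_clock)"
  unfolding aged_singleton_def using nn_integral_distr[OF aged_singleton_measurable, of g] assms by simp

text \<open>The factor 2 absorbs the probability of the coin; the two summands are the two sides.\<close>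

lemma merge_noise_integral:
  assumes f: "f \<in> borel_measurable merge_noise"
  shows "2 * (\<integral>\<^sup>+\<xi>. f \<xi> \<partial>merge_noise) =
    (\<integral>\<^sup>+x. \<integral>\<^sup>+p. f (x, False, p) \<partial>uniform_choices \<partial>exp_clock) +
    (\<integral>\<^sup>+x. \<integral>\<^sup>+p. f (x, True, p) \<partial>uniform_choices \<partial>exp_clock)"
proof -
  interpret E: prob_space exp_clock by (rule prob_space_exp_clock)
  interpret U: prob_space uniform_choices by (rule prob_space_uniform_choices)
  interpret CU: pair_prob_space coin uniform_choices ..
  have f': "f \<in> borel_measurable (exp_clock \<Otimes>\<^sub>M coin \<Otimes>\<^sub>M uniform_choices)"
    using f by (simp add: merge_noise_def)
  have fb: "(\<lambda>(x, p). f (x, b, p)) \<in> borel_measurable (exp_clock \<Otimes>\<^sub>M uniform_choices)" for b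
  proof -
    have "(\<lambda>w. (fst w, b, snd w)) \<in> exp_clock \<Otimes>\<^sub>M uniform_choices \<rightarrow>\<^sub>M exp_clock \<Otimes>\<^sub>M coin \<Otimes>\<^sub>M uniform_choices"
      by (intro measurable_Pair measurable_fst measurable_snd measurable_const) simp
    from measurable_compose[OF this f'] show ?thesis by (simp add: split_beta')
  qed
  have h [measurable]: "(\<lambda>x. \<integral>\<^sup>+p. f (x, b, p) \<partial>uniform_choices) \<in> borel_measurable exp_clock" for b
    using U.borel_measurable_nn_integral[OF fb[of b]] .
  have half: "2 * (a * ennreal (1/2)) = a" for a
    using two_halves[of a] by (simp only: mult.commute)
  have "(\<integral>\<^sup>+\<xi>. f \<xi> \<partial>merge_noise) = (\<integral>\<^sup>+x. \<integral>\<^sup>+w. f (x, w) \<partial>(coin \<Otimes>\<^sub>M uniform_choices) \<partial>exp_clock)"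
    unfolding merge_noise_def by (rule CU.nn_integral_fst[OF f', symmetric])
  also have "\<dots> = (\<integral>\<^sup>+x. \<integral>\<^sup>+b. \<integral>\<^sup>+p. f (x, b, p) \<partial>uniform_choices \<partial>coin \<partial>exp_clock)"
  proof (rule nn_integral_cong)
    fix x assume x: "x \<in> space exp_clock"
    show "(\<integral>\<^sup>+w. f (x, w) \<partial>(coin \<Otimes>\<^sub>M uniform_choices)) = (\<integral>\<^sup>+b. \<integral>\<^sup>+p. f (x, b, p) \<partial>uniform_choices \<partial>coin)"
      using U.nn_integral_fst[OF measurable_compose[OF measurable_Pair1'[OF x] f']] by simp
  qed
  also have "2 * \<dots> = 2 * (\<integral>\<^sup>+x. (\<integral>\<^sup>+p. f (x, True, p) \<partial>uniform_choices) * ennreal (1/2) +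
      (\<integral>\<^sup>+p. f (x, False, p) \<partial>uniform_choices) * ennreal (1/2) \<partial>exp_clock)"
    by (simp add: nn_integral_bernoulli_pmf)
  also have "\<dots> = 2 * ((\<integral>\<^sup>+x. \<integral>\<^sup>+p. f (x, True, p) \<partial>uniform_choices \<partial>exp_clock) * ennreal (1/2) +
      (\<integral>\<^sup>+x. \<integral>\<^sup>+p. f (x, False, p) \<partial>uniform_choices \<partial>exp_clock) * ennreal (1/2))"
    by (simp add: nn_integral_add nn_integral_multc del: ennreal_half)
  also have "\<dots> = (\<integral>\<^sup>+x. \<integral>\<^sup>+p. f (x, True, p) \<partial>uniform_choices \<partial>exp_clock) +
      (\<integral>\<^sup>+x. \<integral>\<^sup>+p. f (x, False, p) \<partial>uniform_choices \<partial>exp_clock)"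
    by (simp only: distrib_left half)
  finally show ?thesis by (simp only: add.commute)
qed

text \<open>Merging samples and ageing by a clock divided by the number of leaves yields a sample of the combined
  decoration, with this clock at the root.\<close>

lemma aged_merge_left:
  assumes L: "plane_tree L" and R: "plane_tree R"
  shows "(let m = merge False v (sample (L, \<rho>L, eL) XL) (sample (R, \<rho>R, eR) XR) in age (x / real (leaf_count m)) m) =
    sample (node L R, False # \<rho>L, combine L R (v, \<rho>R) eL eR) (join_clocks x XL XR)"
proof -
  let ?m = "merge False v (sample (L, \<rho>L, eL) XL) (sample (R, \<rho>R, eR) XR)"
  have "(spent ?m)([] := spent ?m [] + x / real (leaf_count ?m)) = spent_times (node L R) (join_clocks x XL XR)"
  proof
    fix w show "((spent ?m)([] := spent ?m [] + x / real (leaf_count ?m))) w = spent_times (node L R) (join_clocks x XL XR) w"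
      by (cases w) (auto simp: spent_times_def leaf_count_def card_leaves_above_node[OF L R])
  qed
  then show ?thesis
    by (simp add: Let_def age_def sample_def graft_tree_cluster_left[OF L R])
qed

lemma aged_merge_right:
  assumes L: "plane_tree L" and R: "plane_tree R"
  shows "(let m = merge True v (sample (R, \<rho>R, eR) XR) (sample (L, \<rho>L, eL) XL) in age (x / real (leaf_count m)) m) =
    sample (node L R, True # \<rho>R, combine L R (\<rho>L, v) eL eR) (join_clocks x XL XR)"
proof -
  let ?m = "merge True v (sample (R, \<rho>R, eR) XR) (sample (L, \<rho>L, eL) XL)"
  have "(spent ?m)([] := spent ?m [] + x / real (leaf_count ?m)) = spent_times (node L R) (join_clocks x XL XR)"
  proof
    fix w show "((spent ?m)([] := spent ?m [] + x / real (leaf_count ?m))) w = spent_times (node L R) (join_clocks x XL XR) w"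
      by (cases w) (auto simp: spent_times_def leaf_count_def card_leaves_above_node[OF L R])
  qed
  then show ?thesis
    by (simp add: Let_def age_def sample_def graft_tree_cluster_right[OF L R])
qed

lemma clocks_split_last:
  assumes F: "F \<in> borel_measurable clocks"
  shows "(\<integral>\<^sup>+XL. \<integral>\<^sup>+XR. \<integral>\<^sup>+x. F (join_clocks x XL XR) \<partial>exp_clock \<partial>clocks \<partial>clocks) = (\<integral>\<^sup>+X. F X \<partial>clocks)" (is ?A)
    and "(\<integral>\<^sup>+XR. \<integral>\<^sup>+XL. \<integral>\<^sup>+x. F (join_clocks x XL XR) \<partial>exp_clock \<partial>clocks \<partial>clocks) = (\<integral>\<^sup>+X. F X \<partial>clocks)" (is ?B)
proof -
  interpret E: prob_space exp_clock by (rule prob_space_exp_clock)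
  interpret C: prob_space clocks by (rule prob_space_clocks)
  interpret CC: pair_sigma_finite clocks clocks ..
  interpret EC: pair_sigma_finite exp_clock clocks ..
  have m: "(\<lambda>(x, XL, XR). F (join_clocks x XL XR)) \<in> borel_measurable (exp_clock \<Otimes>\<^sub>M clocks \<Otimes>\<^sub>M clocks)"
    using measurable_compose[OF join_clocks_measurable F] by (simp add: split_beta')
  have mm: "(\<lambda>w. F (join_clocks (f w) (g w) (h w))) \<in> borel_measurable N"
    if "f \<in> N \<rightarrow>\<^sub>M exp_clock" "g \<in> N \<rightarrow>\<^sub>M clocks" "h \<in> N \<rightarrow>\<^sub>M clocks"
    for f g h and N :: "'z measure"
    using measurable_compose[OF measurable_Pair[OF that(1) measurable_Pair[OF that(2,3)]] m] by simp
  have 1: "(\<integral>\<^sup>+XR. \<integral>\<^sup>+x. F (join_clocks x XL XR) \<partial>exp_clock \<partial>clocks) = (\<integral>\<^sup>+x. \<integral>\<^sup>+XR. F (join_clocks x XL XR) \<partial>clocks \<partial>exp_clock)"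
    if "XL \<in> space clocks" for XL
    by (rule EC.Fubini') (use that in \<open>simp add: split_beta' mm\<close>)
  have 2: "(\<integral>\<^sup>+XL. \<integral>\<^sup>+x. \<integral>\<^sup>+XR. F (join_clocks x XL XR) \<partial>clocks \<partial>exp_clock \<partial>clocks) =
      (\<integral>\<^sup>+x. \<integral>\<^sup>+XL. \<integral>\<^sup>+XR. F (join_clocks x XL XR) \<partial>clocks \<partial>clocks \<partial>exp_clock)"
  proof (rule EC.Fubini')
    have "(\<lambda>(w, XR). F (join_clocks (fst w) (snd w) XR)) \<in> borel_measurable ((exp_clock \<Otimes>\<^sub>M clocks) \<Otimes>\<^sub>M clocks)"
      unfolding split_beta' by (intro mm) measurable
    from C.borel_measurable_nn_integral[OF this]
    show "(\<lambda>(x, XL). \<integral>\<^sup>+XR. F (join_clocks x XL XR) \<partial>clocks) \<in> borel_measurable (exp_clock \<Otimes>\<^sub>M clocks)"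
      by (simp add: split_beta')
  qed
  show A: ?A
    using 1 2 clocks_split[OF F] by (simp cong: nn_integral_cong)
  have "(\<lambda>(w, x). F (join_clocks x (snd w) (fst w))) \<in> borel_measurable ((clocks \<Otimes>\<^sub>M clocks) \<Otimes>\<^sub>M exp_clock)"
    unfolding split_beta' by (intro mm) measurable
  from E.borel_measurable_nn_integral[OF this]
  have "(\<lambda>(XR, XL). \<integral>\<^sup>+x. F (join_clocks x XL XR) \<partial>exp_clock) \<in> borel_measurable (clocks \<Otimes>\<^sub>M clocks)"
    by (simp add: split_beta')
  from CC.Fubini'[OF this] A show ?B by simp
qed

definition mean :: "(gstate \<Rightarrow> ennreal) \<Rightarrow> decoration \<Rightarrow> ennreal" where
  "mean g d = (\<integral>\<^sup>+X. g (sample d X) \<partial>clocks)"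

lemma uniform_mean_measurable:
  assumes A: "finite A" "A \<noteq> {}" and f: "\<And>v. v \<in> A \<Longrightarrow> f v \<in> borel_measurable M"
  shows "(\<lambda>x. \<integral>\<^sup>+v. f v x \<partial>pmf_of_set A) \<in> borel_measurable M"
proof -
  have "(\<lambda>x. (\<Sum>v\<in>A. f v x) / of_nat (card A)) \<in> borel_measurable M"
    by (intro borel_measurable_divide_ennreal borel_measurable_sum f) auto
  then show ?thesis using A by (simp add: nn_integral_pmf_of_set)
qed

text \<open>One merging step applied to two independent samples, averaged over everything except the two
  decorations: by the fresh clock at the new root, the outcome is again a sample.\<close>

lemma merge_samples_integral:
  assumes g: "g \<in> borel_measurable gen_space" and d: "valid (T, \<rho>, e)" and d': "valid (T', \<rho>', e')"
  shows "2 * (\<integral>\<^sup>+X. \<integral>\<^sup>+X'. \<integral>\<^sup>+\<xi>. g (aged_merge \<xi> (sample (T, \<rho>, e) X) (sample (T', \<rho>', e') X')) \<partial>merge_noise \<partial>clocks \<partial>clocks) =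
    (\<integral>\<^sup>+v. mean g (node T T', False # \<rho>, combine T T' (v, \<rho>') e e') \<partial>pmf_of_set (leaves T)) +
    (\<integral>\<^sup>+v. mean g (node T' T, True # \<rho>, combine T' T (\<rho>', v) e' e) \<partial>pmf_of_set (leaves T))"
proof -
  interpret E: prob_space exp_clock by (rule prob_space_exp_clock)
  interpret C: prob_space clocks by (rule prob_space_clocks)
  have T: "plane_tree T" "plane_tree T'" using d d' by (auto simp: valid_def)
  have lv: "finite (leaves T)" "leaves T \<noteq> {}" using T finite_leaves leaves_nonempty by auto
  let ?dF = "\<lambda>v. (node T T', False # \<rho>, combine T T' (v, \<rho>') e e')"
  let ?dT = "\<lambda>v. (node T' T, True # \<rho>, combine T' T (\<rho>', v) e' e)"
  have comb: "combine L R (a, b) eL eR \<in> choices (node L R)"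
    if "plane_tree L" "plane_tree R" "a \<in> leaves L" "b \<in> leaves R" "eL \<in> choices L" "eR \<in> choices R" for L R a b eL eR
    using bij_betw_imp_surj_on[OF combine_bij[OF that(1,2)]] that by force
  have vF: "valid (?dF v)" "valid (?dT v)" if "v \<in> leaves T" for v
    using d d' that comb T by (auto simp: valid_def leaves_node)
  let ?F = "\<lambda>X. \<integral>\<^sup>+v. g (sample (?dF v) X) \<partial>pmf_of_set (leaves T)"
  let ?T = "\<lambda>X. \<integral>\<^sup>+v. g (sample (?dT v) X) \<partial>pmf_of_set (leaves T)"
  have gs: "(\<lambda>X. g (sample (?dF v) X)) \<in> borel_measurable clocks" "(\<lambda>X. g (sample (?dT v) X)) \<in> borel_measurable clocks"
    if "v \<in> leaves T" for v
    using measurable_compose[OF sample_measurable g] vF[OF that] by blast+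
  have Fm: "?F \<in> borel_measurable clocks" "?T \<in> borel_measurable clocks"
    using gs by (auto intro!: uniform_mean_measurable lv)
  have xi: "2 * (\<integral>\<^sup>+\<xi>. g (aged_merge \<xi> (sample (T, \<rho>, e) X) (sample (T', \<rho>', e') X')) \<partial>merge_noise) =
      (\<integral>\<^sup>+x. ?F (join_clocks x X X') \<partial>exp_clock) + (\<integral>\<^sup>+x. ?T (join_clocks x X' X) \<partial>exp_clock)"
    if X: "X \<in> space clocks" "X' \<in> space clocks" for X X'
  proof -
    have sT: "sample (T, \<rho>, e) X \<in> space gen_space" "sample (T', \<rho>', e') X' \<in> space gen_space"
      using sample_T_gen[OF d X(1)] sample_T_gen[OF d' X(2)] by (simp_all add: space_gen)
    have "(\<lambda>\<xi>. g (aged_merge \<xi> (sample (T, \<rho>, e) X) (sample (T', \<rho>', e') X'))) \<in> borel_measurable merge_noise"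
      using sT by (intro measurable_compose[OF gen.phi_measurable' g]) auto
    from merge_noise_integral[OF this] show ?thesis
      by (simp add: aged_merge_def aged_merge_left[OF T] aged_merge_right[OF T(2,1)]
        uniform_choice_integral[OF lv, of "\<lambda>v. g (sample (?dF v) (join_clocks x X X'))" for x]
        uniform_choice_integral[OF lv, of "\<lambda>v. g (sample (?dT v) (join_clocks x X' X))" for x])
  qed
  have jm: "(\<lambda>((X, X'), x). H (join_clocks x X X')) \<in> borel_measurable ((clocks \<Otimes>\<^sub>M clocks) \<Otimes>\<^sub>M exp_clock)"
      "(\<lambda>((X, X'), x). H (join_clocks x X' X)) \<in> borel_measurable ((clocks \<Otimes>\<^sub>M clocks) \<Otimes>\<^sub>M exp_clock)"
    if H: "H \<in> borel_measurable clocks" for H :: "(vertex \<Rightarrow> real) \<Rightarrow> ennreal"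
  proof -
    have "(\<lambda>w. (snd w, fst (fst w), snd (fst w))) \<in> (clocks \<Otimes>\<^sub>M clocks) \<Otimes>\<^sub>M exp_clock \<rightarrow>\<^sub>M exp_clock \<Otimes>\<^sub>M clocks \<Otimes>\<^sub>M clocks"
      "(\<lambda>w. (snd w, snd (fst w), fst (fst w))) \<in> (clocks \<Otimes>\<^sub>M clocks) \<Otimes>\<^sub>M exp_clock \<rightarrow>\<^sub>M exp_clock \<Otimes>\<^sub>M clocks \<Otimes>\<^sub>M clocks"
      by measurable
    from this[THEN measurable_compose, OF measurable_compose[OF join_clocks_measurable H]]
    show "(\<lambda>((X, X'), x). H (join_clocks x X X')) \<in> borel_measurable ((clocks \<Otimes>\<^sub>M clocks) \<Otimes>\<^sub>M exp_clock)"
      "(\<lambda>((X, X'), x). H (join_clocks x X' X)) \<in> borel_measurable ((clocks \<Otimes>\<^sub>M clocks) \<Otimes>\<^sub>M exp_clock)"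
      by (simp_all add: split_beta')
  qed
  define I where "I = (\<lambda>X X'. \<integral>\<^sup>+\<xi>. g (aged_merge \<xi> (sample (T, \<rho>, e) X) (sample (T', \<rho>', e') X')) \<partial>merge_noise)"
  have Im: "(\<lambda>(X, X'). I X X') \<in> borel_measurable (clocks \<Otimes>\<^sub>M clocks)"
  proof -
    have "(\<lambda>w. (sample (T, \<rho>, e) (fst w), sample (T', \<rho>', e') (snd w))) \<in> clocks \<Otimes>\<^sub>M clocks \<rightarrow>\<^sub>M gen_space \<Otimes>\<^sub>M gen_space"
      using measurable_compose[OF measurable_fst sample_measurable[OF d]] measurable_compose[OF measurable_snd sample_measurable[OF d']]
      by (intro measurable_Pair) auto
    from measurable_compose[OF this gen.inner_measurable[OF gw_environment_law g]] show ?thesis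
      by (simp add: I_def split_beta')
  qed
  define jF where "jF X X' = (\<integral>\<^sup>+x. ?F (join_clocks x X X') \<partial>exp_clock)" for X X'
  define jT where "jT X X' = (\<integral>\<^sup>+x. ?T (join_clocks x X' X) \<partial>exp_clock)" for X X'
  have jFm: "(\<lambda>(X, X'). jF X X') \<in> borel_measurable (clocks \<Otimes>\<^sub>M clocks)"
    using E.borel_measurable_nn_integral[of "\<lambda>w x. ?F (join_clocks x (fst w) (snd w))"] jm(1)[OF Fm(1)]
    by (simp add: jF_def split_beta')
  have jTm: "(\<lambda>(X, X'). jT X X') \<in> borel_measurable (clocks \<Otimes>\<^sub>M clocks)"
    using E.borel_measurable_nn_integral[of "\<lambda>w x. ?T (join_clocks x (snd w) (fst w))"] jm(2)[OF Fm(2)]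
    by (simp add: jT_def split_beta')
  note mI = C.borel_measurable_nn_integral[OF Im] C.borel_measurable_nn_integral[OF jFm] C.borel_measurable_nn_integral[OF jTm]
  have m1: "I X \<in> borel_measurable clocks" "jF X \<in> borel_measurable clocks" "jT X \<in> borel_measurable clocks"
    if "X \<in> space clocks" for X
    using measurable_compose[OF measurable_Pair1'[OF that] Im] measurable_compose[OF measurable_Pair1'[OF that] jFm]
      measurable_compose[OF measurable_Pair1'[OF that] jTm] by simp_all
  have "2 * (\<integral>\<^sup>+X. \<integral>\<^sup>+X'. I X X' \<partial>clocks \<partial>clocks) = (\<integral>\<^sup>+X. 2 * (\<integral>\<^sup>+X'. I X X' \<partial>clocks) \<partial>clocks)"
    by (rule nn_integral_cmult[symmetric, OF mI(1)])
  also have "\<dots> = (\<integral>\<^sup>+X. (\<integral>\<^sup>+X'. jF X X' \<partial>clocks) + (\<integral>\<^sup>+X'. jT X X' \<partial>clocks) \<partial>clocks)"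
  proof (rule nn_integral_cong)
    fix X assume X: "X \<in> space clocks"
    have "2 * (\<integral>\<^sup>+X'. I X X' \<partial>clocks) = (\<integral>\<^sup>+X'. 2 * I X X' \<partial>clocks)"
      by (rule nn_integral_cmult[symmetric, OF m1(1)[OF X]])
    also have "\<dots> = (\<integral>\<^sup>+X'. jF X X' + jT X X' \<partial>clocks)"
      using xi[OF X] by (intro nn_integral_cong) (simp add: I_def jF_def jT_def)
    also have "\<dots> = (\<integral>\<^sup>+X'. jF X X' \<partial>clocks) + (\<integral>\<^sup>+X'. jT X X' \<partial>clocks)"
      by (rule nn_integral_add[OF m1(2,3)[OF X]])
    finally show "2 * (\<integral>\<^sup>+X'. I X X' \<partial>clocks) = \<dots>" .
  qed
  also have "\<dots> = (\<integral>\<^sup>+X. \<integral>\<^sup>+X'. jF X X' \<partial>clocks \<partial>clocks) + (\<integral>\<^sup>+X. \<integral>\<^sup>+X'. jT X X' \<partial>clocks \<partial>clocks)"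
    by (rule nn_integral_add[OF mI(2,3)])
  also have "(\<integral>\<^sup>+X. \<integral>\<^sup>+X'. jF X X' \<partial>clocks \<partial>clocks) = (\<integral>\<^sup>+X. ?F X \<partial>clocks)"
    unfolding jF_def by (rule clocks_split_last(1)[OF Fm(1)])
  also have "(\<integral>\<^sup>+X. \<integral>\<^sup>+X'. jT X X' \<partial>clocks \<partial>clocks) = (\<integral>\<^sup>+X. ?T X \<partial>clocks)"
    unfolding jT_def by (rule clocks_split_last(2)[OF Fm(2)])
  also have "(\<integral>\<^sup>+X. ?F X \<partial>clocks) = (\<integral>\<^sup>+v. mean g (?dF v) \<partial>pmf_of_set (leaves T))"
    unfolding mean_def by (rule pmf_integral_swap) (use gs lv in auto)
  also have "(\<integral>\<^sup>+X. ?T X \<partial>clocks) = (\<integral>\<^sup>+v. mean g (?dT v) \<partial>pmf_of_set (leaves T))"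
    unfolding mean_def by (rule pmf_integral_swap) (use gs lv in auto)
  finally show ?thesis unfolding I_def .
qed

lemma choices_node_integral:
  assumes L: "plane_tree L" and R: "plane_tree R"
  shows "(\<integral>\<^sup>+e. f e \<partial>pmf_of_set (choices (node L R))) =
    (\<integral>\<^sup>+a. \<integral>\<^sup>+b. \<integral>\<^sup>+eL. \<integral>\<^sup>+eR. f (combine L R (a, b) eL eR)
      \<partial>pmf_of_set (choices R) \<partial>pmf_of_set (choices L) \<partial>pmf_of_set (leaves R) \<partial>pmf_of_set (leaves L))"
proof -
  note fin = finite_leaves[OF L] finite_leaves[OF R] finite_choices[OF L] finite_choices[OF R]
    leaves_nonempty[OF L] leaves_nonempty[OF R] choices_nonempty[OF L] choices_nonempty[OF R]
  have "pmf_of_set (choices (node L R)) = map_pmf (\<lambda>(p, eL, eR). combine L R p eL eR)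
      (pmf_of_set ((leaves L \<times> leaves R) \<times> choices L \<times> choices R))"
    using fin by (intro map_pmf_of_set_bij_betw[symmetric] combine_bij L R) auto
  also have "pmf_of_set ((leaves L \<times> leaves R) \<times> choices L \<times> choices R) =
      pair_pmf (pair_pmf (pmf_of_set (leaves L)) (pmf_of_set (leaves R))) (pair_pmf (pmf_of_set (choices L)) (pmf_of_set (choices R)))"
    using fin by (simp add: pair_pmf_of_set)
  finally show ?thesis by (simp add: nn_integral_pair_pmf')
qed

lemma scaled_uniform_integral:
  fixes f :: "'a \<Rightarrow> ennreal"
  assumes "finite A" "A \<noteq> {}"
  shows "of_nat (card A) * (\<integral>\<^sup>+v. f v \<partial>pmf_of_set A) = (\<Sum>v\<in>A. f v)"
proof -
  have "0 < card A" using assms by (simp add: card_gt_0_iff)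
  then have "of_nat (card A) * (sum f A / of_nat (card A)) = sum f A"
    by (simp add: ennreal_times_divide mult.commute[of "of_nat (card A)"] mult_divide_eq_ennreal)
  then show ?thesis using assms by (simp add: nn_integral_pmf_of_set)
qed

text \<open>A uniform leaf of \<open>node L R\<close> lies in a subtree with probability proportional to its number of
  leaves, and is uniform there.\<close>

lemma scaled_node_leaf_integral:
  fixes f :: "vertex \<Rightarrow> ennreal"
  assumes L: "plane_tree L" and R: "plane_tree R"
  shows "of_nat (card (leaves (node L R))) * (\<integral>\<^sup>+v. f v \<partial>pmf_of_set (leaves (node L R))) =
    of_nat (card (leaves L)) * (\<integral>\<^sup>+v. f (False # v) \<partial>pmf_of_set (leaves L)) +
    of_nat (card (leaves R)) * (\<integral>\<^sup>+v. f (True # v) \<partial>pmf_of_set (leaves R))"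
proof -
  have LR: "plane_tree (node L R)" using L R by simp
  have "(\<Sum>v\<in>leaves (node L R). f v) = (\<Sum>v\<in>leaves L. f (False # v)) + (\<Sum>v\<in>leaves R. f (True # v))"
    unfolding leaves_node[OF L R]
    by (subst sum.union_disjoint) (auto simp: finite_leaves L R sum.reindex)
  then show ?thesis
    by (simp only: scaled_uniform_integral[OF finite_leaves[OF LR] leaves_nonempty[OF LR]]
      scaled_uniform_integral[OF finite_leaves[OF L] leaves_nonempty[OF L]]
      scaled_uniform_integral[OF finite_leaves[OF R] leaves_nonempty[OF R]])
qed

lemma leaf_mean:
  assumes g: "g \<in> borel_measurable gen_space"
  shows "mean g ({[]}, [], \<lambda>_. ([], [])) = (\<integral>\<^sup>+z. g z \<partial>aged_singleton)"
proof -
  interpret C: prob_space clocks by (rule prob_space_clocks)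
  have v: "valid ({[]}, [], \<lambda>_. ([], []))" by (simp add: valid_def choices_leaf)
  have s: "sample ({[]}, [], \<lambda>_. ([], [])) (join_clocks x XL XR) = age x singleton_state" for x XL XR
    by (auto simp: sample_def age_def singleton_state_def tree_cluster_leaf spent_times_def fun_eq_iff)
  have "mean g ({[]}, [], \<lambda>_. ([], [])) = (\<integral>\<^sup>+x. g (age x singleton_state) \<partial>exp_clock)"
    unfolding mean_def
    by (subst clocks_split[OF measurable_compose[OF sample_measurable[OF v] g]]) (simp add: s C.emeasure_space_1)
  then show ?thesis by (simp add: aged_singleton_integral[OF g])
qed

lemma gw_AE: "(\<And>T. plane_tree T \<Longrightarrow> P T) \<Longrightarrow> AE T in gw_pmf. P T"
  by (rule AE_pmfI) (simp add: set_gw_pmf)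

abbreviation leaf_pmf :: "vertex set \<Rightarrow> vertex pmf" where "leaf_pmf T \<equiv> pmf_of_set (leaves T)"
abbreviation choice_pmf :: "vertex set \<Rightarrow> (vertex \<Rightarrow> vertex \<times> vertex) pmf" where "choice_pmf T \<equiv> pmf_of_set (choices T)"
abbreviation nl :: "vertex set \<Rightarrow> ennreal" where "nl T \<equiv> of_nat (card (leaves T))"

text \<open>Contributions of the decorations of \<open>node L R\<close> whose cluster is rooted in \<open>L\<close>. The order of the integrals
  is the one into which merging two samples can be brought.\<close>

definition left_total :: "(gstate \<Rightarrow> ennreal) \<Rightarrow> vertex set \<Rightarrow> vertex set \<Rightarrow> ennreal" where
  "left_total g L R = (\<integral>\<^sup>+\<rho>. \<integral>\<^sup>+b. \<integral>\<^sup>+a. \<integral>\<^sup>+eL. \<integral>\<^sup>+eR. nl L * mean g (node L R, False # \<rho>, combine L R (a, b) eL eR)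
     \<partial>choice_pmf R \<partial>choice_pmf L \<partial>leaf_pmf L \<partial>leaf_pmf R \<partial>leaf_pmf L)"

definition right_total :: "(gstate \<Rightarrow> ennreal) \<Rightarrow> vertex set \<Rightarrow> vertex set \<Rightarrow> ennreal" where
  "right_total g L R = (\<integral>\<^sup>+\<rho>. \<integral>\<^sup>+a. \<integral>\<^sup>+b. \<integral>\<^sup>+eR. \<integral>\<^sup>+eL. nl R * mean g (node L R, True # \<rho>, combine L R (a, b) eL eR)
     \<partial>choice_pmf L \<partial>choice_pmf R \<partial>leaf_pmf R \<partial>leaf_pmf L \<partial>leaf_pmf R)"

lemma node_total:
  assumes L: "plane_tree L" and R: "plane_tree R"
  shows "nl (node L R) * (\<integral>\<^sup>+\<rho>. \<integral>\<^sup>+e. mean g (node L R, \<rho>, e) \<partial>choice_pmf (node L R) \<partial>leaf_pmf (node L R)) =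
    left_total g L R + right_total g L R"
proof -
  let ?H = "\<lambda>\<rho> e. mean g (node L R, \<rho>, e)"
  have "nl L * (\<integral>\<^sup>+\<rho>. \<integral>\<^sup>+e. ?H (False # \<rho>) e \<partial>choice_pmf (node L R) \<partial>leaf_pmf L) =
    (\<integral>\<^sup>+\<rho>. \<integral>\<^sup>+a. \<integral>\<^sup>+b. \<integral>\<^sup>+eL. \<integral>\<^sup>+eR. nl L * ?H (False # \<rho>) (combine L R (a, b) eL eR)
      \<partial>choice_pmf R \<partial>choice_pmf L \<partial>leaf_pmf R \<partial>leaf_pmf L \<partial>leaf_pmf L)"
    by (simp add: choices_node_integral[OF L R] nn_integral_cmult)
  also have "\<dots> = left_total g L R"
    unfolding left_total_def by (intro nn_integral_cong, subst pmf_pmf_swap) (rule refl)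
  finally have 1: "nl L * (\<integral>\<^sup>+\<rho>. \<integral>\<^sup>+e. ?H (False # \<rho>) e \<partial>choice_pmf (node L R) \<partial>leaf_pmf L) = left_total g L R" .
  have "nl R * (\<integral>\<^sup>+\<rho>. \<integral>\<^sup>+e. ?H (True # \<rho>) e \<partial>choice_pmf (node L R) \<partial>leaf_pmf R) =
    (\<integral>\<^sup>+\<rho>. \<integral>\<^sup>+a. \<integral>\<^sup>+b. \<integral>\<^sup>+eL. \<integral>\<^sup>+eR. nl R * ?H (True # \<rho>) (combine L R (a, b) eL eR)
      \<partial>choice_pmf R \<partial>choice_pmf L \<partial>leaf_pmf R \<partial>leaf_pmf L \<partial>leaf_pmf R)"
    by (simp add: choices_node_integral[OF L R] nn_integral_cmult)
  also have "\<dots> = right_total g L R"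
    unfolding right_total_def by (intro nn_integral_cong, subst pmf_pmf_swap) (rule refl)
  finally have 2: "nl R * (\<integral>\<^sup>+\<rho>. \<integral>\<^sup>+e. ?H (True # \<rho>) e \<partial>choice_pmf (node L R) \<partial>leaf_pmf R) = right_total g L R" .
  show ?thesis by (simp only: scaled_node_leaf_integral[OF L R] 1 2)
qed

text \<open>The independent pieces of two samples may be integrated in any order.\<close>

lemma sort_pmf_integrals:
  fixes F :: "vertex set \<Rightarrow> vertex \<Rightarrow> (vertex \<Rightarrow> vertex \<times> vertex) \<Rightarrow> vertex set \<Rightarrow> vertex \<Rightarrow>
    (vertex \<Rightarrow> vertex \<times> vertex) \<Rightarrow> vertex \<Rightarrow> ennreal"
  shows "(\<integral>\<^sup>+T. \<integral>\<^sup>+\<rho>. \<integral>\<^sup>+e. \<integral>\<^sup>+T'. \<integral>\<^sup>+\<rho>'. \<integral>\<^sup>+e'. \<integral>\<^sup>+v. F T \<rho> e T' \<rho>' e' v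
      \<partial>leaf_pmf T \<partial>choice_pmf T' \<partial>leaf_pmf T' \<partial>gw_pmf \<partial>choice_pmf T \<partial>leaf_pmf T \<partial>gw_pmf) =
    (\<integral>\<^sup>+T. \<integral>\<^sup>+T'. \<integral>\<^sup>+\<rho>. \<integral>\<^sup>+\<rho>'. \<integral>\<^sup>+v. \<integral>\<^sup>+e. \<integral>\<^sup>+e'. F T \<rho> e T' \<rho>' e' v
      \<partial>choice_pmf T' \<partial>choice_pmf T \<partial>leaf_pmf T \<partial>leaf_pmf T' \<partial>leaf_pmf T \<partial>gw_pmf \<partial>gw_pmf)"
proof -
  note swaps = pmf_pmf_swap[where p = "choice_pmf A" and q = gw_pmf for A]
    pmf_pmf_swap[where p = "leaf_pmf A" and q = gw_pmf for A]
    pmf_pmf_swap[where p = "choice_pmf A" and q = "leaf_pmf B" for A B]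
  show ?thesis by (simp only: swaps)
qed

text \<open>On the left-hand side the weight \<open>leaf_count\<close> cancels the normalisation of the uniform root, and the
  branching property splits off the root of the tree. On the right-hand side one merging step reproduces
  the two halves of \<open>node_total\<close>, according to the side on which the previous tree is placed.\<close>

theorem gw_environment_balanced: "gen.balanced 2 gw_environment"
  unfolding gen.balanced_def
proof (intro conjI ballI gw_environment_law)
  fix g :: "gstate \<Rightarrow> ennreal" assume g: "g \<in> borel_measurable gen_space"
  interpret C: prob_space clocks by (rule prob_space_clocks)
  have nm: "(\<lambda>z. of_nat (leaf_count z) * g z) \<in> borel_measurable gen_space"
    by (rule gen.weighted_measurable[OF g])
  have mean_n: "(\<integral>\<^sup>+X. of_nat (leaf_count (sample d X)) * g (sample d X) \<partial>clocks) = nl (fst d) * mean g d" if "valid d" for d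
    unfolding mean_def using measurable_compose[OF sample_measurable[OF that] g]
    by (cases d) (simp add: leaf_count_def nn_integral_cmult)
  have leaf: "nl {[]} * (\<integral>\<^sup>+\<rho>. \<integral>\<^sup>+e. mean g ({[]}, \<rho>, e) \<partial>choice_pmf {[]} \<partial>leaf_pmf {[]}) = (\<integral>\<^sup>+z. g z \<partial>aged_singleton)"
    by (simp add: choices_leaf pmf_of_set_singleton leaf_mean[OF g])
  have "2 * (\<integral>\<^sup>+z. of_nat (leaf_count z) * g z \<partial>gw_environment) = 2 * (\<integral>\<^sup>+d. nl (fst d) * mean g d \<partial>decoration_pmf)"
    unfolding gw_environment_integral[OF nm]
    by (intro arg_cong[where f = "\<lambda>a. 2 * a"] nn_integral_cong_AE AE_pmfI mean_n) (simp add: set_decoration)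
  also have "\<dots> = 2 * (\<integral>\<^sup>+T. nl T * (\<integral>\<^sup>+\<rho>. \<integral>\<^sup>+e. mean g (T, \<rho>, e) \<partial>choice_pmf T \<partial>leaf_pmf T) \<partial>gw_pmf)"
    by (simp add: decoration_integral nn_integral_cmult)
  also have "\<dots> = (\<integral>\<^sup>+z. g z \<partial>aged_singleton) +
      (\<integral>\<^sup>+L. \<integral>\<^sup>+R. nl (node L R) * (\<integral>\<^sup>+\<rho>. \<integral>\<^sup>+e. mean g (node L R, \<rho>, e) \<partial>choice_pmf (node L R) \<partial>leaf_pmf (node L R)) \<partial>gw_pmf \<partial>gw_pmf)"
    by (subst gw_pmf_recursion) (simp only: leaf)
  also have "(\<integral>\<^sup>+L. \<integral>\<^sup>+R. nl (node L R) * (\<integral>\<^sup>+\<rho>. \<integral>\<^sup>+e. mean g (node L R, \<rho>, e) \<partial>choice_pmf (node L R) \<partial>leaf_pmf (node L R)) \<partial>gw_pmf \<partial>gw_pmf) =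
      (\<integral>\<^sup>+L. \<integral>\<^sup>+R. left_total g L R + right_total g L R \<partial>gw_pmf \<partial>gw_pmf)"
    by (intro nn_integral_cong_AE gw_AE node_total)
  also have "\<dots> = (\<integral>\<^sup>+L. \<integral>\<^sup>+R. left_total g L R \<partial>gw_pmf \<partial>gw_pmf) + (\<integral>\<^sup>+L. \<integral>\<^sup>+R. right_total g L R \<partial>gw_pmf \<partial>gw_pmf)"
    by (simp add: nn_integral_add)
  finally have lhs: "2 * (\<integral>\<^sup>+z. of_nat (leaf_count z) * g z \<partial>gw_environment) = (\<integral>\<^sup>+z. g z \<partial>aged_singleton) +
      ((\<integral>\<^sup>+L. \<integral>\<^sup>+R. left_total g L R \<partial>gw_pmf \<partial>gw_pmf) + (\<integral>\<^sup>+L. \<integral>\<^sup>+R. right_total g L R \<partial>gw_pmf \<partial>gw_pmf))" .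

  define \<Gamma> where "\<Gamma> y z = (\<integral>\<^sup>+\<xi>. g (aged_merge \<xi> y z) \<partial>merge_noise)" for y z
  have \<Gamma>: "(\<lambda>(y, z). \<Gamma> y z) \<in> borel_measurable (gen_space \<Otimes>\<^sub>M gen_space)"
    using gen.inner_measurable[OF gw_environment_law g] by (simp add: \<Gamma>_def)
  have \<Gamma>1: "\<Gamma> y \<in> borel_measurable gen_space" if "y \<in> T_gen" for y
    using measurable_compose[OF measurable_Pair1' \<Gamma>, of y] that by (simp add: space_gen)
  have \<Gamma>2: "(\<lambda>X. \<integral>\<^sup>+X'. \<Gamma> (sample d X) (sample d' X') \<partial>clocks) \<in> borel_measurable clocks" if "valid d" "valid d'" for d d'
  proof -
    have "(\<lambda>w. (sample d (fst w), sample d' (snd w))) \<in> clocks \<Otimes>\<^sub>M clocks \<rightarrow>\<^sub>M gen_space \<Otimes>\<^sub>M gen_space"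
      using measurable_compose[OF measurable_fst sample_measurable[OF that(1)]] measurable_compose[OF measurable_snd sample_measurable[OF that(2)]]
      by (intro measurable_Pair) auto
    from measurable_compose[OF this \<Gamma>] have "(\<lambda>(X, X'). \<Gamma> (sample d X) (sample d' X')) \<in> borel_measurable (clocks \<Otimes>\<^sub>M clocks)"
      by (simp add: split_beta')
    from C.borel_measurable_nn_integral[OF this] show ?thesis .
  qed
  have step: "gen.step_op gw_environment g y = (\<integral>\<^sup>+d'. \<integral>\<^sup>+X'. \<Gamma> y (sample d' X') \<partial>clocks \<partial>decoration_pmf)" if "y \<in> T_gen" for y
    unfolding gen.step_op_def \<Gamma>_def[symmetric] by (rule gw_environment_integral[OF \<Gamma>1[OF that]])
  have sm: "(\<lambda>y. of_nat (leaf_count y) * gen.step_op gw_environment g y) \<in> borel_measurable gen_space"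
    by (intro gen.weighted_measurable gen.step_op_measurable[OF gw_environment_law g])
  let ?A = "\<lambda>T \<rho> e T' \<rho>' e' v. nl T * mean g (node T T', False # \<rho>, combine T T' (v, \<rho>') e e')"
  let ?B = "\<lambda>T \<rho> e T' \<rho>' e' v. nl T * mean g (node T' T, True # \<rho>, combine T' T (\<rho>', v) e' e)"
  have inner: "2 * (\<integral>\<^sup>+X. of_nat (leaf_count (sample d X)) * gen.step_op gw_environment g (sample d X) \<partial>clocks) =
      (\<integral>\<^sup>+d'. (case d of (T, \<rho>, e) \<Rightarrow> case d' of (T', \<rho>', e') \<Rightarrow>
        (\<integral>\<^sup>+v. ?A T \<rho> e T' \<rho>' e' v \<partial>leaf_pmf T) + (\<integral>\<^sup>+v. ?B T \<rho> e T' \<rho>' e' v \<partial>leaf_pmf T)) \<partial>decoration_pmf)"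
    if d: "valid d" for d
  proof -
    obtain T \<rho> e where dT: "d = (T, \<rho>, e)" by (cases d) auto
    have "(\<integral>\<^sup>+X. of_nat (leaf_count (sample d X)) * gen.step_op gw_environment g (sample d X) \<partial>clocks) =
        (\<integral>\<^sup>+X. nl T * gen.step_op gw_environment g (sample d X) \<partial>clocks)"
      by (simp add: dT leaf_count_def)
    also have "\<dots> = nl T * (\<integral>\<^sup>+X. gen.step_op gw_environment g (sample d X) \<partial>clocks)"
      by (rule nn_integral_cmult)
         (rule measurable_compose[OF sample_measurable[OF d] gen.step_op_measurable[OF gw_environment_law g]])
    also have "(\<integral>\<^sup>+X. gen.step_op gw_environment g (sample d X) \<partial>clocks) =
        (\<integral>\<^sup>+X. \<integral>\<^sup>+d'. \<integral>\<^sup>+X'. \<Gamma> (sample d X) (sample d' X') \<partial>clocks \<partial>decoration_pmf \<partial>clocks)"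
      by (intro nn_integral_cong step sample_T_gen d)
    also have "\<dots> = (\<integral>\<^sup>+d'. \<integral>\<^sup>+X. \<integral>\<^sup>+X'. \<Gamma> (sample d X) (sample d' X') \<partial>clocks \<partial>clocks \<partial>decoration_pmf)"
      by (rule pmf_integral_swap) (rule \<Gamma>2[OF d], simp add: set_decoration)
    also have "2 * (nl T * \<dots>) = (\<integral>\<^sup>+d'. nl T * (2 * (\<integral>\<^sup>+X. \<integral>\<^sup>+X'. \<Gamma> (sample d X) (sample d' X') \<partial>clocks \<partial>clocks)) \<partial>decoration_pmf)"
      by (simp add: nn_integral_cmult mult.left_commute)
    also have "\<dots> = (\<integral>\<^sup>+d'. (case d of (T, \<rho>, e) \<Rightarrow> case d' of (T', \<rho>', e') \<Rightarrow>
        (\<integral>\<^sup>+v. ?A T \<rho> e T' \<rho>' e' v \<partial>leaf_pmf T) + (\<integral>\<^sup>+v. ?B T \<rho> e T' \<rho>' e' v \<partial>leaf_pmf T)) \<partial>decoration_pmf)"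
    proof (rule nn_integral_cong_AE, rule AE_pmfI)
      fix d' assume "d' \<in> set_pmf decoration_pmf"
      then have d': "valid d'" by (simp add: set_decoration)
      obtain T' \<rho>' e' where dT': "d' = (T', \<rho>', e')" by (cases d') auto
      show "nl T * (2 * (\<integral>\<^sup>+X. \<integral>\<^sup>+X'. \<Gamma> (sample d X) (sample d' X') \<partial>clocks \<partial>clocks)) =
          (case d of (T, \<rho>, e) \<Rightarrow> case d' of (T', \<rho>', e') \<Rightarrow>
        (\<integral>\<^sup>+v. ?A T \<rho> e T' \<rho>' e' v \<partial>leaf_pmf T) + (\<integral>\<^sup>+v. ?B T \<rho> e T' \<rho>' e' v \<partial>leaf_pmf T))"
        using merge_samples_integral[OF g d[unfolded dT] d'[unfolded dT']]
        by (simp add: dT dT' \<Gamma>_def nn_integral_cmult distrib_left)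
    qed
    finally show ?thesis .
  qed
  have "2 * (\<integral>\<^sup>+y. of_nat (leaf_count y) * gen.step_op gw_environment g y \<partial>gw_environment) =
      (\<integral>\<^sup>+d. 2 * (\<integral>\<^sup>+X. of_nat (leaf_count (sample d X)) * gen.step_op gw_environment g (sample d X) \<partial>clocks) \<partial>decoration_pmf)"
    unfolding gw_environment_integral[OF sm] by (rule nn_integral_cmult[symmetric]) simp
  also have "\<dots> = (\<integral>\<^sup>+d. \<integral>\<^sup>+d'. (case d of (T, \<rho>, e) \<Rightarrow> case d' of (T', \<rho>', e') \<Rightarrow>
        (\<integral>\<^sup>+v. ?A T \<rho> e T' \<rho>' e' v \<partial>leaf_pmf T) + (\<integral>\<^sup>+v. ?B T \<rho> e T' \<rho>' e' v \<partial>leaf_pmf T)) \<partial>decoration_pmf \<partial>decoration_pmf)"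
    by (intro nn_integral_cong_AE AE_pmfI inner) (simp add: set_decoration)
  also have "\<dots> = (\<integral>\<^sup>+T. \<integral>\<^sup>+\<rho>. \<integral>\<^sup>+e. \<integral>\<^sup>+T'. \<integral>\<^sup>+\<rho>'. \<integral>\<^sup>+e'. \<integral>\<^sup>+v. ?A T \<rho> e T' \<rho>' e' v
        \<partial>leaf_pmf T \<partial>choice_pmf T' \<partial>leaf_pmf T' \<partial>gw_pmf \<partial>choice_pmf T \<partial>leaf_pmf T \<partial>gw_pmf) +
      (\<integral>\<^sup>+T. \<integral>\<^sup>+\<rho>. \<integral>\<^sup>+e. \<integral>\<^sup>+T'. \<integral>\<^sup>+\<rho>'. \<integral>\<^sup>+e'. \<integral>\<^sup>+v. ?B T \<rho> e T' \<rho>' e' v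
        \<partial>leaf_pmf T \<partial>choice_pmf T' \<partial>leaf_pmf T' \<partial>gw_pmf \<partial>choice_pmf T \<partial>leaf_pmf T \<partial>gw_pmf)"
    by (simp add: decoration_integral nn_integral_add)
  also have "(\<integral>\<^sup>+T. \<integral>\<^sup>+\<rho>. \<integral>\<^sup>+e. \<integral>\<^sup>+T'. \<integral>\<^sup>+\<rho>'. \<integral>\<^sup>+e'. \<integral>\<^sup>+v. ?A T \<rho> e T' \<rho>' e' v
        \<partial>leaf_pmf T \<partial>choice_pmf T' \<partial>leaf_pmf T' \<partial>gw_pmf \<partial>choice_pmf T \<partial>leaf_pmf T \<partial>gw_pmf) =
      (\<integral>\<^sup>+L. \<integral>\<^sup>+R. left_total g L R \<partial>gw_pmf \<partial>gw_pmf)"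
    unfolding left_total_def by (rule sort_pmf_integrals)
  also have "(\<integral>\<^sup>+T. \<integral>\<^sup>+\<rho>. \<integral>\<^sup>+e. \<integral>\<^sup>+T'. \<integral>\<^sup>+\<rho>'. \<integral>\<^sup>+e'. \<integral>\<^sup>+v. ?B T \<rho> e T' \<rho>' e' v
        \<partial>leaf_pmf T \<partial>choice_pmf T' \<partial>leaf_pmf T' \<partial>gw_pmf \<partial>choice_pmf T \<partial>leaf_pmf T \<partial>gw_pmf) =
      (\<integral>\<^sup>+R. \<integral>\<^sup>+L. right_total g L R \<partial>gw_pmf \<partial>gw_pmf)"
    unfolding right_total_def by (rule sort_pmf_integrals)
  also have "\<dots> = (\<integral>\<^sup>+L. \<integral>\<^sup>+R. right_total g L R \<partial>gw_pmf \<partial>gw_pmf)" by (rule pmf_pmf_swap)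
  finally show "2 * (\<integral>\<^sup>+z. of_nat (leaf_count z) * g z \<partial>gw_environment) = (\<integral>\<^sup>+z. g z \<partial>aged_singleton) +
      2 * (\<integral>\<^sup>+y. of_nat (leaf_count y) * gen.step_op gw_environment g y \<partial>gw_environment)"
    using lhs by (simp only:)
qed

section \<open>Stationary laws are balanced laws\<close>

text \<open>A growth process whose image under \<open>\<kappa>\<close> evolves by merging with samples from \<open>V\<close>. For genealogies
  \<open>\<kappa>\<close> is the identity; for clusters it passes to isomorphism classes, where the process is
  still Markov although a single grafting step is defined on representatives.\<close>

locale lumped_growth =
  G: growth J S upd age sz z0 + M: merging S' sz' \<Xi> \<phi> \<iota>
  for J :: "'j measure" and S :: "'s measure" and upd :: "'j \<Rightarrow> 's \<Rightarrow> 's"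
    and age :: "real \<Rightarrow> 's \<Rightarrow> 's" and sz :: "'s \<Rightarrow> nat" and z0 :: 's
    and S' :: "'o measure" and sz' :: "'o \<Rightarrow> nat" and \<Xi> :: "'x measure"
    and \<phi> :: "'x \<Rightarrow> 'o \<Rightarrow> 'o \<Rightarrow> 'o" and \<iota> :: "'o measure" +
  fixes \<kappa> :: "'s \<Rightarrow> 'o" and V :: "'o measure"
  assumes kappa: "\<kappa> \<in> S \<rightarrow>\<^sub>M S'"
    and V: "law_on S' V"
    and sz_kappa: "z \<in> space S \<Longrightarrow> sz' (\<kappa> z) = sz z"
    and sz_age: "sz (age a z) = sz z"
    and kappa_start: "g \<in> borel_measurable S' \<Longrightarrow>
      (\<integral>\<^sup>+x. g (\<kappa> (age (x / real (sz z0)) z0)) \<partial>exp_clock) = (\<integral>\<^sup>+z. g z \<partial>\<iota>)"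
    and kappa_step: "g \<in> borel_measurable S' \<Longrightarrow> y \<in> space S \<Longrightarrow>
      (\<integral>\<^sup>+j. \<integral>\<^sup>+x. g (\<kappa> (age (x / real (sz (upd j y))) (upd j y))) \<partial>exp_clock \<partial>J) = M.step_op V g (\<kappa> y)"
begin

definition generation :: "nat \<Rightarrow> 'o measure" where
  "generation n = distr G.\<Omega> S' (\<lambda>\<omega>. \<kappa> (G.aged \<omega> n))"

lemma kappa_aged: "(\<lambda>\<omega>. \<kappa> (G.aged \<omega> n)) \<in> G.\<Omega> \<rightarrow>\<^sub>M S'"
  by (rule measurable_compose[OF G.aged_measurable kappa])

lemma generation_integral:
  "g \<in> borel_measurable S' \<Longrightarrow> (\<integral>\<^sup>+z. g z \<partial>generation n) = (\<integral>\<^sup>+\<omega>. g (\<kappa> (G.aged \<omega> n)) \<partial>G.\<Omega>)"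
  unfolding generation_def by (simp add: nn_integral_distr[OF kappa_aged])

lemma measure_eq_by_integrals:
  assumes "sets M = sets S'" "sets N = sets S'"
    and "\<And>g. g \<in> borel_measurable S' \<Longrightarrow> (\<integral>\<^sup>+z. g z \<partial>M) = (\<integral>\<^sup>+z. g z \<partial>N)"
  shows "M = N"
proof (rule measure_eqI)
  show "sets M = sets N" using assms by simp
  fix A assume A: "A \<in> sets M"
  then have "(\<integral>\<^sup>+z. indicator A z \<partial>M) = (\<integral>\<^sup>+z. indicator A z \<partial>N)"
    using assms(1) by (intro assms(3) borel_measurable_indicator) simp
  then show "emeasure M A = emeasure N A" using A assms(1,2) by simp
qed

lemma generations_evolve: "M.evolves V generation"
  unfolding M.evolves_def
proof (intro conjI allI ballI)
  show s: "sets (generation n) = sets S'" for n by (simp add: generation_def)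
  show "generation 0 = \<iota>"
  proof (rule measure_eq_by_integrals[OF s M.sets_iota])
    fix g :: "'o \<Rightarrow> ennreal" assume g: "g \<in> borel_measurable S'"
    show "(\<integral>\<^sup>+z. g z \<partial>generation 0) = (\<integral>\<^sup>+z. g z \<partial>\<iota>)"
      using G.aged_start[OF measurable_compose[OF kappa g]] by (simp add: generation_integral[OF g] kappa_start[OF g])
  qed
  fix n and g :: "'o \<Rightarrow> ennreal" assume g: "g \<in> borel_measurable S'"
  have "(\<integral>\<^sup>+z. g z \<partial>generation (Suc n)) = (\<integral>\<^sup>+\<omega>. M.step_op V g (\<kappa> (G.aged \<omega> n)) \<partial>G.\<Omega>)"
    unfolding generation_integral[OF g] G.aged_step[OF measurable_compose[OF kappa g]]
    by (intro nn_integral_cong kappa_step[OF g] measurable_space[OF G.aged_measurable])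
  also have "\<dots> = (\<integral>\<^sup>+y. M.step_op V g y \<partial>generation n)"
    by (rule generation_integral[symmetric, OF M.step_op_measurable[OF V g]])
  finally show "(\<integral>\<^sup>+z. g z \<partial>generation (Suc n)) = \<dots>" .
qed

lemma sz_aged: "\<omega> \<in> space G.\<Omega> \<Longrightarrow> sz' (\<kappa> (G.aged \<omega> n)) = sz (G.chain z0 \<omega> n)"
  using sz_kappa[OF measurable_space[OF G.aged_measurable]] by (simp add: G.aged_def sz_age)

lemma occupation_generation:
  assumes "g \<in> borel_measurable S'"
  shows "M.occupation generation (\<lambda>z. g z / of_nat (sz' z)) =
    (\<Sum>n. \<integral>\<^sup>+\<omega>. g (\<kappa> (G.aged \<omega> n)) / of_nat (sz (G.chain z0 \<omega> n)) \<partial>G.\<Omega>)"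
  unfolding M.occupation_def generation_integral[OF M.divided_measurable[OF assms]]
  by (intro suminf_cong nn_integral_cong) (simp only: sz_aged)

lemma expected_lifetime_occupation:
  "(\<integral>\<^sup>+\<omega>. G.lifetime \<omega> \<partial>G.\<Omega>) = M.occupation generation (\<lambda>z. 1 / of_nat (sz' z))"
  using occupation_generation[of "\<lambda>_. 1"] by (simp add: G.expected_lifetime)

lemma kappa_present: "(\<lambda>w. \<kappa> (G.present w)) \<in> G.stat \<rightarrow>\<^sub>M S'"
  by (rule measurable_compose[OF G.present_measurable kappa])

text \<open>The laws of the aged states are the generations whose occupation functional appears both in the
  stationary law and in the balance equation.\<close>

theorem stationary_iff_balanced:
  "(\<integral>\<^sup>+\<omega>. G.lifetime \<omega> \<partial>G.\<Omega>) < \<infinity> \<and> distr G.stat S' (\<lambda>w. \<kappa> (G.present w)) = V \<longleftrightarrow> M.balanced 2 V"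
proof
  assume l: "(\<integral>\<^sup>+\<omega>. G.lifetime \<omega> \<partial>G.\<Omega>) < \<infinity> \<and> distr G.stat S' (\<lambda>w. \<kappa> (G.present w)) = V"
  show "M.balanced 2 V"
  proof (rule M.stationary_balanced[OF V generations_evolve, of "\<integral>\<^sup>+\<omega>. G.lifetime \<omega> \<partial>G.\<Omega>"])
    show "(\<integral>\<^sup>+\<omega>. G.lifetime \<omega> \<partial>G.\<Omega>) < \<infinity>" using l ..
    fix g :: "'o \<Rightarrow> ennreal" assume g: "g \<in> borel_measurable S'"
    have "(\<integral>\<^sup>+z. g z \<partial>V) = (\<integral>\<^sup>+z. g z \<partial>distr G.stat S' (\<lambda>w. \<kappa> (G.present w)))" using l by simp
    also have "\<dots> = (\<integral>\<^sup>+w. g (\<kappa> (G.present w)) \<partial>G.stat)"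
      by (rule nn_integral_distr[OF kappa_present]) (simp add: g)
    finally show "(\<integral>\<^sup>+\<omega>. G.lifetime \<omega> \<partial>G.\<Omega>) * (\<integral>\<^sup>+z. g z \<partial>V) = M.occupation generation (\<lambda>z. g z / of_nat (sz' z))"
      using G.present_integral[OF _ measurable_compose[OF kappa g]] l
      by (simp add: occupation_generation[OF g])
  qed
next
  assume bal: "M.balanced 2 V"
  interpret V: prob_space V using V by (simp add: law_on_def)
  have two: "(\<integral>\<^sup>+\<omega>. G.lifetime \<omega> \<partial>G.\<Omega>) = 2"
    using M.balanced_occupation[OF bal generations_evolve, of "\<lambda>_. 1"]
    by (simp add: expected_lifetime_occupation V.emeasure_space_1)
  then have fin: "(\<integral>\<^sup>+\<omega>. G.lifetime \<omega> \<partial>G.\<Omega>) < \<infinity>" by simp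
  have "distr G.stat S' (\<lambda>w. \<kappa> (G.present w)) = V"
  proof (rule measure_eq_by_integrals)
    show "sets V = sets S'" using V by (simp add: law_on_def)
    fix g :: "'o \<Rightarrow> ennreal" assume g: "g \<in> borel_measurable S'"
    have "(\<integral>\<^sup>+z. g z \<partial>distr G.stat S' (\<lambda>w. \<kappa> (G.present w))) = (\<integral>\<^sup>+w. g (\<kappa> (G.present w)) \<partial>G.stat)"
      by (rule nn_integral_distr[OF kappa_present]) (simp add: g)
    moreover have "2 * (\<integral>\<^sup>+w. g (\<kappa> (G.present w)) \<partial>G.stat) = 2 * (\<integral>\<^sup>+z. g z \<partial>V)"
      using G.present_integral[OF fin measurable_compose[OF kappa g]] M.balanced_occupation[OF bal generations_evolve g]
      unfolding two occupation_generation[OF g] by (rule trans)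
    ultimately show "(\<integral>\<^sup>+z. g z \<partial>distr G.stat S' (\<lambda>w. \<kappa> (G.present w))) = (\<integral>\<^sup>+z. g z \<partial>V)"
      by (simp add: ennreal_mult_cancel_left)
  qed simp
  with fin show "(\<integral>\<^sup>+\<omega>. G.lifetime \<omega> \<partial>G.\<Omega>) < \<infinity> \<and> distr G.stat S' (\<lambda>w. \<kappa> (G.present w)) = V" ..
qed

end

section \<open>Genealogies\<close>

definition genealogy_update :: "bool \<times> gstate \<times> (vertex set \<Rightarrow> vertex) \<Rightarrow> gstate \<Rightarrow> gstate" where
  "genealogy_update = (\<lambda>(b, z', p) z. merge b (p (verts (cluster z))) z z')"

lemma merge_noise_integral':
  assumes f: "f \<in> borel_measurable merge_noise"
  shows "(\<integral>\<^sup>+\<xi>. f \<xi> \<partial>merge_noise) = (\<integral>\<^sup>+b. \<integral>\<^sup>+p. \<integral>\<^sup>+x. f (x, b, p) \<partial>exp_clock \<partial>uniform_choices \<partial>coin)"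
proof -
  interpret E: prob_space exp_clock by (rule prob_space_exp_clock)
  interpret U: prob_space uniform_choices by (rule prob_space_uniform_choices)
  interpret CU: pair_prob_space coin uniform_choices ..
  interpret N: pair_prob_space exp_clock "coin \<Otimes>\<^sub>M uniform_choices" ..
  have f': "(\<lambda>(x, w). f (x, w)) \<in> borel_measurable (exp_clock \<Otimes>\<^sub>M coin \<Otimes>\<^sub>M uniform_choices)"
    using f by (simp add: merge_noise_def)
  have f'': "f \<in> borel_measurable (exp_clock \<Otimes>\<^sub>M coin \<Otimes>\<^sub>M uniform_choices)"
    using f by (simp add: merge_noise_def)
  have "(\<lambda>(w, x). f (x, w)) \<in> borel_measurable ((coin \<Otimes>\<^sub>M uniform_choices) \<Otimes>\<^sub>M exp_clock)"
    using measurable_compose[OF measurable_pair_swap' f''] by (simp add: split_beta')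
  from E.borel_measurable_nn_integral[OF this]
  have m: "(\<lambda>w. \<integral>\<^sup>+x. f (x, w) \<partial>exp_clock) \<in> borel_measurable (coin \<Otimes>\<^sub>M uniform_choices)" .
  have "(\<integral>\<^sup>+\<xi>. f \<xi> \<partial>merge_noise) = (\<integral>\<^sup>+w. \<integral>\<^sup>+x. f (x, w) \<partial>exp_clock \<partial>(coin \<Otimes>\<^sub>M uniform_choices))"
    using N.nn_integral_snd[OF f'] unfolding merge_noise_def by simp
  also have "\<dots> = (\<integral>\<^sup>+b. \<integral>\<^sup>+p. \<integral>\<^sup>+x. f (x, b, p) \<partial>exp_clock \<partial>uniform_choices \<partial>coin)"
    by (rule U.nn_integral_fst[OF m, symmetric])
  finally show ?thesis .
qed

text \<open>The order in which clock, side, sample and choice are drawn differs between the growth process and the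
  merging step; Fubini identifies them.\<close>

lemma genealogy_lumped_growth:
  assumes V: "law_on gen_space V"
  shows "lumped_growth (coin \<Otimes>\<^sub>M V \<Otimes>\<^sub>M uniform_choices) gen_space genealogy_update age leaf_count singleton_state
    gen_space leaf_count merge_noise aged_merge aged_singleton (\<lambda>z. z) V"
proof (rule lumped_growth.intro)
  interpret V: prob_space V using V by (simp add: law_on_def)
  interpret E: prob_space exp_clock by (rule prob_space_exp_clock)
  interpret U: prob_space uniform_choices by (rule prob_space_uniform_choices)
  interpret VU: pair_prob_space V uniform_choices ..
  interpret J: pair_prob_space coin "V \<Otimes>\<^sub>M uniform_choices" ..
  have sV: "sets V = sets gen_space" using V by (simp add: law_on_def)
  let ?J = "coin \<Otimes>\<^sub>M V \<Otimes>\<^sub>M uniform_choices"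
  have upd: "(\<lambda>(j, z). genealogy_update j z) \<in> ?J \<Otimes>\<^sub>M gen_space \<rightarrow>\<^sub>M gen_space"
  proof -
    have "(\<lambda>w. merge (fst (fst w)) (snd (snd (fst w)) (verts (cluster (snd w)))) (snd w) (fst (snd (fst w)))) \<in> ?J \<Otimes>\<^sub>M gen_space \<rightarrow>\<^sub>M gen_space"
    proof (rule choice_merge_measurable)
      show "(\<lambda>w. fst (fst w)) \<in> ?J \<Otimes>\<^sub>M gen_space \<rightarrow>\<^sub>M coin"
        by (rule measurable_compose[OF measurable_fst measurable_fst])
      show "(\<lambda>w. snd (snd (fst w))) \<in> ?J \<Otimes>\<^sub>M gen_space \<rightarrow>\<^sub>M uniform_choices"
        by (rule measurable_compose[OF measurable_compose[OF measurable_fst measurable_snd] measurable_snd])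
      have "(\<lambda>w. fst (snd (fst w))) \<in> ?J \<Otimes>\<^sub>M gen_space \<rightarrow>\<^sub>M V"
        by (rule measurable_compose[OF measurable_compose[OF measurable_fst measurable_snd] measurable_fst])
      then show "(\<lambda>w. fst (snd (fst w))) \<in> ?J \<Otimes>\<^sub>M gen_space \<rightarrow>\<^sub>M gen_space"
        by (simp add: measurable_cong_sets[OF refl sV])
    qed (rule measurable_snd)
    then show ?thesis by (simp add: genealogy_update_def split_beta')
  qed
  show growth: "growth ?J gen_space genealogy_update age leaf_count singleton_state"
    by (rule growth.intro[OF J.prob_space_axioms upd age_measurable_gen leaf_count_measurable])
       (simp_all add: space_gen leaf_count_pos singleton_state_T_gen)
  show "merging gen_space leaf_count merge_noise aged_merge aged_singleton" by (rule gen.merging_axioms)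
  show "lumped_growth_axioms ?J gen_space genealogy_update age leaf_count singleton_state
    gen_space leaf_count merge_noise aged_merge aged_singleton (\<lambda>z. z) V"
  proof (rule lumped_growth_axioms.intro)
    show "law_on gen_space V" by (rule V)
    fix g :: "gstate \<Rightarrow> ennreal" assume g: "g \<in> borel_measurable gen_space"
    show "(\<integral>\<^sup>+x. g (age (x / real (leaf_count singleton_state)) singleton_state) \<partial>exp_clock) = (\<integral>\<^sup>+z. g z \<partial>aged_singleton)"
      by (simp add: aged_singleton_integral[OF g])
    fix y assume y: "y \<in> space gen_space"
    define h where "h j x = g (age (x / real (leaf_count (genealogy_update j y))) (genealogy_update j y))" for j x
    have hx: "(\<lambda>(j, x). h j x) \<in> borel_measurable (?J \<Otimes>\<^sub>M exp_clock)"
    proof -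
      have "(\<lambda>w. genealogy_update (fst w) y) \<in> ?J \<Otimes>\<^sub>M exp_clock \<rightarrow>\<^sub>M gen_space"
        using measurable_compose[OF measurable_Pair[OF measurable_fst measurable_const[OF y]] upd] by simp
      from measurable_compose[OF age_by_clock_measurable[OF measurable_snd this] g]
      show ?thesis by (simp add: h_def split_beta')
    qed
    define H where "H j = (\<integral>\<^sup>+x. h j x \<partial>exp_clock)" for j
    have H: "H \<in> borel_measurable ?J" unfolding H_def by (rule E.borel_measurable_nn_integral[OF hx])
    have Hb: "(\<lambda>(z, p). H (b, z, p)) \<in> borel_measurable (V \<Otimes>\<^sub>M uniform_choices)" for b
      using measurable_compose[OF measurable_Pair1'[of b coin] H] by simp
    have "(\<integral>\<^sup>+j. H j \<partial>?J) = (\<integral>\<^sup>+b. \<integral>\<^sup>+z. \<integral>\<^sup>+p. H (b, z, p) \<partial>uniform_choices \<partial>V \<partial>coin)"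
    proof -
      have "(\<integral>\<^sup>+j. H j \<partial>?J) = (\<integral>\<^sup>+b. \<integral>\<^sup>+w. H (b, w) \<partial>(V \<Otimes>\<^sub>M uniform_choices) \<partial>coin)"
        by (rule VU.nn_integral_fst[OF H, symmetric])
      also have "\<dots> = (\<integral>\<^sup>+b. \<integral>\<^sup>+z. \<integral>\<^sup>+p. H (b, z, p) \<partial>uniform_choices \<partial>V \<partial>coin)"
        using U.nn_integral_fst[of "\<lambda>w. H (b, w)" V for b] Hb by (intro nn_integral_cong) (simp add: split_beta')
      finally show ?thesis .
    qed
    also have "\<dots> = (\<integral>\<^sup>+z. \<integral>\<^sup>+b. \<integral>\<^sup>+p. H (b, z, p) \<partial>uniform_choices \<partial>coin \<partial>V)"
      by (rule pmf_integral_swap[symmetric]) (rule U.borel_measurable_nn_integral[OF Hb])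
    also have "\<dots> = gen.step_op V g y"
      unfolding gen.step_op_def
    proof (rule nn_integral_cong)
      fix z assume "z \<in> space V"
      then have z: "z \<in> space gen_space" using sets_eq_imp_space_eq[OF sV] by simp
      have "(\<lambda>\<xi>. g (aged_merge \<xi> y z)) \<in> borel_measurable merge_noise"
        using y z by (intro measurable_compose[OF gen.phi_measurable' g]) auto
      from merge_noise_integral'[OF this]
      show "(\<integral>\<^sup>+b. \<integral>\<^sup>+p. H (b, z, p) \<partial>uniform_choices \<partial>coin) = (\<integral>\<^sup>+\<xi>. g (aged_merge \<xi> y z) \<partial>merge_noise)"
        by (simp add: H_def h_def aged_merge_def genealogy_update_def Let_def)
    qed
    finally show "(\<integral>\<^sup>+j. \<integral>\<^sup>+x. g (age (x / real (leaf_count (genealogy_update j y))) (genealogy_update j y)) \<partial>exp_clock \<partial>?J) = gen.step_op V g y"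
      by (simp add: H_def h_def)
  qed simp_all
qed

theorem steady_environment_iff_balanced: "steady_environment V \<longleftrightarrow> gen.balanced 2 V"
proof -
  have "steady_environment V \<longleftrightarrow> gen.balanced 2 V" if V: "law_on gen_space V"
  proof -
    interpret lumped_growth "coin \<Otimes>\<^sub>M V \<Otimes>\<^sub>M uniform_choices" gen_space genealogy_update age leaf_count singleton_state
      gen_space leaf_count merge_noise aged_merge aged_singleton "\<lambda>z. z" V
      by (rule genealogy_lumped_growth[OF V])
    have space: "genealogy_space V = G.\<Omega>" by (simp add: genealogy_space_def G.\<Omega>_def)
    have chain: "genealogy_chain \<omega> n = G.chain singleton_state \<omega> n" for \<omega> n
    proof (induction n)
      case (Suc n)
      have "genealogy_chain \<omega> (Suc n) = genealogy_update (snd (\<omega> n))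
          (age (fst (\<omega> n) / real (leaf_count (genealogy_chain \<omega> n))) (genealogy_chain \<omega> n))"
        by (simp add: genealogy_update_def leaf_count_def split_beta Let_def)
      then show ?case by (simp only: Suc G.chain.simps)
    qed simp
    have wait: "genealogy_wait = G.wait"
    proof (intro ext)
      fix \<omega> n
      have "genealogy_wait \<omega> n = fst (\<omega> n) / real (leaf_count (genealogy_chain \<omega> n))"
        by (simp add: genealogy_wait_def leaf_count_def)
      then show "genealogy_wait \<omega> n = G.wait \<omega> n" by (simp only: chain G.wait_def)
    qed
    have life: "genealogy_lifetime = G.lifetime"
      by (simp add: fun_eq_iff genealogy_lifetime_def G.lifetime_def wait)
    have path: "genealogy_process = G.path"
      by (simp add: fun_eq_iff genealogy_process_def G.path_def life wait chain)
    show ?thesis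
      unfolding steady_environment_def space life path using stationary_iff_balanced V by simp
  qed
  then show ?thesis using gen.balanced_law by (auto simp: steady_environment_def)
qed

section \<open>Clusters up to isomorphism\<close>

abbreviation classes :: "rgraph set measure" where "classes \<equiv> count_space iso_classes"

definition class_size :: "rgraph set \<Rightarrow> nat" where
  "class_size c = card (verts (repr c))"

definition class_graft :: "(vertex set \<Rightarrow> vertex) \<Rightarrow> rgraph set \<Rightarrow> rgraph set \<Rightarrow> rgraph set" where
  "class_graft p c c' = iso_class (graft False (p (verts (repr c))) (repr c) (repr c'))"

definition singleton_class :: "rgraph set measure" where
  "singleton_class = return classes (iso_class singleton_graph)"

lemma countable_iso_classes: "countable iso_classes"
  unfolding iso_classes_def by (intro countable_image countable_rooted_graphs)

lemma rooted_graph_verts: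
  assumes "rooted_graph g" shows "finite (verts g)" "verts g \<noteq> {}"
  using assms by (auto simp: rooted_graph_def)

lemma iso_class_in [intro]: "rooted_graph g \<Longrightarrow> iso_class g \<in> iso_classes"
  by (auto simp: iso_classes_def)

lemma rooted_graph_repr: "c \<in> iso_classes \<Longrightarrow> rooted_graph (repr c)"
  unfolding iso_classes_def by (elim imageE) (simp add: repr_iso_class)


lemma class_size_iso_class: "rooted_graph g \<Longrightarrow> class_size (iso_class g) = card (verts g)"
  unfolding class_size_def by (rule rooted_iso_card[symmetric]) (rule repr_iso_class(2))

lemma rooted_graph_singleton: "rooted_graph singleton_graph"
  using rooted_tree_singleton by (simp add: rooted_tree_def)

lemma choose_vert: "p \<in> space uniform_choices \<Longrightarrow> rooted_graph g \<Longrightarrow> p (verts g) \<in> verts g"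
  by (intro chosen_in rooted_graph_verts)

lemma verts_repr_measurable:
  assumes "c \<in> N \<rightarrow>\<^sub>M classes"
  shows "(\<lambda>x. verts (repr (c x))) \<in> N \<rightarrow>\<^sub>M count_space {A. finite A \<and> A \<noteq> {}}"
  by (rule discrete_compose[OF assms]) (simp add: rooted_graph_verts rooted_graph_repr)

lemma class_graft_measurable:
  "(\<lambda>(p, c, c'). class_graft p c c') \<in> uniform_choices \<Otimes>\<^sub>M classes \<Otimes>\<^sub>M classes \<rightarrow>\<^sub>M classes"
proof -
  let ?N = "uniform_choices \<Otimes>\<^sub>M classes \<Otimes>\<^sub>M classes"
  have c: "(\<lambda>w. fst (snd w)) \<in> ?N \<rightarrow>\<^sub>M classes" "(\<lambda>w. snd (snd w)) \<in> ?N \<rightarrow>\<^sub>M classes"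
    by measurable
  have v: "(\<lambda>w. fst w (verts (repr (fst (snd w))))) \<in> ?N \<rightarrow>\<^sub>M count_space UNIV"
    by (rule choice_measurable[OF measurable_fst verts_repr_measurable[OF c(1)]])
  have "(\<lambda>w. (\<lambda>(u, c, c'). if u \<in> verts (repr c) then iso_class (graft False u (repr c) (repr c')) else c)
      (fst w (verts (repr (fst (snd w)))), fst (snd w), snd (snd w))) \<in> ?N \<rightarrow>\<^sub>M classes"
    by (rule discrete_compose[OF discrete_pair[OF v discrete_pair[OF c]]])
       (auto simp: countable_iso_classes countable_SIGMA rooted_graph_repr intro!: iso_class_in rooted_graph_graft)
  also have "?this \<longleftrightarrow> ?thesis"
  proof (rule measurable_cong)
    fix w assume "w \<in> space ?N"
    then have "fst w \<in> space uniform_choices" "rooted_graph (repr (fst (snd w)))"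
      by (simp_all add: space_pair_measure mem_Times_iff rooted_graph_repr)
    then have "fst w (verts (repr (fst (snd w)))) \<in> verts (repr (fst (snd w)))"
      by (rule choose_vert)
    then show "(\<lambda>(u, c, c'). if u \<in> verts (repr c) then iso_class (graft False u (repr c) (repr c')) else c)
      (fst w (verts (repr (fst (snd w)))), fst (snd w), snd (snd w)) = (case w of (p, c, c') \<Rightarrow> class_graft p c c')"
      by (simp add: class_graft_def split_beta)
  qed
  finally show ?thesis .
qed

interpretation cls: merging classes class_size uniform_choices class_graft singleton_class
proof (rule merging.intro)
  show "prob_space uniform_choices" by (rule prob_space_uniform_choices)
  show "(\<lambda>(p, c, c'). class_graft p c c') \<in> uniform_choices \<Otimes>\<^sub>M classes \<Otimes>\<^sub>M classes \<rightarrow>\<^sub>M classes"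
    by (rule class_graft_measurable)
  show "class_size \<in> classes \<rightarrow>\<^sub>M count_space UNIV" by simp
  show "0 < class_size c" if "c \<in> space classes" for c
    using that rooted_graph_verts[OF rooted_graph_repr] by (simp add: class_size_def card_gt_0_iff)
  show "class_size (class_graft p c c') = class_size c + class_size c'"
    if "p \<in> space uniform_choices" "c \<in> space classes" "c' \<in> space classes" for p c c'
  proof -
    have r: "rooted_graph (repr c)" "rooted_graph (repr c')" using that by (simp_all add: rooted_graph_repr)
    then have "rooted_graph (graft False (p (verts (repr c))) (repr c) (repr c'))"
      by (intro rooted_graph_graft choose_vert that(1))
    then show ?thesis using r
      by (simp only: class_graft_def class_size_iso_class card_verts_graft rooted_graph_verts) (simp add: class_size_def)
  qed
  have s: "iso_class singleton_graph \<in> space classes" using rooted_graph_singleton by auto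
  show "prob_space singleton_class" unfolding singleton_class_def by (rule prob_space_return[OF s])
  show "sets singleton_class = sets classes" by (simp add: singleton_class_def)
  have "class_size (iso_class singleton_graph) = 1"
    by (simp add: class_size_iso_class[OF rooted_graph_singleton]) (simp add: singleton_graph_def)
  then show "AE c in singleton_class. class_size c = 1"
    unfolding singleton_class_def using s by (subst AE_return) auto
qed

lemma singleton_class_integral: "(\<integral>\<^sup>+c. g c \<partial>singleton_class) = g (iso_class singleton_graph)"
  unfolding singleton_class_def by (simp add: nn_integral_return iso_class_in rooted_graph_singleton)

text \<open>The isomorphism class of a uniform grafting depends on the two graphs only through their classes,
  because an isomorphism carries the uniform vertex to the uniform vertex.\<close>

lemma graft_class_integral:
  fixes f :: "rgraph set \<Rightarrow> ennreal"
  assumes g: "rooted_graph g" "rooted_graph g'" and h: "rooted_graph h" "rooted_graph h'"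
    and gg: "rooted_iso g g'" and hh: "rooted_iso h h'"
  shows "(\<integral>\<^sup>+p. f (iso_class (graft b (p (verts g)) g h)) \<partial>uniform_choices) =
    (\<integral>\<^sup>+p. f (iso_class (graft b' (p (verts g')) g' h')) \<partial>uniform_choices)"
proof -
  note fin = rooted_graph_verts[OF g(1)] rooted_graph_verts[OF g(2)]
  obtain k where k: "bij_betw k (verts g) (verts g')" "(`) k ` edges g = edges g'" "k (root_of g) = root_of g'"
    using gg unfolding rooted_iso_def by blast
  have "(\<integral>\<^sup>+p. f (iso_class (graft b' (p (verts g')) g' h')) \<partial>uniform_choices) =
      (\<integral>\<^sup>+v. f (iso_class (graft b' v g' h')) \<partial>map_pmf k (pmf_of_set (verts g)))"
    using uniform_choice_integral[OF fin(3,4), of "\<lambda>v. f (iso_class (graft b' v g' h'))"]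
    by (simp only: map_pmf_of_set_bij_betw[OF k(1) fin(2,1)])
  also have "\<dots> = (\<integral>\<^sup>+v. f (iso_class (graft b' (k v) g' h')) \<partial>pmf_of_set (verts g))" by simp
  also have "\<dots> = (\<integral>\<^sup>+v. f (iso_class (graft b v g h)) \<partial>pmf_of_set (verts g))"
  proof (rule nn_integral_cong_AE, rule AE_pmfI)
    fix v assume "v \<in> set_pmf (pmf_of_set (verts g))"
    then have v: "v \<in> verts g" using fin by simp
    then have "k v \<in> verts g'" using bij_betwE[OF k(1)] by blast
    then have "iso_class (graft b v g h) = iso_class (graft b' (k v) g' h')"
      using rooted_iso_graft[OF g(1) h(1) v k hh, of b b']
      by (subst iso_class_eq_iff) (use v g h in \<open>auto intro!: rooted_graph_graft\<close>)
    then show "f (iso_class (graft b' (k v) g' h')) = f (iso_class (graft b v g h))" by simp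
  qed
  also have "\<dots> = (\<integral>\<^sup>+p. f (iso_class (graft b (p (verts g)) g h)) \<partial>uniform_choices)"
    by (rule uniform_choice_integral[symmetric, OF fin(1,2)])
  finally show ?thesis by simp
qed

definition cluster_update :: "rgraph set \<times> (vertex set \<Rightarrow> vertex) \<Rightarrow> rgraph \<Rightarrow> rgraph" where
  "cluster_update = (\<lambda>(c, p) z. graft False (p (verts z)) z (repr c))"

abbreviation graphs :: "rgraph measure" where "graphs \<equiv> count_space {g. rooted_graph g}"

lemma cluster_lumped_growth:
  assumes W: "law_on classes W"
  shows "lumped_growth (W \<Otimes>\<^sub>M uniform_choices) graphs cluster_update (\<lambda>_ z. z) (\<lambda>z. card (verts z)) singleton_graph
    classes class_size uniform_choices class_graft singleton_class iso_class W"
proof (rule lumped_growth.intro)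
  interpret W: prob_space W using W by (simp add: law_on_def)
  interpret E: prob_space exp_clock by (rule prob_space_exp_clock)
  interpret U: prob_space uniform_choices by (rule prob_space_uniform_choices)
  interpret J: pair_prob_space W uniform_choices ..
  have sW: "sets W = sets classes" using W by (simp add: law_on_def)
  have spW: "space W = iso_classes" using sets_eq_imp_space_eq[OF sW] by simp
  let ?J = "W \<Otimes>\<^sub>M uniform_choices"
  have upd: "(\<lambda>(j, z). cluster_update j z) \<in> ?J \<Otimes>\<^sub>M graphs \<rightarrow>\<^sub>M graphs"
  proof -
    let ?N = "?J \<Otimes>\<^sub>M graphs"
    have "(\<lambda>w. fst (fst w)) \<in> ?N \<rightarrow>\<^sub>M W" by (rule measurable_compose[OF measurable_fst measurable_fst])
    then have c: "(\<lambda>w. fst (fst w)) \<in> ?N \<rightarrow>\<^sub>M classes" by (simp add: measurable_cong_sets[OF refl sW])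
    have p: "(\<lambda>w. snd (fst w)) \<in> ?N \<rightarrow>\<^sub>M uniform_choices" by (rule measurable_compose[OF measurable_fst measurable_snd])
    have vz: "(\<lambda>w. verts (snd w)) \<in> ?N \<rightarrow>\<^sub>M count_space {A. finite A \<and> A \<noteq> {}}"
      by (rule discrete_compose[OF measurable_snd]) (use rooted_graph_verts in blast)
    have v: "(\<lambda>w. snd (fst w) (verts (snd w))) \<in> ?N \<rightarrow>\<^sub>M count_space UNIV"
      by (rule choice_measurable[OF p vz])
    have "(\<lambda>w. (\<lambda>(u, c, z). if u \<in> verts z then graft False u z (repr c) else z) (snd (fst w) (verts (snd w)), fst (fst w), snd w)) \<in> ?N \<rightarrow>\<^sub>M graphs"
      by (rule discrete_compose[OF discrete_pair[OF v discrete_pair[OF c measurable_snd]]])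
         (auto simp: countable_iso_classes countable_rooted_graphs countable_SIGMA rooted_graph_repr intro!: rooted_graph_graft)
    also have "?this \<longleftrightarrow> ?thesis"
    proof (rule measurable_cong)
      fix w assume "w \<in> space ?N"
      then have "snd (fst w) \<in> space uniform_choices" "rooted_graph (snd w)"
        by (simp_all add: space_pair_measure mem_Times_iff)
      then have "snd (fst w) (verts (snd w)) \<in> verts (snd w)"
        by (rule choose_vert)
      then show "(\<lambda>(u, c, z). if u \<in> verts z then graft False u z (repr c) else z) (snd (fst w) (verts (snd w)), fst (fst w), snd w) =
          (case w of (j, z) \<Rightarrow> cluster_update j z)"
        by (simp add: cluster_update_def split_beta)
    qed
    finally show ?thesis .
  qed
  show "growth ?J graphs cluster_update (\<lambda>_ z. z) (\<lambda>z. card (verts z)) singleton_graph"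
  proof (rule growth.intro[OF J.prob_space_axioms upd])
    show "(\<lambda>(a::real, z). z) \<in> restrict_space borel {0..} \<Otimes>\<^sub>M graphs \<rightarrow>\<^sub>M graphs"
      using measurable_snd[of "restrict_space borel {0::real..}" graphs] by (simp add: split_beta')
  qed (simp_all add: rooted_graph_verts card_gt_0_iff rooted_graph_singleton)
  show "merging classes class_size uniform_choices class_graft singleton_class" by (rule cls.merging_axioms)
  show "lumped_growth_axioms ?J graphs cluster_update (\<lambda>_ z. z) (\<lambda>z. card (verts z)) singleton_graph
    classes class_size uniform_choices class_graft singleton_class iso_class W"
  proof (rule lumped_growth_axioms.intro)
    show "iso_class \<in> graphs \<rightarrow>\<^sub>M classes" by auto
    show "law_on classes W" by (rule W)
    show "class_size (iso_class z) = card (verts z)" if "z \<in> space graphs" for z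
      using that by (simp add: class_size_iso_class)
    fix g :: "rgraph set \<Rightarrow> ennreal" assume g: "g \<in> borel_measurable classes"
    show "(\<integral>\<^sup>+x. g (iso_class singleton_graph) \<partial>exp_clock) = (\<integral>\<^sup>+z. g z \<partial>singleton_class)"
      by (simp add: singleton_class_integral E.emeasure_space_1)
    fix y assume "y \<in> space graphs"
    then have y: "rooted_graph y" by simp
    have "(\<lambda>j. cluster_update j y) \<in> ?J \<rightarrow>\<^sub>M graphs"
      using measurable_compose[OF measurable_Pair2'[of y graphs] upd] y by simp
    then have m: "(\<lambda>j. g (iso_class (cluster_update j y))) \<in> borel_measurable ?J"
      by (rule measurable_compose) (rule measurable_compose[OF _ g], auto)
    have "(\<integral>\<^sup>+j. \<integral>\<^sup>+x. g (iso_class (cluster_update j y)) \<partial>exp_clock \<partial>?J) = (\<integral>\<^sup>+j. g (iso_class (cluster_update j y)) \<partial>?J)"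
      by (simp add: E.emeasure_space_1)
    also have "\<dots> = (\<integral>\<^sup>+c. \<integral>\<^sup>+p. g (iso_class (graft False (p (verts y)) y (repr c))) \<partial>uniform_choices \<partial>W)"
      using U.nn_integral_fst[OF m] by (simp add: cluster_update_def)
    also have "\<dots> = cls.step_op W g (iso_class y)"
      unfolding cls.step_op_def class_graft_def
    proof (rule nn_integral_cong)
      fix c assume "c \<in> space W"
      then have "rooted_graph (repr c)" by (simp add: spW rooted_graph_repr)
      then show "(\<integral>\<^sup>+p. g (iso_class (graft False (p (verts y)) y (repr c))) \<partial>uniform_choices) =
         (\<integral>\<^sup>+p. g (iso_class (graft False (p (verts (repr (iso_class y)))) (repr (iso_class y)) (repr c))) \<partial>uniform_choices)"
        using y by (intro graft_class_integral repr_iso_class rooted_iso_refl)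
    qed
    finally show "(\<integral>\<^sup>+j. \<integral>\<^sup>+x. g (iso_class (cluster_update j y)) \<partial>exp_clock \<partial>?J) = cls.step_op W g (iso_class y)" .
  qed simp
qed

theorem steady_state_cluster_iff_balanced: "steady_state_cluster_law W \<longleftrightarrow> cls.balanced 2 W"
proof -
  have "steady_state_cluster_law W \<longleftrightarrow> cls.balanced 2 W" if W: "law_on classes W"
  proof -
    interpret lumped_growth "W \<Otimes>\<^sub>M uniform_choices" graphs cluster_update "\<lambda>_ z. z" "\<lambda>z. card (verts z)" singleton_graph
      classes class_size uniform_choices class_graft singleton_class iso_class W
      by (rule cluster_lumped_growth[OF W])
    have space: "cluster_space W = G.\<Omega>" by (simp add: cluster_space_def G.\<Omega>_def)
    have chain: "cluster_chain \<omega> n = G.chain singleton_graph \<omega> n" for \<omega> n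
    proof (induction n)
      case (Suc n)
      have "cluster_chain \<omega> (Suc n) = cluster_update (snd (\<omega> n)) (cluster_chain \<omega> n)"
        by (simp add: cluster_update_def split_beta)
      then show ?case by (simp only: Suc G.chain.simps)
    qed simp
    have wait: "cluster_wait = G.wait"
      by (intro ext) (simp only: cluster_wait_def G.wait_def chain)
    have life: "cluster_lifetime = G.lifetime"
      by (intro ext) (simp only: cluster_lifetime_def G.lifetime_def wait)
    have path: "cluster_process = G.path"
      by (intro ext) (simp only: cluster_process_def G.path_def life wait chain Let_def)
    show ?thesis
      unfolding steady_state_cluster_law_def space life path
      using stationary_iff_balanced W G.AE_lifetime_finite by blast
  qed
  then show ?thesis using cls.balanced_law by (auto simp: steady_state_cluster_law_def)
qed

text \<open>Forgetting the genealogy turns the balance equation for environments into that for clusters.\<close>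

definition cluster_class :: "gstate \<Rightarrow> rgraph set" where
  "cluster_class z = iso_class (cluster z)"

lemma rooted_graph_cluster: "z \<in> T_gen \<Longrightarrow> rooted_graph (cluster z)"
  using T_genD(4) by (simp add: rooted_tree_def)

lemma cluster_class_measurable: "cluster_class \<in> gen_space \<rightarrow>\<^sub>M classes"
  unfolding cluster_class_def[abs_def]
  by (rule discrete_part_measurable[where F = "\<lambda>T C. iso_class C"]) (simp add: rooted_graph_cluster iso_class_in)

lemma class_size_cluster_class: "z \<in> T_gen \<Longrightarrow> class_size (cluster_class z) = leaf_count z"
  by (simp add: cluster_class_def class_size_iso_class rooted_graph_cluster T_genD leaf_count_def)

theorem balanced_clusters:
  assumes bal: "gen.balanced 2 V"
  shows "cls.balanced 2 (distr V classes cluster_class)"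
proof -
  have V: "law_on gen_space V" by (rule gen.balanced_law[OF bal])
  interpret V: prob_space V using V by (simp add: law_on_def)
  interpret E: prob_space exp_clock by (rule prob_space_exp_clock)
  have sV: "sets V = sets gen_space" using V by (simp add: law_on_def)
  have spV: "space V = T_gen" using sets_eq_imp_space_eq[OF sV] by (simp add: space_gen)
  let ?W = "distr V classes cluster_class"
  have cm: "cluster_class \<in> V \<rightarrow>\<^sub>M classes"
    using cluster_class_measurable by (simp add: measurable_cong_sets[OF sV refl])
  have W: "law_on classes ?W" by (simp add: law_on_def V.prob_space_distr[OF cm])
  have int: "(\<integral>\<^sup>+c. f c \<partial>?W) = (\<integral>\<^sup>+z. f (cluster_class z) \<partial>V)" for f :: "rgraph set \<Rightarrow> ennreal"
    by (rule nn_integral_distr[OF cm]) simp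
  show ?thesis
    unfolding cls.balanced_def
  proof (intro conjI ballI W)
    fix g :: "rgraph set \<Rightarrow> ennreal" assume "g \<in> borel_measurable classes"
    then have gc: "(\<lambda>z. g (cluster_class z)) \<in> borel_measurable gen_space"
      by (rule measurable_compose[OF cluster_class_measurable])
    have start: "(\<integral>\<^sup>+z. g (cluster_class z) \<partial>aged_singleton) = (\<integral>\<^sup>+c. g c \<partial>singleton_class)"
      unfolding aged_singleton_integral[OF gc] singleton_class_integral
      by (simp add: cluster_class_def singleton_state_def E.emeasure_space_1)
    have step: "gen.step_op V (\<lambda>z. g (cluster_class z)) y = cls.step_op ?W g (cluster_class y)" if y: "y \<in> T_gen" for y
      unfolding gen.step_op_def cls.step_op_def int
    proof (rule nn_integral_cong)
      fix z assume "z \<in> space V"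
      then have z: "z \<in> T_gen" by (simp add: spV)
      have "(\<lambda>\<xi>. g (cluster_class (aged_merge \<xi> y z))) \<in> borel_measurable merge_noise"
        using y z by (intro measurable_compose[OF gen.phi_measurable' gc]) (auto simp: space_gen)
      from merge_noise_integral'[OF this]
      have "(\<integral>\<^sup>+\<xi>. g (cluster_class (aged_merge \<xi> y z)) \<partial>merge_noise) =
        (\<integral>\<^sup>+b. \<integral>\<^sup>+p. g (iso_class (graft b (p (verts (cluster y))) (cluster y) (cluster z))) \<partial>uniform_choices \<partial>coin)"
        by (simp add: aged_merge_def Let_def cluster_class_def E.emeasure_space_1)
      also have "\<dots> = (\<integral>\<^sup>+b. \<integral>\<^sup>+p. g (class_graft p (cluster_class y) (cluster_class z)) \<partial>uniform_choices \<partial>coin)"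
        unfolding class_graft_def cluster_class_def using rooted_graph_cluster[OF y] rooted_graph_cluster[OF z]
        by (intro nn_integral_cong graft_class_integral repr_iso_class)
      also have "\<dots> = (\<integral>\<^sup>+p. g (class_graft p (cluster_class y) (cluster_class z)) \<partial>uniform_choices)"
        by (simp add: measure_pmf.emeasure_space_1)
      finally show "(\<integral>\<^sup>+\<xi>. g (cluster_class (aged_merge \<xi> y z)) \<partial>merge_noise) = \<dots>" .
    qed
    have "2 * (\<integral>\<^sup>+c. of_nat (class_size c) * g c \<partial>?W) = 2 * (\<integral>\<^sup>+z. of_nat (leaf_count z) * g (cluster_class z) \<partial>V)"
      unfolding int by (intro arg_cong[where f = "\<lambda>a. 2 * a"] nn_integral_cong) (simp add: spV class_size_cluster_class)
    also have "\<dots> = (\<integral>\<^sup>+z. g (cluster_class z) \<partial>aged_singleton) +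
        2 * (\<integral>\<^sup>+y. of_nat (leaf_count y) * gen.step_op V (\<lambda>z. g (cluster_class z)) y \<partial>V)"
      by (rule gen.balanced_eq[OF bal gc])
    also have "(\<integral>\<^sup>+y. of_nat (leaf_count y) * gen.step_op V (\<lambda>z. g (cluster_class z)) y \<partial>V) =
        (\<integral>\<^sup>+c. of_nat (class_size c) * cls.step_op ?W g c \<partial>?W)"
      unfolding int by (intro nn_integral_cong) (simp add: spV class_size_cluster_class step)
    finally show "2 * (\<integral>\<^sup>+c. of_nat (class_size c) * g c \<partial>?W) = (\<integral>\<^sup>+c. g c \<partial>singleton_class) +
        2 * (\<integral>\<^sup>+c. of_nat (class_size c) * cls.step_op ?W g c \<partial>?W)"
      by (simp only: start)
  qed
qed

lemma balanced_cluster_law_is_W0: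
  assumes "gen.balanced 2 V" shows "distr V classes cluster_class = W0"
  unfolding W0_def
proof (rule the_equality[symmetric])
  show "steady_state_cluster_law (distr V classes cluster_class)"
    using balanced_clusters[OF assms] by (simp only: steady_state_cluster_iff_balanced)
  show "W = distr V classes cluster_class" if "steady_state_cluster_law W" for W
    using that balanced_clusters[OF assms] cls.balanced_unique unfolding steady_state_cluster_iff_balanced by blast
qed

section \<open>The genealogy and the cluster of the stationary environment\<close>

lemma sets_gw_environment: "sets gw_environment = sets gen_space"
  and space_gw_environment: "space gw_environment = T_gen"
proof -
  show s: "sets gw_environment = sets gen_space"
    using gw_environment_law by (simp add: law_on_def)
  show "space gw_environment = T_gen"
    using sets_eq_imp_space_eq[OF s] by (simp add: space_gen)
qed

lemma measurable_gw_environment: "f \<in> gen_space \<rightarrow>\<^sub>M N \<Longrightarrow> f \<in> gw_environment \<rightarrow>\<^sub>M N"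
  by (simp add: measurable_cong_sets[OF sets_gw_environment refl])

lemma gw_environment_emeasure:
  assumes "{z \<in> T_gen. P z} \<in> sets gen_space"
  shows "emeasure gw_environment {z \<in> space gw_environment. P z} =
    (\<integral>\<^sup>+d. \<integral>\<^sup>+X. of_bool (P (sample d X)) \<partial>clocks \<partial>decoration_pmf)"
proof -
  have "emeasure gw_environment {z \<in> space gw_environment. P z} = (\<integral>\<^sup>+z. indicator {z \<in> T_gen. P z} z \<partial>gw_environment)"
    using assms by (simp add: space_gw_environment sets_gw_environment)
  also have "\<dots> = (\<integral>\<^sup>+d. \<integral>\<^sup>+X. indicator {z \<in> T_gen. P z} (sample d X) \<partial>clocks \<partial>decoration_pmf)"
    using assms by (intro gw_environment_integral borel_measurable_indicator)
  also have "\<dots> = (\<integral>\<^sup>+d. \<integral>\<^sup>+X. of_bool (P (sample d X)) \<partial>clocks \<partial>decoration_pmf)"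
    by (intro nn_integral_cong_AE AE_pmfI nn_integral_cong)
       (simp add: set_decoration sample_T_gen indicator_def)
  finally show ?thesis .
qed

lemma shape_law:
  assumes "plane_tree T"
  shows "measure gw_environment {z \<in> space gw_environment. shape z = T} = gw_prob T"
proof -
  interpret C: prob_space clocks by (rule prob_space_clocks)
  have "shape -` {T} \<inter> space gen_space \<in> sets gen_space"
    by (rule measurable_sets[OF shape_measurable]) (simp add: assms)
  also have "shape -` {T} \<inter> space gen_space = {z \<in> T_gen. shape z = T}" by (auto simp: space_gen)
  finally have "emeasure gw_environment {z \<in> space gw_environment. shape z = T} =
      (\<integral>\<^sup>+d. \<integral>\<^sup>+X. of_bool (shape (sample d X) = T) \<partial>clocks \<partial>decoration_pmf)"
    by (rule gw_environment_emeasure)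
  also have "\<dots> = (\<integral>\<^sup>+T'. indicator {T} T' \<partial>gw_pmf)"
    by (simp add: decoration_integral C.emeasure_space_1 measure_pmf.emeasure_space_1 indicator_def)
  also have "\<dots> = ennreal (gw_prob T)"
    using assms by (simp add: emeasure_pmf_single pmf_gw gw_prob_eq)
  finally show ?thesis
    by (simp add: measure_def gw_prob_eq assms)
qed

lemma spent_time_law_prob_algebra:
  assumes "plane_tree T"
  shows "spent_time_law T \<in> space (prob_algebra (PiM UNIV (\<lambda>_. borel)))"
  unfolding spent_times_distr[OF assms, symmetric] space_prob_algebra
  by (simp add: prob_space.prob_space_distr[OF prob_space_clocks spent_times_measurable])

lemma spent_time_conditional_law:
  "has_cond_law gw_environment (count_space plane_trees) shape (PiM UNIV (\<lambda>_. borel)) spent spent_time_law"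
  unfolding has_cond_law_def
proof (intro conjI ballI)
  show "shape \<in> gw_environment \<rightarrow>\<^sub>M count_space plane_trees"
    by (rule measurable_gw_environment[OF shape_measurable])
  show "spent \<in> gw_environment \<rightarrow>\<^sub>M PiM UNIV (\<lambda>_. borel)"
    by (rule measurable_gw_environment[OF spents_measurable])
  show "spent_time_law \<in> count_space plane_trees \<rightarrow>\<^sub>M prob_algebra (PiM UNIV (\<lambda>_. borel))"
    by (simp add: spent_time_law_prob_algebra)
  fix A :: "vertex set set" and B :: "(vertex \<Rightarrow> real) set"
  assume A: "A \<in> sets (count_space plane_trees)" and B: "B \<in> sets (PiM UNIV (\<lambda>_. borel))"
  have "(shape -` A \<inter> space gen_space) \<inter> (spent -` B \<inter> space gen_space) \<in> sets gen_space"
    by (intro sets.Int measurable_sets[OF shape_measurable A] measurable_sets[OF spents_measurable B])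
  also have "(shape -` A \<inter> space gen_space) \<inter> (spent -` B \<inter> space gen_space) = {z \<in> T_gen. shape z \<in> A \<and> spent z \<in> B}"
    by (auto simp: space_gen)
  finally have "emeasure gw_environment {z \<in> space gw_environment. shape z \<in> A \<and> spent z \<in> B} =
      (\<integral>\<^sup>+d. \<integral>\<^sup>+X. of_bool (shape (sample d X) \<in> A \<and> spent (sample d X) \<in> B) \<partial>clocks \<partial>decoration_pmf)"
    by (rule gw_environment_emeasure)
  also have "\<dots> = (\<integral>\<^sup>+d. \<integral>\<^sup>+X. indicator A (shape (sample d X)) * emeasure (spent_time_law (shape (sample d X))) B \<partial>clocks \<partial>decoration_pmf)"
  proof (rule nn_integral_cong_AE, rule AE_pmfI)
    fix d assume "d \<in> set_pmf decoration_pmf"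
    then have v: "valid d" by (simp add: set_decoration)
    obtain T \<rho> e where d: "d = (T, \<rho>, e)" by (cases d) auto
    have T: "plane_tree T" using v by (simp add: d valid_def)
    interpret C: prob_space clocks by (rule prob_space_clocks)
    have "(\<integral>\<^sup>+X. of_bool (shape (sample d X) \<in> A \<and> spent (sample d X) \<in> B) \<partial>clocks) =
        (\<integral>\<^sup>+X. indicator A T * indicator B (spent_times T X) \<partial>clocks)"
      by (intro nn_integral_cong) (auto simp: d indicator_def)
    also have "\<dots> = indicator A T * (\<integral>\<^sup>+X. indicator B (spent_times T X) \<partial>clocks)"
      by (rule nn_integral_cmult)
         (rule measurable_compose[OF spent_times_measurable borel_measurable_indicator[OF B]])
    also have "(\<integral>\<^sup>+X. indicator B (spent_times T X) \<partial>clocks) = (\<integral>\<^sup>+s. indicator B s \<partial>distr clocks (PiM UNIV (\<lambda>_. borel)) (spent_times T))"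
      by (rule nn_integral_distr[symmetric, OF spent_times_measurable]) (simp add: borel_measurable_indicator[OF B])
    also have "\<dots> = emeasure (spent_time_law T) B"
      using B by (subst nn_integral_indicator) (simp_all add: spent_times_distr[OF T, symmetric])
    finally show "(\<integral>\<^sup>+X. of_bool (shape (sample d X) \<in> A \<and> spent (sample d X) \<in> B) \<partial>clocks) =
        (\<integral>\<^sup>+X. indicator A (shape (sample d X)) * emeasure (spent_time_law (shape (sample d X))) B \<partial>clocks)"
      by (simp add: d C.emeasure_space_1)
  qed
  also have "\<dots> = (\<integral>\<^sup>+z. indicator A (shape z) * emeasure (spent_time_law (shape z)) B \<partial>gw_environment)"
    by (rule gw_environment_integral[symmetric], rule measurable_compose[OF shape_measurable]) simp
  finally show "emeasure gw_environment {z \<in> space gw_environment. shape z \<in> A \<and> spent z \<in> B} = \<dots>" .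
qed

text \<open>A quantity that is read off the decoration alone is, given the tree, independent of the spent times.\<close>

lemma conditional_law_given_tree:
  fixes Y :: "gstate \<Rightarrow> 'y" and q :: "vertex set \<Rightarrow> 'y pmf"
  assumes Y: "Y \<in> gen_space \<rightarrow>\<^sub>M count_space UNIV"
    and y: "\<And>T \<rho> e X. valid (T, \<rho>, e) \<Longrightarrow> Y (sample (T, \<rho>, e) X) = y T \<rho> e"
    and q: "\<And>T. plane_tree T \<Longrightarrow> map_pmf (\<lambda>(\<rho>, e). y T \<rho> e) (pair_pmf (leaf_pmf T) (choice_pmf T)) = q T"
  shows "has_cond_law gw_environment gtree_space fst (count_space UNIV) Y (\<lambda>(T, s). measure_pmf (q T))"
  unfolding has_cond_law_def
proof (intro conjI ballI)
  show "fst \<in> gw_environment \<rightarrow>\<^sub>M gtree_space"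
    by (rule measurable_gw_environment[OF fst_gen_measurable])
  show "Y \<in> gw_environment \<rightarrow>\<^sub>M count_space UNIV"
    by (rule measurable_gw_environment[OF Y])
  have fstm: "fst \<in> gtree_space \<rightarrow>\<^sub>M count_space plane_trees"
    unfolding gtree_space_def by (rule measurable_fst)
  have "(\<lambda>T. measure_pmf (q T)) \<in> count_space plane_trees \<rightarrow>\<^sub>M prob_algebra (count_space UNIV)"
    by (simp add: space_prob_algebra prob_space_measure_pmf)
  from measurable_compose[OF fstm this]
  show "(\<lambda>(T, s). measure_pmf (q T)) \<in> gtree_space \<rightarrow>\<^sub>M prob_algebra (count_space UNIV)"
    by (simp add: split_beta')
  fix A :: "gtree set" and B :: "'y set" assume A: "A \<in> sets gtree_space"
  have "(fst -` A \<inter> space gen_space) \<inter> (Y -` B \<inter> space gen_space) \<in> sets gen_space"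
    by (intro sets.Int measurable_sets[OF fst_gen_measurable A] measurable_sets[OF Y]) simp
  also have "(fst -` A \<inter> space gen_space) \<inter> (Y -` B \<inter> space gen_space) = {z \<in> T_gen. fst z \<in> A \<and> Y z \<in> B}"
    by (auto simp: space_gen)
  finally have "emeasure gw_environment {z \<in> space gw_environment. fst z \<in> A \<and> Y z \<in> B} =
      (\<integral>\<^sup>+d. \<integral>\<^sup>+X. of_bool (fst (sample d X) \<in> A \<and> Y (sample d X) \<in> B) \<partial>clocks \<partial>decoration_pmf)"
    by (rule gw_environment_emeasure)
  moreover
  define a where "a T = (\<integral>\<^sup>+X. indicator A (T, spent_times T X) \<partial>clocks)" for T
  have am: "(\<lambda>X. indicator A (T, spent_times T X) :: ennreal) \<in> borel_measurable clocks" if "plane_tree T" for T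
  proof -
    have "(\<lambda>X. (T, spent_times T X)) \<in> clocks \<rightarrow>\<^sub>M gtree_space"
      unfolding gtree_space_def using that by (intro measurable_Pair spent_times_measurable) simp
    from measurable_compose[OF this borel_measurable_indicator[OF A]] show ?thesis .
  qed
  have "(\<integral>\<^sup>+d. \<integral>\<^sup>+X. of_bool (fst (sample d X) \<in> A \<and> Y (sample d X) \<in> B) \<partial>clocks \<partial>decoration_pmf) =
      (\<integral>\<^sup>+d. (case d of (T, \<rho>, e) \<Rightarrow> a T * indicator B (y T \<rho> e)) \<partial>decoration_pmf)"
  proof (rule nn_integral_cong_AE, rule AE_pmfI)
    fix d assume "d \<in> set_pmf decoration_pmf"
    then have v: "valid d" by (simp add: set_decoration)
    obtain T \<rho> e where d: "d = (T, \<rho>, e)" by (cases d) auto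
    have T: "plane_tree T" using v by (simp add: d valid_def)
    have "(\<integral>\<^sup>+X. of_bool (fst (sample d X) \<in> A \<and> Y (sample d X) \<in> B) \<partial>clocks) =
        (\<integral>\<^sup>+X. indicator A (T, spent_times T X) * indicator B (y T \<rho> e) \<partial>clocks)"
      using y v by (intro nn_integral_cong) (auto simp: d indicator_def sample_def)
    also have "\<dots> = a T * indicator B (y T \<rho> e)"
      unfolding a_def by (rule nn_integral_multc[OF am[OF T]])
    finally show "(\<integral>\<^sup>+X. of_bool (fst (sample d X) \<in> A \<and> Y (sample d X) \<in> B) \<partial>clocks) =
        (case d of (T, \<rho>, e) \<Rightarrow> a T * indicator B (y T \<rho> e))" by (simp add: d)
  qed
  also have "\<dots> = (\<integral>\<^sup>+T. a T * (\<integral>\<^sup>+w. indicator B ((\<lambda>(\<rho>, e). y T \<rho> e) w) \<partial>pair_pmf (leaf_pmf T) (choice_pmf T)) \<partial>gw_pmf)"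
    by (simp add: decoration_integral nn_integral_pair_pmf' nn_integral_cmult)
  also have "\<dots> = (\<integral>\<^sup>+T. a T * emeasure (q T) B \<partial>gw_pmf)"
  proof (intro nn_integral_cong_AE gw_AE)
    fix T assume T: "plane_tree T"
    have "(\<integral>\<^sup>+w. indicator B ((\<lambda>(\<rho>, e). y T \<rho> e) w) \<partial>pair_pmf (leaf_pmf T) (choice_pmf T)) = (\<integral>\<^sup>+v. indicator B v \<partial>q T)"
      unfolding q[OF T, symmetric] by (rule nn_integral_map_pmf[symmetric])
    then show "a T * (\<integral>\<^sup>+w. indicator B ((\<lambda>(\<rho>, e). y T \<rho> e) w) \<partial>pair_pmf (leaf_pmf T) (choice_pmf T)) = a T * emeasure (q T) B"
      by simp
  qed
  also have "\<dots> = (\<integral>\<^sup>+d. (case d of (T, \<rho>, e) \<Rightarrow> a T * emeasure (q T) B) \<partial>decoration_pmf)"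
    by (simp add: decoration_integral measure_pmf.emeasure_space_1)
  also have "\<dots> = (\<integral>\<^sup>+d. \<integral>\<^sup>+X. indicator A (fst (sample d X)) * emeasure ((\<lambda>(T, s). measure_pmf (q T)) (fst (sample d X))) B \<partial>clocks \<partial>decoration_pmf)"
  proof (rule nn_integral_cong_AE, rule AE_pmfI)
    fix d assume "d \<in> set_pmf decoration_pmf"
    then have v: "valid d" by (simp add: set_decoration)
    obtain T \<rho> e where d: "d = (T, \<rho>, e)" by (cases d) auto
    have T: "plane_tree T" using v by (simp add: d valid_def)
    show "(case d of (T, \<rho>, e) \<Rightarrow> a T * emeasure (q T) B) =
        (\<integral>\<^sup>+X. indicator A (fst (sample d X)) * emeasure ((\<lambda>(T, s). measure_pmf (q T)) (fst (sample d X))) B \<partial>clocks)"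
      by (simp add: d sample_def a_def nn_integral_multc[OF am[OF T]])
  qed
  also have "\<dots> = (\<integral>\<^sup>+z. indicator A (fst z) * emeasure ((\<lambda>(T, s). measure_pmf (q T)) (fst z)) B \<partial>gw_environment)"
  proof (rule gw_environment_integral[symmetric])
    have "(\<lambda>z. emeasure (q (shape z)) B) \<in> borel_measurable gen_space"
      by (rule measurable_compose[OF shape_measurable]) simp
    moreover have "(\<lambda>z. indicator A (fst z) :: ennreal) \<in> borel_measurable gen_space"
      by (rule measurable_compose[OF fst_gen_measurable borel_measurable_indicator[OF A]])
    ultimately show "(\<lambda>z. indicator A (fst z) * emeasure ((\<lambda>(T, s). measure_pmf (q T)) (fst z)) B) \<in> borel_measurable gen_space"
      by (simp add: split_beta)
  qed
  ultimately show "emeasure gw_environment {z \<in> space gw_environment. fst z \<in> A \<and> Y z \<in> B} =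
      (\<integral>\<^sup>+z. indicator A (fst z) * emeasure ((\<lambda>(T, s). measure_pmf (q T)) (fst z)) B \<partial>gw_environment)"
    by (rule trans)
qed

lemma crossing_edge_sample: "valid (T, \<rho>, e) \<Longrightarrow> crossing_edge (sample (T, \<rho>, e) X) = e"
  by (simp add: valid_def sample_def crossing_edge_tree_cluster)

lemma root_conditional_law:
  "has_cond_law gw_environment gtree_space fst (count_space UNIV) (\<lambda>z. root_of (cluster z))
    (\<lambda>(T, s). measure_pmf (pmf_of_set (leaves T)))"
proof (rule conditional_law_given_tree[where y = "\<lambda>T \<rho> e. \<rho>"])
  show "(\<lambda>z. root_of (cluster z)) \<in> gen_space \<rightarrow>\<^sub>M count_space UNIV"
    by (rule discrete_part_measurable[where F = "\<lambda>T C. root_of C"]) simp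
  show "map_pmf (\<lambda>(\<rho>, e). \<rho>) (pair_pmf (leaf_pmf T) (choice_pmf T)) = leaf_pmf T" for T
    using map_fst_pair_pmf[of "leaf_pmf T" "choice_pmf T"] by (simp add: case_prod_unfold)
qed simp

lemma root_and_edges_conditional_law:
  "has_cond_law gw_environment gtree_space fst (count_space UNIV) (\<lambda>z. (root_of (cluster z), crossing_edge z))
    (\<lambda>(T, s). measure_pmf (pair_pmf (pmf_of_set (leaves T)) (crossing_edges_law T)))"
proof (rule conditional_law_given_tree[where y = "\<lambda>T \<rho> e. (\<rho>, e)"])
  have "crossing_edge z = crossing_edge ((shape z, \<lambda>_. 0), cluster z)" for z
    by (simp add: crossing_edge_def fun_eq_iff)
  then show "(\<lambda>z. (root_of (cluster z), crossing_edge z)) \<in> gen_space \<rightarrow>\<^sub>M count_space UNIV"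
    using discrete_part_measurable[where F = "\<lambda>T C. (root_of C, crossing_edge ((T, \<lambda>_. 0), C))" and B = UNIV] by simp
  show "(root_of (cluster (sample (T, \<rho>, e) X)), crossing_edge (sample (T, \<rho>, e) X)) = (\<rho>, e)" if "valid (T, \<rho>, e)" for T \<rho> e X
    using crossing_edge_sample[OF that] by simp
  show "map_pmf (\<lambda>(\<rho>, e). (\<rho>, e)) (pair_pmf (leaf_pmf T) (choice_pmf T)) = pair_pmf (leaf_pmf T) (crossing_edges_law T)"
    if "plane_tree T" for T
    using crossing_edges_law_uniform[OF that] by simp
qed

lemma unique_crossing_edges:
  "AE z in gw_environment. \<forall>x\<in>nonleaves (shape z). \<exists>!e. e \<in> edges (cluster z) \<and>
     (\<exists>a b. e = {a, b} \<and> joins_subtrees (shape z) x (a, b))" (is "AE z in _. ?P z")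
proof -
  have P: "Measurable.pred gen_space ?P"
    by (rule discrete_part_measurable[where F = "\<lambda>T C. \<forall>x\<in>nonleaves T. \<exists>!e. e \<in> edges C \<and>
     (\<exists>a b. e = {a, b} \<and> joins_subtrees T x (a, b))"]) simp
  have "AE z in sample_law d. ?P z" if "valid d" for d
  proof -
    obtain T \<rho> e where d: "d = (T, \<rho>, e)" by (cases d) auto
    have set: "{z \<in> space gen_space. ?P z} \<in> sets gen_space" using P by simp
    have "?P (sample d X)" for X
      using that unique_crossing_edge by (simp add: d valid_def)
    then show ?thesis
      unfolding sample_law_def using that
      by (simp only: if_True AE_distr_iff[OF sample_measurable[OF that] set]) simp
  qed
  then have "AE d in decoration_pmf. AE z in sample_law d. ?P z"
    by (intro AE_pmfI) (simp add: set_decoration)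
  then show ?thesis
    unfolding gw_environment_def by (simp only: AE_bind[OF sample_law_measurable P])
qed

theorem proposition3:
  shows "(\<exists>!V. steady_environment V) \<and>
    (\<forall>V. steady_environment V \<longrightarrow>
      (\<forall>T. plane_tree T \<longrightarrow> measure V {z \<in> space V. shape z = T} = gw_prob T) \<and>
      has_cond_law V (count_space {T. plane_tree T}) shape
        (PiM UNIV (\<lambda>_. borel)) spent spent_time_law \<and>
      distr V (count_space iso_classes) (\<lambda>z. iso_class (cluster z)) = W0 \<and>
      has_cond_law V gtree_space fst (count_space UNIV) (\<lambda>z. root_of (cluster z))
        (\<lambda>(T, s). measure_pmf (pmf_of_set (leaves T))) \<and>
      (AE z in V. \<forall>x\<in>nonleaves (shape z). \<exists>!e. e \<in> edges (cluster z) \<and>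
         (\<exists>a b. e = {a, b} \<and> joins_subtrees (shape z) x (a, b))) \<and>
      has_cond_law V gtree_space fst (count_space UNIV)
        (\<lambda>z. (root_of (cluster z), crossing_edge z))
        (\<lambda>(T, s). measure_pmf (pair_pmf (pmf_of_set (leaves T)) (crossing_edges_law T))))"
proof -
  have unique: "V = gw_environment" if "steady_environment V" for V
    using that gw_environment_balanced gen.balanced_unique
    unfolding steady_environment_iff_balanced by blast
  have steady: "steady_environment gw_environment"
    using gw_environment_balanced by (simp only: steady_environment_iff_balanced)
  have W0: "distr gw_environment classes (\<lambda>z. iso_class (cluster z)) = W0"
    using balanced_cluster_law_is_W0[OF gw_environment_balanced] by (simp only: cluster_class_def[abs_def])
  have ex: "\<exists>!V. steady_environment V"
    using steady unique by (rule ex1I)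
  show ?thesis
    by (intro conjI allI impI; (rule ex |
        (drule unique, hypsubst, (erule shape_law | rule spent_time_conditional_law W0 root_conditional_law
          unique_crossing_edges root_and_edges_conditional_law))))
qed

end
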